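(* Let $i,j,k\ge0$ be integers with $k\le i+j$. Then for all $c\ge0$, $$(i\mathrm{EXP})^{(j\mathrm{EXP})^{\Sigma^p_c}}\subseteq ((i+j)\mathrm{EXP})^{\Sigma^p_c}\subseteq (k\mathrm{EXP})^{((i+j-k)\mathrm{EXP})^{\Sigma^p_c}[1]}.$$
   Context: $\Sigma=\{0,1\}$. For an integer $i$, $\exp_i(x)$ denotes the iterated exponential: $\exp_0(x)=x$, $\exp_i(x)=2^{\exp_{i-1}(x)}$ for $i>0$, and $\exp_{-i}(x)=\log_2\cdots\log_2 x$ ($i$ times) for $i>0$. For $i\ge0$, $i\mathrm{EXP}=\bigcup_{k\ge1}\mathrm{DTIME}(\exp_i(n^k))$ and $\mathrm{N}i\mathrm{EXP}=\bigcup_{k\ge1}\mathrm{NTIME}(\exp_i(n^k))$; for $j\ge-1$, $j\mathrm{EXPSPACE}=\bigcup_{k\ge1}\mathrm{DSPACE}(\exp_j(n^k))$. Thus $0\mathrm{EXP}=\mathrm P$, $\mathrm N0\mathrm{EXP}=\mathrm{NP}$, $1\mathrm{EXP}=\mathrm{EXP}$, $\mathrm N1\mathrm{EXP}=\mathrm{NEXP}$, $(-1)\mathrm{EXPSPACE}=\mathrm{LOGSPACE}$, $0\mathrm{EXPSPACE}=\mathrm{PSPACE}$. $\Sigma^p_c$ is the $c$-th level of the polynomial hierarchy ($\Sigma^p_0=\mathrm P$, $\Sigma^p_{c+1}=\mathrm{NP}^{\Sigma^p_c}$). For complexity classes $\mathcal C,\mathcal D$, $\mathcal C^{\mathcal D}$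 is the class of languages decided by oracle machines of the kind and resource bound of $\mathcal C$ (bounds measured in the input length; each query costs one step) with an oracle for some language in $\mathcal D$; $\mathcal C^{\mathcal D^{\mathcal E}}$ means $\mathcal C^{(\mathcal D^{\mathcal E})}$. $\mathcal C^{\mathcal D[f(n)]}$ restricts the machine to at most $f(n)$ (adaptive) queries on inputs of length $n$; for a constant $k$, $[k]$ means at most $k$ queries. *)

theory Defs
  imports Main
begin

fun exp_it :: "nat \<Rightarrow> nat \<Rightarrow> nat" where
  "exp_it 0 x = x"
| "exp_it (Suc i) x = 2 ^ exp_it i x"

text \<open>A (possibly nondeterministic) single-work-tape oracle Turing machine over
  alphabet {0,1}.  Tape symbols are naturals: 0 = blank, 1 encodes bit False (0),
  2 encodes bit True (1).  Besides the work tape the machine has an append-only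
  query tape of bits.  Entering state qry is a query: in one step the machine moves
  to state yes if the query tape content is in the oracle, to state no otherwise,
  and the query tape is erased.  States acc and rej are halting.\<close>

datatype move = MvL | MvR | MvS

record machine =
  delta :: "((nat \<times> nat) \<times> (nat \<times> nat \<times> move \<times> bool option)) set"
  start :: nat
  acc :: nat
  rej :: nat
  qry :: nat
  yes :: nat
  no :: nat

record config =
  st :: nat
  tp :: "int \<Rightarrow> nat"
  hp :: int
  qt :: "bool list"

definition wf_machine :: "machine \<Rightarrow> bool" where
  "wf_machine M \<longleftrightarrow> finite (delta M) \<and> acc M \<noteq> rej M \<and> qry M \<noteq> acc M \<and> qry M \<noteq> rej M"

definition deterministic :: "machine \<Rightarrow> bool" where
  "deterministic M \<longleftrightarrow> (\<forall>qa t1 t2. (qa, t1) \<in> delta M \<longrightarrow> (qa, t2) \<in> delta M \<longrightarrow> t1 = t2)"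

fun mv :: "move \<Rightarrow> int" where
  "mv MvL = -1" | "mv MvR = 1" | "mv MvS = 0"

fun bitsym :: "bool \<Rightarrow> nat" where
  "bitsym False = 1" | "bitsym True = 2"

definition init_config :: "machine \<Rightarrow> bool list \<Rightarrow> config" where
  "init_config M x = \<lparr> st = start M,
     tp = (\<lambda>p. if 0 \<le> p \<and> p < int (length x) then bitsym (x ! nat p) else 0),
     hp = 0, qt = [] \<rparr>"

inductive step :: "machine \<Rightarrow> bool list set \<Rightarrow> config \<Rightarrow> config \<Rightarrow> bool" where
  query: "st c = qry M \<Longrightarrow>
     step M Or c \<lparr> st = (if qt c \<in> Or then yes M else no M), tp = tp c, hp = hp c, qt = [] \<rparr>"
| trans: "st c \<notin> {acc M, rej M, qry M} \<Longrightarrow>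
     ((st c, tp c (hp c)), (q', b, d, w)) \<in> delta M \<Longrightarrow>
     step M Or c \<lparr> st = q', tp = (tp c)(hp c := b), hp = hp c + mv d,
                  qt = qt c @ (case w of None \<Rightarrow> [] | Some a \<Rightarrow> [a]) \<rparr>"

inductive steps :: "machine \<Rightarrow> bool list set \<Rightarrow> config \<Rightarrow> nat \<Rightarrow> nat \<Rightarrow> config \<Rightarrow> bool" where
  refl: "steps M Or c 0 0 c"
| stepI: "step M Or c c'' \<Longrightarrow> steps M Or c'' n m c' \<Longrightarrow>
     steps M Or c (Suc n) (m + (if st c = qry M then 1 else 0)) c'"

definition decides :: "machine \<Rightarrow> bool list set \<Rightarrow> (nat \<Rightarrow> nat) \<Rightarrow> (nat \<Rightarrow> nat) \<Rightarrow> bool list set \<Rightarrow> bool" where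
  "decides M Or T Q L \<longleftrightarrow>
     (\<forall>x. (\<forall>n m c'. steps M Or (init_config M x) n m c' \<longrightarrow> n \<le> T (length x) \<and> m \<le> Q (length x))
        \<and> (x \<in> L \<longleftrightarrow> (\<exists>n m c'. steps M Or (init_config M x) n m c' \<and> st c' = acc M)))"

text \<open>Relativized classes with time bound Or(exp_i(n^k)) for some k \<ge> 1:
  oracle machines (deterministic unless nondet) with an oracle from the class D;
  qb = Some q restricts to at most q queries, None means unrestricted.\<close>
definition OClass :: "bool \<Rightarrow> nat \<Rightarrow> nat option \<Rightarrow> bool list set set \<Rightarrow> bool list set set" where
  "OClass nondet i qb D = {L. \<exists>Or\<in>D. \<exists>k\<ge>1. \<exists>M. wf_machine M \<and> (\<not> nondet \<longrightarrow> deterministic M) \<and>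
      decides M Or (\<lambda>n. k * exp_it i (n ^ k) + k)
        (\<lambda>n. case qb of None \<Rightarrow> k * exp_it i (n ^ k) + k | Some q \<Rightarrow> q) L}"

abbreviation DEXP_rel :: "nat \<Rightarrow> bool list set set \<Rightarrow> bool list set set" where
  "DEXP_rel i D \<equiv> OClass False i None D"

abbreviation DEXP_rel_q :: "nat \<Rightarrow> nat \<Rightarrow> bool list set set \<Rightarrow> bool list set set" where
  "DEXP_rel_q i q D \<equiv> OClass False i (Some q) D"

text \<open>Polynomial hierarchy: Sigma_0 = P (machines with the empty oracle, i.e. no
  useful oracle), Sigma_{c+1} = NP^{Sigma_c}.\<close>
fun SigmaP :: "nat \<Rightarrow> bool list set set" where
  "SigmaP 0 = OClass False 0 None {{}}"
| "SigmaP (Suc c) = OClass True 0 None (SigmaP c)"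

end

(* Stack programs with a cost semantics are compiled to single-tape oracle machines with polynomial
   slowdown (one track for each stack), so that machines can be composed as programs.
   For the first inclusion, one program simulates the outer machine and answers each of its queries
   by simulating the machine for the oracle.
   For the second inclusion, the query on input x of length n is x 1 0^m with m = exp_k((n+1)^K).
   The oracle recognises a sufficiently long padding in polynomial time by taking k discrete
   logarithms of m and comparing with (n+1)^K; a simulation in time exp_(i+j)(n^K) is then one in
   time exp_(i+j-k)(m). *)

theory Submission
  imports Defs "HOL-Library.Nat_Bijection" "HOL-Library.Discrete_Functions"
begin

section \<open>Runs of deterministic machines\<close>

text \<open>The program layer pays off because costs of programs add under composition. A stack
  never exceeds its initial height plus the cost spent, so one instruction is one sweep over the
  tape of at most that length up to a factor; the resulting quadratic loss vanishes because
  \<open>exp_it i a ^ k \<le> exp_it i (a ^ k)\<close>. The levels \<open>i\<close> and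
  \<open>j\<close> add because the query tape is append-only: a query is no longer than the time
  spent, so the inner machine runs on inputs of length up to exp_i of a polynomial. Only a query
  erases the query tape, so each inner simulation ends with a query whose answer is ignored; in the
  first inclusion the time bound covers it. In the second inclusion the oracle cannot test the
  padding by computing exp_k, whose value may be far longer than an ill-formed word; logarithms only
  shrink. Both arguments hand the innermost oracle on unchanged, so they are carried out for an
  arbitrary class \<open>D\<close>.\<close>

lemma steps_trans:
  assumes "steps M Or a n m b" "steps M Or b n' m' c"
  shows "steps M Or a (n + n') (m + m') c"
  using assms
proof (induction rule: steps.induct)
  case (stepI M Or a a' n m b)
  then show ?case
    using steps.stepI[of M Or a a' "n + n'" "m + m'" c] by (simp add: ac_simps)
qed simp

lemma steps_one:
  "step M Or a b \<Longrightarrow> steps M Or a 1 (if st a = qry M then 1 else 0) b"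
  using steps.stepI[OF _ steps.refl] by fastforce

lemma step_deterministic:
  assumes "deterministic M" "step M Or a b" "step M Or a b'"
  shows "b = b'"
proof (cases "st a = qry M")
  case True
  then show ?thesis using assms(2,3) by (auto elim!: step.cases)
next
  case False
  then obtain t1 t2 where "((st a, tp a (hp a)), t1) \<in> delta M" "((st a, tp a (hp a)), t2) \<in> delta M"
    and *: "b = (case t1 of (q', b, d, w) \<Rightarrow> \<lparr> st = q', tp = (tp a)(hp a := b), hp = hp a + mv d,
                  qt = qt a @ (case w of None \<Rightarrow> [] | Some a \<Rightarrow> [a]) \<rparr>)"
      "b' = (case t2 of (q', b, d, w) \<Rightarrow> \<lparr> st = q', tp = (tp a)(hp a := b), hp = hp a + mv d,
                  qt = qt a @ (case w of None \<Rightarrow> [] | Some a \<Rightarrow> [a]) \<rparr>)"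
    using assms(2,3) by (fastforce elim!: step.cases)
  then have "t1 = t2" using assms(1) unfolding deterministic_def by blast
  then show ?thesis using * by simp
qed

lemma halted_no_step:
  assumes "wf_machine M" "st c \<in> {acc M, rej M}"
  shows "\<not> step M Or c c'"
  using assms by (auto elim!: step.cases simp: wf_machine_def)

text \<open>Determinism makes every run an initial segment of the run that gets stuck, so one
  maximal run settles the bounds that \<open>decides\<close> imposes on all runs.\<close>

lemma steps_stuck_unique:
  assumes "deterministic M" "steps M Or a n m b" "\<And>b'. \<not> step M Or b b'"
    "steps M Or a n' m' c"
  shows "n' \<le> n \<and> m' \<le> m \<and> ((\<forall>c'. \<not> step M Or c c') \<longrightarrow> c = b)"
  using assms(2,1,3,4)
proof (induction arbitrary: n' m' c rule: steps.induct)
  case (refl M Or a)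
  from refl(3) show ?case by cases (use refl in auto)
next
  case (stepI M Or a a' n m b)
  from stepI.prems(3) show ?case
  proof cases
    case refl
    then show ?thesis using stepI.hyps(1) by (metis le0)
  next
    case (stepI a'' n'' m'')
    then have "a'' = a'" using step_deterministic stepI.hyps stepI.prems by metis
    then show ?thesis using stepI.IH[OF stepI.prems(1,2), of n'' m'' c] local.stepI by auto
  qed
qed

lemma decidesI:
  assumes "wf_machine M" "deterministic M"
    "\<And>x. \<exists>n m c. steps M Or (init_config M x) n m c \<and> n \<le> T (length x) \<and> m \<le> Q (length x)
        \<and> (st c = acc M \<or> st c = rej M) \<and> (st c = acc M \<longleftrightarrow> x \<in> L)"
  shows "decides M Or T Q L"
  unfolding decides_def
proof (intro allI conjI)
  fix x
  obtain n m c where run: "steps M Or (init_config M x) n m c"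
    and b: "n \<le> T (length x)" "m \<le> Q (length x)"
    and h: "st c = acc M \<or> st c = rej M" "st c = acc M \<longleftrightarrow> x \<in> L"
    using assms(3) by blast
  have stuck: "\<not> step M Or c c'" for c' using halted_no_step[OF assms(1)] h(1) by blast
  note u = steps_stuck_unique[OF assms(2) run stuck]
  show "\<And>n' m' c'. steps M Or (init_config M x) n' m' c' \<longrightarrow> n' \<le> T (length x) \<and> m' \<le> Q (length x)"
    using u b by (meson order_trans)
  show "x \<in> L \<longleftrightarrow> (\<exists>n m c'. steps M Or (init_config M x) n m c' \<and> st c' = acc M)"
    using u run h halted_no_step[OF assms(1)] by (metis insertCI)
qed

text \<open>A rejecting run may end for want of a transition instead of in \<open>rej\<close>, so
  halting is understood as having no successor. Since \<open>T\<close> bounds the length of all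
  runs, a longest one exists, and it ends in such a configuration.\<close>

lemma decides_stuck_run:
  assumes "wf_machine M" "deterministic M" "decides M Or T Q L"
  obtains n m c where "steps M Or (init_config M x) n m c" "n \<le> T (length x)"
    "\<And>c'. \<not> step M Or c c'" "st c = acc M \<longleftrightarrow> x \<in> L"
proof -
  let ?P = "\<lambda>n. \<exists>m c. steps M Or (init_config M x) n m c"
  have bd: "?P n \<Longrightarrow> n \<le> T (length x)" for n
    using assms(3) unfolding decides_def by blast
  have "?P 0" using steps.refl by blast
  then obtain n where n: "?P n" "\<And>n'. ?P n' \<Longrightarrow> n' \<le> n"
    using Nat.ex_has_greatest_nat[of ?P 0 "T (length x)"] bd by blast
  then obtain m c where run: "steps M Or (init_config M x) n m c" by blast
  have stuck: "\<not> step M Or c c'" for c'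
  proof
    assume "step M Or c c'"
    then have "?P (n + 1)" using steps_trans[OF run steps_one] by blast
    then show False using n(2) by fastforce
  qed
  have "st c = acc M \<longleftrightarrow> x \<in> L"
  proof
    assume "x \<in> L"
    then obtain n' m' c' where c': "steps M Or (init_config M x) n' m' c'" "st c' = acc M"
      using assms(3) unfolding decides_def by blast
    then have "c' = c" using steps_stuck_unique[OF assms(2) run stuck c'(1)]
        halted_no_step[OF assms(1)] by blast
    then show "st c = acc M" using c' by simp
  qed (use assms(3) run in \<open>auto simp: decides_def\<close>)
  then show thesis using that run stuck bd n(1) by blast
qed

section \<open>Stack programs\<close>

text \<open>Every command is chosen so that it compiles to boundedly many instructions besides its
  subprograms, each of them local or a single sweep over the tape. The number 0 as a top symbol
  means the empty stack.\<close>

datatype com =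
    Skip
  | Push nat nat
  | Pop nat
  | Emit bool
  | Seq com com (infixr ";;" 60)
  | IfTop nat nat com com
  | While nat com
  | IfQ com com

definition topsym :: "nat list \<Rightarrow> nat" where
  "topsym l = (case l of [] \<Rightarrow> 0 | a # _ \<Rightarrow> a)"

lemma topsym_simps [simp]: "topsym [] = 0" "topsym (a # l) = a"
  by (auto simp: topsym_def)

text \<open>In \<^term>\<open>exec Or c t m S w S' w'\<close> the number \<^term>\<open>t\<close> is only an upper bound for the cost,
  whereas \<^term>\<open>m\<close> is the exact number of queries.\<close>

inductive exec :: "bool list set \<Rightarrow> com \<Rightarrow> nat \<Rightarrow> nat \<Rightarrow> (nat \<Rightarrow> nat list) \<Rightarrow> bool list
    \<Rightarrow> (nat \<Rightarrow> nat list) \<Rightarrow> bool list \<Rightarrow> bool" for Or where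
  Skip: "exec Or Skip 0 0 S w S w"
| Push: "exec Or (Push s a) 1 0 S w (S(s := a # S s)) w"
| Pop: "exec Or (Pop s) 1 0 S w (S(s := tl (S s))) w"
| Emit: "exec Or (Emit b) 1 0 S w S (w @ [b])"
| Seq: "exec Or c1 t1 m1 S w S1 w1 \<Longrightarrow> exec Or c2 t2 m2 S1 w1 S2 w2 \<Longrightarrow>
    exec Or (c1 ;; c2) (t1 + t2) (m1 + m2) S w S2 w2"
| IfT: "topsym (S s) = a \<Longrightarrow> exec Or c1 t m S w S1 w1 \<Longrightarrow>
    exec Or (IfTop s a c1 c2) (t + 2) m S w S1 w1"
| IfF: "topsym (S s) \<noteq> a \<Longrightarrow> exec Or c2 t m S w S1 w1 \<Longrightarrow>
    exec Or (IfTop s a c1 c2) (t + 2) m S w S1 w1"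
| WhileEnd: "S s = [] \<Longrightarrow> exec Or (While s c) 2 0 S w S w"
| WhileStep: "S s \<noteq> [] \<Longrightarrow> exec Or c t1 m1 S w S1 w1 \<Longrightarrow>
    exec Or (While s c) t2 m2 S1 w1 S2 w2 \<Longrightarrow>
    exec Or (While s c) (t1 + t2 + 2) (m1 + m2) S w S2 w2"
| QueryT: "w \<in> Or \<Longrightarrow> exec Or c1 t m S [] S1 w1 \<Longrightarrow> exec Or (IfQ c1 c2) (t + 2) (Suc m) S w S1 w1"
| QueryF: "w \<notin> Or \<Longrightarrow> exec Or c2 t m S [] S1 w1 \<Longrightarrow> exec Or (IfQ c1 c2) (t + 2) (Suc m) S w S1 w1"
| Weaken: "exec Or c t m S w S1 w1 \<Longrightarrow> t \<le> t' \<Longrightarrow> exec Or c t' m S w S1 w1"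

fun wf_com :: "nat \<Rightarrow> nat \<Rightarrow> com \<Rightarrow> bool" where
  "wf_com m B Skip \<longleftrightarrow> True"
| "wf_com m B (Push s a) \<longleftrightarrow> s < m \<and> 0 < a \<and> a < B"
| "wf_com m B (Pop s) \<longleftrightarrow> s < m"
| "wf_com m B (Emit b) \<longleftrightarrow> True"
| "wf_com m B (c1 ;; c2) \<longleftrightarrow> wf_com m B c1 \<and> wf_com m B c2"
| "wf_com m B (IfTop s a c1 c2) \<longleftrightarrow> s < m \<and> wf_com m B c1 \<and> wf_com m B c2"
| "wf_com m B (While s c) \<longleftrightarrow> s < m \<and> wf_com m B c"
| "wf_com m B (IfQ c1 c2) \<longleftrightarrow> wf_com m B c1 \<and> wf_com m B c2"

text \<open>Only a push raises a stack, and it costs one unit. This bounds the length of the sweeps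
  of the compiled machine by the cost.\<close>

lemma exec_height: "exec Or c t m S w S' w' \<Longrightarrow> length (S' s) \<le> length (S s) + t"
  by (induction rule: exec.induct) auto

text \<open>Classes with unrestricted queries still carry a query bound in \<open>decides\<close>;
  this lets the time bound play that part.\<close>

lemma exec_queries_le: "exec Or c t m S w S' w' \<Longrightarrow> m \<le> t"
  by (induction rule: exec.induct) auto

text \<open>0 is reserved: it marks a vacant entry of a track and is the value of
  \<open>topsym\<close> on an empty stack.\<close>

definition good :: "nat \<Rightarrow> nat \<Rightarrow> (nat \<Rightarrow> nat list) \<Rightarrow> bool" where
  "good m B S \<longleftrightarrow> (\<forall>s<m. set (S s) \<subseteq> {0<..<B})"

lemma good_mem: "good m B S \<Longrightarrow> s < m \<Longrightarrow> a \<in> set (S s) \<Longrightarrow> 0 < a \<and> a < B"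
  by (fastforce simp: good_def)

lemma exec_good: "exec Or c t q S w S' w' \<Longrightarrow> wf_com m B c \<Longrightarrow> good m B S \<Longrightarrow> good m B S'"
proof (induction rule: exec.induct)
  case (Pop s S w)
  moreover have "set (tl (S s)) \<subseteq> set (S s)" by (cases "S s") auto
  ultimately show ?case by (auto simp: good_def)
qed (auto simp: good_def)

section \<open>Compilation to single-tape machines\<close>

text \<open>\<open>ITest s a e\<close> and \<open>IQuery e\<close> fall through to the next
  instruction on success and jump to \<open>e\<close> otherwise.\<close>

datatype instr = IPush nat nat | IPop nat | IEmit bool | ITest nat nat nat | IJump nat
  | IQuery nat | IHalt bool

text \<open>The number is the absolute address at which the code is placed. In a loop the test
  against 0 succeeds on the empty stack, so the instruction right after the test is the exit
  jump.\<close>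

fun comp :: "com \<Rightarrow> nat \<Rightarrow> instr list" where
  "comp Skip p = []"
| "comp (Push s a) p = [IPush s a]"
| "comp (Pop s) p = [IPop s]"
| "comp (Emit b) p = [IEmit b]"
| "comp (c1 ;; c2) p = (let x = comp c1 p in x @ comp c2 (p + length x))"
| "comp (IfTop s a c1 c2) p = (let x = comp c1 (p + 1); y = comp c2 (p + 2 + length x) in
     ITest s a (p + 2 + length x) # x @ IJump (p + 2 + length x + length y) # y)"
| "comp (While s c) p = (let x = comp c (p + 2) in
     ITest s 0 (p + 2) # IJump (p + 3 + length x) # x @ [IJump p])"
| "comp (IfQ c1 c2) p = (let x = comp c1 (p + 1); y = comp c2 (p + 2 + length x) in
     IQuery (p + 2 + length x) # x @ IJump (p + 2 + length x + length y) # y)"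

text \<open>The phase in \<open>At pc ph\<close> is the memory needed within one instruction: 0
  while searching for the first vacant entry of a track, a positive number after it has been found.
  In a test, 2 and 3 carry the outcome back to the marker.\<close>

datatype tst = Acc | Rej | Qry | Yes | No | Init0 | Init1 | At nat nat

fun sc :: "tst \<Rightarrow> nat" where
  "sc Acc = 0" | "sc Rej = 1" | "sc Qry = 2" | "sc Yes = 3" | "sc No = 4"
| "sc Init0 = 5" | "sc Init1 = 6" | "sc (At pc ph) = 7 + prod_encode (pc, ph)"

lemma sc_inject [simp]: "sc a = sc b \<longleftrightarrow> a = b"
  by (cases a; cases b) auto

text \<open>A list of length 1 is the marker at cell \<open>-1\<close>; its entry is 0, or \<open>Suc pc\<close> while the
  query issued at \<open>pc\<close> is pending.  All other cells hold one symbol for each stack.\<close>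

fun at_step :: "instr \<Rightarrow> nat \<Rightarrow> nat \<Rightarrow> nat list \<Rightarrow> tst \<times> nat list \<times> move \<times> bool option" where
  "at_step (IPush s a) pc ph l =
     (if ph = 0 then if length l = 1 \<or> l ! s \<noteq> 0 then (At pc 0, l, MvR, None)
        else (At pc 1, l[s := a], MvL, None)
      else if length l = 1 then (At (pc + 1) 0, l, MvS, None) else (At pc ph, l, MvL, None))"
| "at_step (IPop s) pc ph l =
     (if ph = 0 then if length l = 1 \<or> l ! s \<noteq> 0 then (At pc 0, l, MvR, None)
        else (At pc 1, l, MvL, None)
      else if length l = 1 then (At (pc + 1) 0, l, MvS, None)
      else if ph = 1 then (At pc 2, l[s := 0], MvL, None)
      else (At pc ph, l, MvL, None))"
| "at_step (ITest s a e) pc ph l =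
     (if ph = 0 then if length l = 1 \<or> l ! s \<noteq> 0 then (At pc 0, l, MvR, None)
        else (At pc 1, l, MvL, None)
      else if ph = 1 then if length l = 1 then (At (if a = 0 then pc + 1 else e) 0, l, MvS, None)
        else (At pc (if l ! s = a then 2 else 3), l, MvL, None)
      else if length l = 1 then (At (if ph = 2 then pc + 1 else e) 0, l, MvS, None)
      else (At pc ph, l, MvL, None))"
| "at_step (IEmit b) pc ph l = (At (pc + 1) 0, l, MvS, Some b)"
| "at_step (IJump e) pc ph l = (At e 0, l, MvS, None)"
| "at_step (IQuery e) pc ph l = (Qry, [pc + 1], MvS, None)"
| "at_step (IHalt b) pc ph l = (if b then Acc else Rej, l, MvS, None)"

text \<open>The oracle step leads to a fixed state and so loses the program counter;
  \<open>Yes\<close> and \<open>No\<close> recover it from the marker and clear the marker. The two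
  initial states only write the marker to the left of the input.\<close>

fun nxt :: "instr list \<Rightarrow> tst \<Rightarrow> nat list \<Rightarrow> tst \<times> nat list \<times> move \<times> bool option" where
  "nxt P Init0 l = (Init1, l, MvL, None)"
| "nxt P Init1 l = (At 0 0, [0], MvS, None)"
| "nxt P Yes l = (At (hd l) 0, [0], MvS, None)"
| "nxt P No l = (At (case P ! (hd l - 1) of IQuery e \<Rightarrow> e | _ \<Rightarrow> 0) 0, [0], MvS, None)"
| "nxt P (At pc ph) l = at_step (P ! pc) pc ph l"
| "nxt P _ l = (Rej, l, MvS, None)"

text \<open>The codes 0, 1, 2 go to the vacant cell and to the cells with just an input bit on track
  0. Thus the initial tape already represents the input as stack 0. The shift by 3 keeps all other
  codes apart from these.\<close>

definition enc :: "nat \<Rightarrow> nat list \<Rightarrow> nat" where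
  "enc m l = (if l = replicate m 0 then 0 else if l = (replicate m 0)[0 := 1] then 1
     else if l = (replicate m 0)[0 := 2] then 2 else 3 + list_encode l)"

lemma enc_inject [simp]: "enc m l = enc m l' \<longleftrightarrow> l = l'"
  by (auto simp: enc_def dest: inj_onD[OF inj_list_encode[of UNIV]] split: if_splits)

definition syms :: "instr list \<Rightarrow> nat \<Rightarrow> nat \<Rightarrow> nat list set" where
  "syms P m B = {l. set l \<subseteq> {..<B} \<and> length l = m} \<union> (\<lambda>r. [r]) ` {..length P}"

definition ctrl :: "instr list \<Rightarrow> tst set" where
  "ctrl P = {Yes, No, Init0, Init1} \<union> (\<lambda>(pc, ph). At pc ph) ` ({..<length P} \<times> {..<4})"

fun out :: "nat \<Rightarrow> tst \<times> nat list \<times> move \<times> bool option \<Rightarrow> nat \<times> nat \<times> move \<times> bool option" where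
  "out m (q, l, d, w) = (sc q, enc m l, d, w)"

definition mach :: "instr list \<Rightarrow> nat \<Rightarrow> nat \<Rightarrow> machine" where
  "mach P m B = \<lparr> delta = (\<lambda>(q, l). ((sc q, enc m l), out m (nxt P q l))) ` (ctrl P \<times> syms P m B),
     start = sc Init0, acc = sc Acc, rej = sc Rej, qry = sc Qry, yes = sc Yes, no = sc No \<rparr>"

lemma mach_simps [simp]: "start (mach P m B) = sc Init0" "acc (mach P m B) = sc Acc"
  "rej (mach P m B) = sc Rej" "qry (mach P m B) = sc Qry" "yes (mach P m B) = sc Yes"
  "no (mach P m B) = sc No"
  by (simp_all add: mach_def del: sc.simps)

declare sc.simps [simp del]

lemma wf_mach: "wf_machine (mach P m B)"
proof -
  have "finite (ctrl P)" "finite (syms P m B)"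
    by (auto simp: ctrl_def syms_def intro: finite_lists_length_eq)
  then show ?thesis by (simp add: wf_machine_def) (simp add: mach_def)
qed

text \<open>\<open>sc\<close> and \<open>enc\<close> are injective, so a key of the table determines
  the abstract state and cell from which its entry was computed.\<close>

lemma deterministic_mach: "deterministic (mach P m B)"
proof -
  have "t1 = t2" if 1: "(x, t1) \<in> delta (mach P m B)" and 2: "(x, t2) \<in> delta (mach P m B)" for x t1 t2
  proof -
    obtain q l where 3: "x = (sc q, enc m l)" "t1 = out m (nxt P q l)"
      using 1 by (auto simp: mach_def)
    obtain q' l' where 4: "x = (sc q', enc m l')" "t2 = out m (nxt P q' l')"
      using 2 by (auto simp: mach_def)
    show ?thesis using 3 4 by simp
  qed
  then show ?thesis unfolding deterministic_def by blast
qed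

section \<open>Stacks as tracks of the tape\<close>

text \<open>The \<open>rev\<close> puts the bottom of every stack at cell 0, so that push and pop
  change a single cell.\<close>

definition cellat :: "nat \<Rightarrow> (nat \<Rightarrow> nat list) \<Rightarrow> nat \<Rightarrow> nat list" where
  "cellat m S p = map (\<lambda>s. if p < length (S s) then rev (S s) ! p else 0) [0..<m]"

text \<open>Nothing is required to the left of the marker, where the head never goes.\<close>

definition tape_of :: "nat \<Rightarrow> (nat \<Rightarrow> nat list) \<Rightarrow> (int \<Rightarrow> nat) \<Rightarrow> bool" where
  "tape_of m S T \<longleftrightarrow> T (-1) = enc m [0] \<and> (\<forall>p. T (int p) = enc m (cellat m S p))"

lemma length_cellat [simp]: "length (cellat m S p) = m"
  by (simp add: cellat_def)

lemma cellat_nth: "s < m \<Longrightarrow> cellat m S p ! s = (if p < length (S s) then rev (S s) ! p else 0)"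
  by (simp add: cellat_def)

lemma cellat_push:
  "s < m \<Longrightarrow> cellat m (S(s := a # S s)) p =
    (if p = length (S s) then (cellat m S p)[s := a] else cellat m S p)"
  by (auto simp: cellat_nth nth_list_update nth_append intro!: nth_equalityI)

lemma cellat_pop:
  "s < m \<Longrightarrow> S s = a # l \<Longrightarrow> cellat m (S(s := l)) p =
    (if p = length l then (cellat m S p)[s := 0] else cellat m S p)"
  by (auto simp: cellat_nth nth_list_update nth_append intro!: nth_equalityI)

lemma cellat_top: "s < m \<Longrightarrow> S s = a # l \<Longrightarrow> cellat m S (length l) ! s = a"
  by (simp add: cellat_nth nth_append)

lemma cellat_good:
  assumes "good m B S" "0 < B"
  shows "cellat m S p \<in> syms P m B"
proof -
  have "rev (S s) ! p < B" if "s < m" "p < length (S s)" for s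
  proof -
    have "rev (S s) ! p \<in> set (S s)" using that by (metis length_rev nth_mem set_rev)
    then show ?thesis using good_mem assms(1) that(1) by blast
  qed
  then show ?thesis using assms by (auto simp: syms_def cellat_def)
qed

lemma cellat_nonzero:
  assumes "good m B S" "s < m" "p < length (S s)"
  shows "cellat m S p ! s \<noteq> 0"
proof -
  have "rev (S s) ! p \<in> set (S s)" using assms by (metis length_rev nth_mem set_rev)
  then have "rev (S s) ! p \<noteq> 0" using good_mem assms by blast
  then show ?thesis using assms by (simp add: cellat_nth)
qed

lemma mach_step:
  assumes "q \<in> ctrl P" "l \<in> syms P m B" "T h = enc m l" "nxt P q l = (q', l', d, w)"
  shows "step (mach P m B) Or \<lparr> st = sc q, tp = T, hp = h, qt = v \<rparr>
    \<lparr> st = sc q', tp = T(h := enc m l'), hp = h + mv d,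
      qt = v @ (case w of None \<Rightarrow> [] | Some a \<Rightarrow> [a]) \<rparr>"
proof -
  let ?c = "\<lparr> st = sc q, tp = T, hp = h, qt = v \<rparr>"
  have "((sc q, enc m l), (sc q', enc m l', d, w)) \<in> delta (mach P m B)"
    using assms(1,2,4) unfolding mach_def by (auto intro!: image_eqI[of _ _ "(q, l)"])
  then have "((st ?c, tp ?c (hp ?c)), (sc q', enc m l', d, w)) \<in> delta (mach P m B)"
    using assms(3) by simp
  moreover have "st ?c \<notin> {acc (mach P m B), rej (mach P m B), qry (mach P m B)}"
    using assms(1) by (auto simp: ctrl_def)
  ultimately show ?thesis using step.trans[of ?c "mach P m B"] by simp
qed

section \<open>Running the compiled code\<close>

text \<open>At least two tracks, so that a cell differs in length from the one-entry marker;
  \<open>3 \<le> B\<close>, so that the input bits 1 and 2 are stack symbols.\<close>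

locale compiled =
  fixes P :: "instr list" and m B :: nat and Or :: "bool list set"
  assumes m: "2 \<le> m" and B: "3 \<le> B"
begin

abbreviation "M \<equiv> mach P m B"
abbreviation "cf pc ph T h w \<equiv> \<lparr> st = sc (At pc ph), tp = T, hp = h, qt = w \<rparr>"

lemma at_mach_step:
  assumes "pc < length P" "ph < 4" "l \<in> syms P m B" "T h = enc m l"
    "at_step (P ! pc) pc ph l = (q', l', d, w)"
  shows "steps M Or (cf pc ph T h v) 1 0 \<lparr> st = sc q', tp = T(h := enc m l'), hp = h + mv d,
      qt = v @ (case w of None \<Rightarrow> [] | Some a \<Rightarrow> [a]) \<rparr>"
proof -
  have "At pc ph \<in> ctrl P" using assms by (auto simp: ctrl_def)
  from steps_one[OF mach_step[OF this assms(3), of T h q' l' d w Or v]] assms(4) assms(5)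
  show ?thesis by simp
qed

lemma home_syms: "r \<le> length P \<Longrightarrow> [r] \<in> syms P m B"
  by (auto simp: syms_def)

lemma good_syms: "good m B S \<Longrightarrow> cellat m S p \<in> syms P m B"
  using cellat_good B by simp

lemma length_cell: "length (cellat m S p) \<noteq> 1"
  using m by simp

lemma tape_home: "tape_of m S T \<Longrightarrow> T (-1) = enc m [0]"
  and tape_cell: "tape_of m S T \<Longrightarrow> T (int p) = enc m (cellat m S p)"
  by (auto simp: tape_of_def)

text \<open>\<open>good\<close> makes all entries below the height of the stack nonzero, so the scan
  cannot stop early. One of the \<open>Suc p\<close> steps leaves the marker.\<close>

lemma scan_right:
  assumes T: "tape_of m S T" and S: "good m B S" "s < m" and pc: "pc < length P"
    and scan: "\<And>l. length l = 1 \<or> l ! s \<noteq> 0 \<Longrightarrow> at_step (P ! pc) pc 0 l = (At pc 0, l, MvR, None)"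
  shows "p \<le> length (S s) \<Longrightarrow> steps M Or (cf pc 0 T (-1) w) (Suc p) 0 (cf pc 0 T (int p) w)"
proof (induction p)
  case 0
  show ?case
    using at_mach_step[where T=T and h="-1" and v=w, OF pc _ home_syms[of 0] tape_home[OF T] scan] tape_home[OF T]
    by (simp add: fun_upd_idem)
next
  case (Suc p)
  then have "cellat m S p ! s \<noteq> 0" using cellat_nonzero S by simp
  then have "steps M Or (cf pc 0 T (int p) w) 1 0 (cf pc 0 T (int (Suc p)) w)"
    using at_mach_step[where T=T and h="int p" and v=w, OF pc _ good_syms[OF S(1)] tape_cell[OF T] scan] tape_cell[OF T]
    by (simp add: fun_upd_idem ac_simps)
  then show ?case using steps_trans[OF Suc.IH] Suc.prems by fastforce
qed

lemma scan_left:
  assumes T: "tape_of m S T" and S: "good m B S" and pc: "pc < length P" "ph < 4"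
    and scan: "\<And>l. length l \<noteq> 1 \<Longrightarrow> at_step (P ! pc) pc ph l = (At pc ph, l, MvL, None)"
    and home: "at_step (P ! pc) pc ph [0] = (At pc' 0, [0], MvS, None)"
  shows "steps M Or (cf pc ph T (int p - 1) w) (Suc p) 0 (cf pc' 0 T (-1) w)"
proof (induction p)
  case 0
  show ?case
    using at_mach_step[where T=T and h="-1" and v=w, OF pc home_syms[of 0] tape_home[OF T] home] tape_home[OF T]
    by (simp add: fun_upd_idem)
next
  case (Suc p)
  have "steps M Or (cf pc ph T (int (Suc p) - 1) w) 1 0 (cf pc ph T (int p - 1) w)"
    using at_mach_step[where T=T and h="int p" and v=w, OF pc good_syms[OF S(1)] tape_cell[OF T] scan[OF length_cell]] tape_cell[OF T]
    by (simp add: fun_upd_idem ac_simps)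
  from steps_trans[OF this Suc.IH] show ?case by simp
qed

text \<open>Before and after each instruction the head is on the marker and the phase is 0, so that
  pieces of code can be chained. Only the represented stacks matter, hence the quantification over
  all tapes that represent them.\<close>

definition reaches where
  "reaches pc S w N q pc' S' w' \<longleftrightarrow> (\<forall>T. tape_of m S T \<longrightarrow> (\<exists>n\<le>N. \<exists>T'. tape_of m S' T' \<and>
     steps M Or (cf pc 0 T (-1) w) n q (cf pc' 0 T' (-1) w')))"

lemma reachesI:
  assumes "\<And>T. tape_of m S T \<Longrightarrow> \<exists>T'. tape_of m S' T' \<and>
     steps M Or (cf pc 0 T (-1) w) n q (cf pc' 0 T' (-1) w')" "n \<le> N"
  shows "reaches pc S w N q pc' S' w'"
  using assms unfolding reaches_def by blast

lemma reaches_refl: "reaches pc S w N 0 pc S w"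
  using steps.refl by (intro reachesI[of _ _ _ _ 0]) auto

lemma reaches_trans:
  assumes "reaches a S w N q b S1 w1" "reaches b S1 w1 N' q' c S2 w2"
  shows "reaches a S w (N + N') (q + q') c S2 w2"
  unfolding reaches_def
proof (intro allI impI)
  fix T assume "tape_of m S T"
  then obtain n T1 where 1: "n \<le> N" "tape_of m S1 T1" "steps M Or (cf a 0 T (-1) w) n q (cf b 0 T1 (-1) w1)"
    using assms(1) unfolding reaches_def by blast
  obtain n' T2 where 2: "n' \<le> N'" "tape_of m S2 T2" "steps M Or (cf b 0 T1 (-1) w1) n' q' (cf c 0 T2 (-1) w2)"
    using assms(2) 1(2) unfolding reaches_def by blast
  show "\<exists>n\<le>N + N'. \<exists>T'. tape_of m S2 T' \<and>
     steps M Or (cf a 0 T (-1) w) n (q + q') (cf c 0 T' (-1) w2)"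
    using 2(2) steps_trans[OF 1(3) 2(3)] add_mono[OF 1(1) 2(1)] by blast
qed

lemma reaches_mono: "reaches a S w N q b S1 w1 \<Longrightarrow> N \<le> N' \<Longrightarrow> reaches a S w N' q b S1 w1"
  unfolding reaches_def by (meson order_trans)

lemma tape_push:
  assumes "tape_of m S T" "s < m"
  shows "tape_of m (S(s := a # S s)) (T(int (length (S s)) := enc m ((cellat m S (length (S s)))[s := a])))"
  using assms by (auto simp: tape_of_def cellat_push simp del: fun_upd_apply) (auto simp: cellat_push)

lemma tape_pop:
  assumes "tape_of m S T" "s < m" "S s = a # l"
  shows "tape_of m (S(s := l)) (T(int (length l) := enc m ((cellat m S (length l))[s := 0])))"
  using assms cellat_pop[of s m S a l, OF assms(2,3)] by (auto simp: tape_of_def)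

lemma instr_push:
  assumes S: "good m B S" "s < m" "0 < a" "a < B" and pc: "pc < length P" "P ! pc = IPush s a"
  shows "reaches pc S w (2 * length (S s) + 6) 0 (pc + 1) (S(s := a # S s)) w"
proof (rule reachesI[of _ _ _ _ "Suc (length (S s)) + 1 + Suc (length (S s))"])
  fix T assume T: "tape_of m S T"
  let ?p = "length (S s)" and ?S' = "S(s := a # S s)"
  let ?T' = "T(int ?p := enc m ((cellat m S ?p)[s := a]))"
  have T': "tape_of m ?S' ?T'" using tape_push T S by blast
  have S': "good m B ?S'" using S by (auto simp: good_def)
  have 1: "steps M Or (cf pc 0 T (-1) w) (Suc ?p) 0 (cf pc 0 T (int ?p) w)"
    by (rule scan_right[OF T S(1,2) pc(1)]) (auto simp: pc)
  have "at_step (P ! pc) pc 0 (cellat m S ?p) = (At pc 1, (cellat m S ?p)[s := a], MvL, None)"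
    using length_cell S by (simp add: pc cellat_nth)
  from at_mach_step[where T=T and h="int ?p" and v=w, OF pc(1) _ good_syms[OF S(1)] tape_cell[OF T] this]
  have 2: "steps M Or (cf pc 0 T (int ?p) w) 1 0 (cf pc 1 ?T' (int ?p - 1) w)" by simp
  have 3: "steps M Or (cf pc 1 ?T' (int ?p - 1) w) (Suc ?p) 0 (cf (pc + 1) 0 ?T' (-1) w)"
    by (rule scan_left[OF T' S' pc(1)]) (auto simp: pc)
  show "\<exists>T'. tape_of m ?S' T' \<and> steps M Or (cf pc 0 T (-1) w) (Suc ?p + 1 + Suc ?p) 0 (cf (pc + 1) 0 T' (-1) w)"
    using T' steps_trans[OF steps_trans[OF 1 2] 3] by auto
qed simp

lemma scan_top:
  assumes T: "tape_of m S T" and S: "good m B S" "s < m" and pc: "pc < length P"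
    "P ! pc = IPop s \<or> P ! pc = ITest s a e"
  shows "steps M Or (cf pc 0 T (-1) w) (length (S s) + 2) 0 (cf pc 1 T (int (length (S s)) - 1) w)"
proof -
  let ?p = "length (S s)"
  have 1: "steps M Or (cf pc 0 T (-1) w) (Suc ?p) 0 (cf pc 0 T (int ?p) w)"
    by (rule scan_right[OF T S(1,2) pc(1)]) (use pc(2) in auto)
  have "at_step (P ! pc) pc 0 (cellat m S ?p) = (At pc 1, cellat m S ?p, MvL, None)"
    using length_cell S pc(2) by (auto simp: cellat_nth)
  from at_mach_step[where T=T and h="int ?p" and v=w, OF pc(1) _ good_syms[OF S(1)] tape_cell[OF T] this]
  have 2: "steps M Or (cf pc 0 T (int ?p) w) 1 0 (cf pc 1 T (int ?p - 1) w)"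
    using tape_cell[OF T] by (simp add: fun_upd_idem)
  show ?thesis using steps_trans[OF 1 2] by simp
qed

lemma instr_pop:
  assumes S: "good m B S" "s < m" and pc: "pc < length P" "P ! pc = IPop s"
  shows "reaches pc S w (2 * length (S s) + 6) 0 (pc + 1) (S(s := tl (S s))) w"
proof (rule reachesI[of _ _ _ _ "length (S s) + 2 + Suc (length (S s))"])
  fix T assume T: "tape_of m S T"
  let ?p = "length (S s)" and ?S' = "S(s := tl (S s))"
  have 1: "steps M Or (cf pc 0 T (-1) w) (?p + 2) 0 (cf pc 1 T (int ?p - 1) w)"
    using scan_top[OF T S pc(1)] pc(2) by blast
  show "\<exists>T'. tape_of m ?S' T' \<and> steps M Or (cf pc 0 T (-1) w) (?p + 2 + Suc ?p) 0 (cf (pc + 1) 0 T' (-1) w)"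
  proof (cases "S s")
    case Nil
    \<comment> \<open>The stack is empty exactly when the step left from the first vacant entry
      lands on the marker; popping then changes nothing.\<close>
    have "at_step (P ! pc) pc 1 [0] = (At (pc + 1) 0, [0], MvS, None)" by (simp add: pc)
    from at_mach_step[where T=T and h="-1" and v=w, OF pc(1) _ home_syms tape_home[OF T] this]
    have "steps M Or (cf pc 1 T (-1) w) 1 0 (cf (pc + 1) 0 T (-1) w)"
      using tape_home[OF T] by (simp add: fun_upd_idem)
    moreover have "steps M Or (cf pc 0 T (-1) w) (?p + 2) 0 (cf pc 1 T (-1) w)"
      using 1 by (simp add: Nil)
    ultimately show ?thesis using T Nil steps_trans by (fastforce simp: fun_upd_idem)
  next
    case (Cons a l)
    let ?q = "length l"
    let ?T' = "T(int ?q := enc m ((cellat m S ?q)[s := 0]))"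
    have T': "tape_of m ?S' ?T'" using tape_pop[OF T S(2) Cons] Cons by simp
    have "set (tl (S s)) \<subseteq> set (S s)" by (cases "S s") auto
    then have S': "good m B ?S'" using S by (auto simp: good_def)
    have "at_step (P ! pc) pc 1 (cellat m S ?q) = (At pc 2, (cellat m S ?q)[s := 0], MvL, None)"
      using length_cell by (simp add: pc)
    from at_mach_step[where T=T and h="int ?q" and v=w, OF pc(1) _ good_syms[OF S(1)] tape_cell[OF T] this]
    have 2: "steps M Or (cf pc 1 T (int ?p - 1) w) 1 0 (cf pc 2 ?T' (int ?q - 1) w)"
      using Cons by simp
    have 3: "steps M Or (cf pc 2 ?T' (int ?q - 1) w) (Suc ?q) 0 (cf (pc + 1) 0 ?T' (-1) w)"
      by (rule scan_left[OF T' S' pc(1)]) (auto simp: pc)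
    show ?thesis using T' steps_trans[OF steps_trans[OF 1 2] 3] Cons by auto
  qed
qed simp

lemma instr_test:
  assumes S: "good m B S" "s < m" and pc: "pc < length P" "P ! pc = ITest s a e"
  shows "reaches pc S w (2 * length (S s) + 6) 0 (if topsym (S s) = a then pc + 1 else e) S w"
proof (rule reachesI[of _ _ _ _ "length (S s) + 2 + Suc (length (S s))"])
  fix T assume T: "tape_of m S T"
  let ?p = "length (S s)" and ?e = "if topsym (S s) = a then pc + 1 else e"
  have 1: "steps M Or (cf pc 0 T (-1) w) (?p + 2) 0 (cf pc 1 T (int ?p - 1) w)"
    using scan_top[OF T S pc(1)] pc(2) by blast
  show "\<exists>T'. tape_of m S T' \<and> steps M Or (cf pc 0 T (-1) w) (?p + 2 + Suc ?p) 0 (cf ?e 0 T' (-1) w)"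
  proof (cases "S s")
    case Nil
    have "at_step (P ! pc) pc 1 [0] = (At ?e 0, [0], MvS, None)" using Nil by (simp add: pc)
    from at_mach_step[where T=T and h="-1" and v=w, OF pc(1) _ home_syms tape_home[OF T] this]
    have "steps M Or (cf pc 1 T (-1) w) 1 0 (cf ?e 0 T (-1) w)"
      using tape_home[OF T] by (simp add: fun_upd_idem)
    moreover have "steps M Or (cf pc 0 T (-1) w) (?p + 2) 0 (cf pc 1 T (-1) w)"
      using 1 by (simp add: Nil)
    ultimately show ?thesis using T Nil steps_trans by (fastforce simp: fun_upd_idem)
  next
    case (Cons b l)
    let ?q = "length l" and ?ph = "if b = a then 2 else 3 :: nat"
    have "at_step (P ! pc) pc 1 (cellat m S ?q) = (At pc ?ph, cellat m S ?q, MvL, None)"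
      using length_cell cellat_top[of s m S b l, OF S(2) Cons] by (simp add: pc)
    from at_mach_step[where T=T and h="int ?q" and v=w, OF pc(1) _ good_syms[OF S(1)] tape_cell[OF T] this]
    have 2: "steps M Or (cf pc 1 T (int ?p - 1) w) 1 0 (cf pc ?ph T (int ?q - 1) w)"
      using Cons tape_cell[OF T] by (simp add: fun_upd_idem)
    have 3: "steps M Or (cf pc ?ph T (int ?q - 1) w) (Suc ?q) 0 (cf ?e 0 T (-1) w)"
      by (rule scan_left[OF T S(1) pc(1)]) (auto simp: pc Cons)
    show ?thesis using T steps_trans[OF steps_trans[OF 1 2] 3] Cons by auto
  qed
qed simp

lemma instr_jump:
  assumes pc: "pc < length P" "P ! pc = IJump e"
  shows "reaches pc S w 1 0 e S w"
proof (rule reachesI)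
  fix T assume T: "tape_of m S T"
  have "at_step (P ! pc) pc 0 [0] = (At e 0, [0], MvS, None)" by (simp add: pc)
  from at_mach_step[where T=T and h="-1" and v=w, OF pc(1) _ home_syms tape_home[OF T] this]
  show "\<exists>T'. tape_of m S T' \<and> steps M Or (cf pc 0 T (-1) w) 1 0 (cf e 0 T' (-1) w)"
    using T tape_home[OF T] by (auto simp: fun_upd_idem)
qed simp

lemma instr_emit:
  assumes pc: "pc < length P" "P ! pc = IEmit b"
  shows "reaches pc S w 1 0 (pc + 1) S (w @ [b])"
proof (rule reachesI)
  fix T assume T: "tape_of m S T"
  have "at_step (P ! pc) pc 0 [0] = (At (pc + 1) 0, [0], MvS, Some b)" by (simp add: pc)
  from at_mach_step[where T=T and h="-1" and v=w, OF pc(1) _ home_syms tape_home[OF T] this]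
  show "\<exists>T'. tape_of m S T' \<and> steps M Or (cf pc 0 T (-1) w) 1 0 (cf (pc + 1) 0 T' (-1) (w @ [b]))"
    using T tape_home[OF T] by (auto simp: fun_upd_idem)
qed simp

text \<open>Three steps: the address is noted on the marker, the oracle answers, and the address is
  read back while the marker is cleared.\<close>

lemma instr_query:
  assumes pc: "pc < length P" "P ! pc = IQuery e"
  shows "reaches pc S w 3 1 (if w \<in> Or then pc + 1 else e) S []"
proof (rule reachesI[of _ _ _ _ 3])
  fix T assume T: "tape_of m S T"
  let ?T' = "T(-1 := enc m [pc + 1])" and ?q = "if w \<in> Or then Yes else No"
    and ?e = "if w \<in> Or then pc + 1 else e"
  have "at_step (P ! pc) pc 0 [0] = (Qry, [pc + 1], MvS, None)" by (simp add: pc)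
  from at_mach_step[where T=T and h="-1" and v=w, OF pc(1) _ home_syms tape_home[OF T] this]
  have 1: "steps M Or (cf pc 0 T (-1) w) 1 0 \<lparr> st = sc Qry, tp = ?T', hp = -1, qt = w \<rparr>" by simp
  have 2: "steps M Or \<lparr> st = sc Qry, tp = ?T', hp = -1, qt = w \<rparr> 1 1
      \<lparr> st = sc ?q, tp = ?T', hp = -1, qt = [] \<rparr>"
    using steps_one[OF step.query[of "\<lparr> st = sc Qry, tp = ?T', hp = -1, qt = w \<rparr>" M Or]]
    by (simp split: if_splits)
  have "nxt P ?q [pc + 1] = (At ?e 0, [0], MvS, None)" "?q \<in> ctrl P"
    by (auto simp: pc ctrl_def)
  from steps_one[OF mach_step[OF this(2) home_syms[of "pc + 1"] _ this(1), of ?T' "-1" Or "[]"]] pc(1)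
  have 3: "steps M Or \<lparr> st = sc ?q, tp = ?T', hp = -1, qt = [] \<rparr> 1 0 (cf ?e 0 T (-1) [])"
    using tape_home[OF T] by (auto simp: fun_upd_idem split: if_splits)
  show "\<exists>T'. tape_of m S T' \<and> steps M Or (cf pc 0 T (-1) w) 3 1 (cf ?e 0 T' (-1) [])"
    using T steps_trans[OF steps_trans[OF 1 2] 3] by (auto simp: numeral_3_eq_3)
qed simp

fun code_at :: "nat \<Rightarrow> instr list \<Rightarrow> bool" where
  "code_at pc [] \<longleftrightarrow> True"
| "code_at pc (x # xs) \<longleftrightarrow> pc < length P \<and> P ! pc = x \<and> code_at (pc + 1) xs"

lemma code_at_append [simp]:
  "code_at pc (xs @ ys) \<longleftrightarrow> code_at pc xs \<and> code_at (pc + length xs) ys"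
  by (induction xs arbitrary: pc) auto

text \<open>\<open>H\<close> bounds each height plus the cost still to be spent; by
  \<open>exec_height\<close> the same \<open>H\<close> therefore serves all later parts of the run.
  Each unit of cost pays for one instruction of at most \<open>2 * H + 6\<close> steps, and the 2
  units charged for a test, a loop round or a query pay for that instruction and a jump.\<close>

lemma compile_correct:
  assumes "exec Or c t q S w S' w'" "wf_com m B c" "good m B S" "\<And>s. s < m \<Longrightarrow> length (S s) + t \<le> H"
    "code_at pc (comp c pc)"
  shows "reaches pc S w (t * (2 * H + 6)) q (pc + length (comp c pc)) S' w'"
  using assms
proof (induction arbitrary: pc rule: exec.induct)
  case Skip
  then show ?case by (simp add: reaches_refl)
next
  case (Push s a S w)
  have "length (S s) \<le> H" using Push(3)[of s] Push(1) by simp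
  then show ?case
    using reaches_mono[OF instr_push[of S s a pc w], of "1 * (2 * H + 6)"] Push by (simp del: fun_upd_apply)
next
  case (Pop s S w)
  have "length (S s) \<le> H" using Pop(3)[of s] Pop(1) by simp
  then show ?case
    using reaches_mono[OF instr_pop[of S s pc w], of "1 * (2 * H + 6)"] Pop by (simp del: fun_upd_apply)
next
  case (Emit b S w)
  then show ?case using reaches_mono[OF instr_emit[of pc b S w], of "1 * (2 * H + 6)"] by simp
next
  case (Seq c1 t1 m1 S w S1 w1 c2 t2 m2 S2 w2)
  let ?x = "comp c1 pc"
  have 1: "reaches pc S w (t1 * (2 * H + 6)) m1 (pc + length ?x) S1 w1"
  proof (rule Seq.IH(1))
    show "length (S s) + t1 \<le> H" if "s < m" for s using Seq.prems(3)[OF that] by simp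
  qed (use Seq.prems(1,2,4) in \<open>auto simp: Let_def\<close>)
  have 2: "reaches (pc + length ?x) S1 w1 (t2 * (2 * H + 6)) m2
      (pc + length ?x + length (comp c2 (pc + length ?x))) S2 w2"
  proof (rule Seq.IH(2))
    show "length (S1 s) + t2 \<le> H" if "s < m" for s
      using Seq.prems(3)[OF that] exec_height[OF Seq.hyps(1), of s] by simp
    show "good m B S1" using exec_good[OF Seq.hyps(1)] Seq.prems by simp
  qed (use Seq.prems(1,2,4) in \<open>auto simp: Let_def\<close>)
  show ?case using reaches_trans[OF 1 2] by (simp add: Let_def algebra_simps)
next
  case (IfT S s a c1 t q w S1 w1 c2)
  let ?x = "comp c1 (pc + 1)"
  have 1: "reaches pc S w (2 * H + 6) 0 (pc + 1) S w"
    using reaches_mono[OF instr_test, of S s pc a _ "2 * H + 6" w] IfT.prems(1,2,4) IfT.hyps(1) IfT.prems(3)[of s]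
    by (simp add: Let_def)
  have 2: "reaches (pc + 1) S w (t * (2 * H + 6)) q (pc + 1 + length ?x) S1 w1"
  proof (rule IfT.IH)
    show "length (S s) + t \<le> H" if "s < m" for s using IfT.prems(3)[OF that] by simp
  qed (use IfT.prems(1,2,4) in \<open>auto simp: Let_def\<close>)
  have 3: "reaches (pc + 1 + length ?x) S1 w1 1 0 (pc + length (comp (IfTop s a c1 c2) pc)) S1 w1"
    by (rule instr_jump) (use IfT.prems(1,2,4) in \<open>auto simp: Let_def ac_simps\<close>)
  show ?case
    using reaches_mono[OF reaches_trans[OF reaches_trans[OF 1 2] 3], of "(t + 2) * (2 * H + 6)"]
    by (simp add: algebra_simps del: comp.simps)
next
  case (IfF S s a c2 t q w S1 w1 c1)
  let ?p = "pc + 2 + length (comp c1 (pc + 1))"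
  have 1: "reaches pc S w (2 * H + 6) 0 ?p S w"
    using reaches_mono[OF instr_test, of S s pc a ?p "2 * H + 6" w] IfF.prems(1,2,4) IfF.hyps(1) IfF.prems(3)[of s]
    by (simp add: Let_def)
  have 2: "reaches ?p S w (t * (2 * H + 6)) q (?p + length (comp c2 ?p)) S1 w1"
  proof (rule IfF.IH)
    show "length (S s) + t \<le> H" if "s < m" for s using IfF.prems(3)[OF that] by simp
  qed (use IfF.prems(1,2,4) in \<open>auto simp: Let_def\<close>)
  show ?case
    using reaches_mono[OF reaches_trans[OF 1 2], of "(t + 2) * (2 * H + 6)"]
    by (simp add: Let_def algebra_simps)
next
  case (WhileEnd S s c w)
  have 1: "reaches pc S w (2 * H + 6) 0 (pc + 1) S w"
    using reaches_mono[OF instr_test, of S s pc 0 _ "2 * H + 6" w] WhileEnd.prems WhileEnd.hyps(1) WhileEnd.prems(3)[of s]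
    by (simp add: Let_def)
  have 2: "reaches (pc + 1) S w 1 0 (pc + length (comp (While s c) pc)) S w"
    by (rule instr_jump) (use WhileEnd.prems in \<open>auto simp: Let_def ac_simps\<close>)
  show ?case
    using reaches_mono[OF reaches_trans[OF 1 2], of "2 * (2 * H + 6)"] by (simp del: comp.simps)
next
  case (WhileStep S s c t1 m1 w S1 w1 t2 m2 S2 w2)
  let ?x = "comp c (pc + 2)"
  have "topsym (S s) \<noteq> 0" using WhileStep.hyps(1) WhileStep.prems(1,2)
    by (cases "S s") (auto simp: good_def)
  then have 1: "reaches pc S w (2 * H + 6) 0 (pc + 2) S w"
    using reaches_mono[OF instr_test, of S s pc 0 "pc + 2" "2 * H + 6" w] WhileStep.prems(1,2,4) WhileStep.prems(3)[of s]
    by (simp add: Let_def)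
  have 2: "reaches (pc + 2) S w (t1 * (2 * H + 6)) m1 (pc + 2 + length ?x) S1 w1"
  proof (rule WhileStep.IH(1))
    show "length (S s) + t1 \<le> H" if "s < m" for s using WhileStep.prems(3)[OF that] by simp
  qed (use WhileStep.prems(1,2,4) in \<open>auto simp: Let_def\<close>)
  have 3: "reaches (pc + 2 + length ?x) S1 w1 1 0 pc S1 w1"
    by (rule instr_jump) (use WhileStep.prems(1,2,4) in \<open>auto simp: Let_def ac_simps\<close>)
  have 4: "reaches pc S1 w1 (t2 * (2 * H + 6)) m2 (pc + length (comp (While s c) pc)) S2 w2"
  proof (rule WhileStep.IH(2))
    show "length (S1 s) + t2 \<le> H" if "s < m" for s
      using WhileStep.prems(3)[OF that] exec_height[OF WhileStep.hyps(2), of s] by simp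
    show "good m B S1" using exec_good[OF WhileStep.hyps(2)] WhileStep.prems by simp
  qed (use WhileStep.prems(1,2,4) in auto)
  show ?case
    using reaches_mono[OF reaches_trans[OF reaches_trans[OF reaches_trans[OF 1 2] 3] 4],
        of "(t1 + t2 + 2) * (2 * H + 6)"]
    by (simp add: algebra_simps del: comp.simps)
next
  case (QueryT w c1 t q S S1 w1 c2)
  let ?x = "comp c1 (pc + 1)"
  have 1: "reaches pc S w 3 1 (pc + 1) S []"
    using instr_query[of pc _ S w] QueryT.prems QueryT.hyps(1) by (simp add: Let_def)
  have 2: "reaches (pc + 1) S [] (t * (2 * H + 6)) q (pc + 1 + length ?x) S1 w1"
  proof (rule QueryT.IH)
    show "length (S s) + t \<le> H" if "s < m" for s using QueryT.prems(3)[OF that] by simp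
  qed (use QueryT.prems(1,2,4) in \<open>auto simp: Let_def\<close>)
  have 3: "reaches (pc + 1 + length ?x) S1 w1 1 0 (pc + length (comp (IfQ c1 c2) pc)) S1 w1"
    by (rule instr_jump) (use QueryT.prems(1,2,4) in \<open>auto simp: Let_def ac_simps\<close>)
  show ?case
    using reaches_mono[OF reaches_trans[OF reaches_trans[OF 1 2] 3], of "(t + 2) * (2 * H + 6)"]
    by (simp add: algebra_simps del: comp.simps)
next
  case (QueryF w c2 t q S S1 w1 c1)
  let ?p = "pc + 2 + length (comp c1 (pc + 1))"
  have 1: "reaches pc S w 3 1 ?p S []"
    using instr_query[of pc ?p S w] QueryF.prems QueryF.hyps(1) by (simp add: Let_def)
  have 2: "reaches ?p S [] (t * (2 * H + 6)) q (?p + length (comp c2 ?p)) S1 w1"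
  proof (rule QueryF.IH)
    show "length (S s) + t \<le> H" if "s < m" for s using QueryF.prems(3)[OF that] by simp
  qed (use QueryF.prems(1,2,4) in \<open>auto simp: Let_def\<close>)
  show ?case
    using reaches_mono[OF reaches_trans[OF 1 2], of "(t + 2) * (2 * H + 6)"]
    by (simp add: Let_def algebra_simps)
next
  case (Weaken c t q S w S1 w1 t')
  have "reaches pc S w (t * (2 * H + 6)) q (pc + length (comp c pc)) S1 w1"
  proof (rule Weaken.IH)
    show "length (S s) + t \<le> H" if "s < m" for s using Weaken.prems(3)[OF that] Weaken.hyps(2) by simp
  qed (use Weaken.prems in auto)
  then show ?case using reaches_mono Weaken.hyps(2) by simp
qed

end

section \<open>From programs to deciders\<close>

text \<open>Reversed because the bottom of stack 0 is cell 0: the last bit of the word is on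
  top.\<close>

definition input :: "bool list \<Rightarrow> nat \<Rightarrow> nat list" where
  "input x = (\<lambda>_. [])(0 := rev (map bitsym x))"

lemma bitsym_cases: "bitsym b = 1 \<or> bitsym b = 2"
  by (cases b) auto

lemma good_input: "3 \<le> B \<Longrightarrow> good m B (input x)"
proof -
  assume "3 \<le> B"
  have "set (map bitsym x) \<subseteq> {1, 2}" using bitsym_cases by auto
  then show ?thesis using \<open>3 \<le> B\<close> by (fastforce simp: good_def input_def)
qed

lemma enc_input:
  assumes "2 \<le> m"
  shows "enc m (cellat m (input x) p) = (if p < length x then bitsym (x ! p) else 0)"
proof -
  have 1: "cellat m (input x) p = (replicate m 0)[0 := if p < length x then bitsym (x ! p) else 0]"
    using assms by (intro nth_equalityI) (auto simp: cellat_nth input_def nth_list_update)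
  have "(replicate m (0::nat))[0 := a] \<noteq> (replicate m 0)[0 := b]" if "a \<noteq> b" for a b
    using that assms arg_cong[of _ _ "\<lambda>l. l ! 0"] by (fastforce dest: arg_cong[of _ _ "\<lambda>l. l ! 0"])
  then have 2: "(replicate m (0::nat))[0 := Suc 0] \<noteq> replicate m 0"
    "(replicate m (0::nat))[0 := 2] \<noteq> replicate m 0"
    "(replicate m (0::nat))[0 := 2] \<noteq> (replicate m 0)[0 := Suc 0]"
    using assms by (metis list_update_id nth_replicate less_le_trans pos2 zero_neq_numeral nat.distinct(1) numeral_2_eq_2 Suc_inject)+
  have 3: "enc m ((replicate m 0)[0 := bitsym b]) = bitsym b" for b
    using 2 by (cases b) (auto simp: enc_def)
  show ?thesis
  proof (cases "p < length x")
    case False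
    have "(replicate m 0)[0 := 0::nat] = replicate m 0"
      using assms by (metis list_update_id nth_replicate less_le_trans pos2)
    then show ?thesis using 1 False by (simp add: enc_def)
  qed (use 1 3 in simp)
qed

text \<open>The code is followed by a test of stack \<open>res\<close> and two halting instructions.
  All heights stay below \<open>n + T n\<close>, the added 1 in the first factor pays for the final
  test, and the 3 for the two initial steps and the halting step.\<close>

theorem compile_decides:
  assumes c: "wf_com m B c" "res < m" "2 \<le> m" "3 \<le> B"
    and runs: "\<And>x. \<exists>q S' w'. exec Or c (T (length x)) q (input x) [] S' w' \<and> q \<le> Q (length x) \<and>
      (topsym (S' res) = 2 \<longleftrightarrow> x \<in> L)"
  shows "\<exists>M. wf_machine M \<and> deterministic M \<and>
    decides M Or (\<lambda>n. (T n + 1) * (2 * (n + T n) + 6) + 3) Q L"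
proof -
  define e where "e = length (comp c 0)"
  define P where "P = comp c 0 @ [ITest res 2 (e + 2), IHalt True, IHalt False]"
  interpret compiled P m B Or using c by unfold_locales auto
  have code: "code_at 0 P"
  proof -
    have "code_at (length ys) xs" if "P = ys @ xs" for xs ys
      using that
    proof (induction xs arbitrary: ys)
      case (Cons a xs)
      have "code_at (length (ys @ [a])) xs" by (rule Cons.IH) (simp add: Cons.prems)
      moreover have "length ys < length P" "P ! length ys = a" by (simp_all add: Cons.prems)
      ultimately show ?case by simp
    qed simp
    then show ?thesis by (metis append_Nil list.size(3))
  qed
  then have "code_at 0 (comp c 0)"
    using code_at_append[of 0 "comp c 0" "[ITest res 2 (e + 2), IHalt True, IHalt False]"]
    by (metis P_def)
  then have code: "code_at 0 (comp c 0)" "e < length P" "e + 1 < length P" "e + 2 < length P"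
    "P ! e = ITest res 2 (e + 2)" "P ! (e + 1) = IHalt True" "P ! (e + 2) = IHalt False"
    by (auto simp: P_def e_def nth_append)
  have "\<exists>n q c'. steps M Or (init_config M x) n q c' \<and>
      n \<le> (T (length x) + 1) * (2 * (length x + T (length x)) + 6) + 3 \<and> q \<le> Q (length x)
        \<and> (st c' = acc M \<or> st c' = rej M) \<and> (st c' = acc M \<longleftrightarrow> x \<in> L)" for x
  proof -
    obtain q S' w' where run: "exec Or c (T (length x)) q (input x) [] S' w'"
      and q: "q \<le> Q (length x)" and res: "topsym (S' res) = 2 \<longleftrightarrow> x \<in> L"
      using runs by blast
    define H where "H = length x + T (length x)"
    let ?T = "\<lambda>p. if 0 \<le> p \<and> p < int (length x) then bitsym (x ! nat p) else 0"
    let ?T' = "?T(-1 := enc m [0])"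
    have good: "good m B (input x)" using good_input c by blast
    have T: "tape_of m (input x) ?T'" using enc_input[OF c(3)] by (auto simp: tape_of_def)
    have 1: "steps M Or (init_config M x) 1 0 \<lparr> st = sc Init1, tp = ?T, hp = -1, qt = [] \<rparr>"
    proof -
      have "?T 0 = enc m (cellat m (input x) 0)" using enc_input[OF c(3)] by simp
      from steps_one[OF mach_step[of Init0 P _ m B ?T 0 Init1 _ MvL None, OF _ good_syms[OF good] this]]
      show ?thesis using \<open>?T 0 = _\<close> by (auto simp: init_config_def ctrl_def fun_upd_idem)
    qed
    have 2: "steps M Or \<lparr> st = sc Init1, tp = ?T, hp = -1, qt = [] \<rparr> 1 0 (cf 0 0 ?T' (-1) [])"
    proof -
      \<comment> \<open>The blank cell left of the input has the code of a cell of the empty input,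
        so the transition table covers it.\<close>
      have "?T (-1) = enc m (cellat m (input []) 0)" using enc_input[OF c(3)] by simp
      from steps_one[OF mach_step[of Init1 P _ m B ?T "-1" "At 0 0" "[0]" MvS None, OF _ good_syms[OF good_input[OF B]] this]]
      show ?thesis by (auto simp: ctrl_def)
    qed
    have "reaches 0 (input x) [] (T (length x) * (2 * H + 6)) q (0 + length (comp c 0)) S' w'"
      by (rule compile_correct[OF run c(1) good _ code(1)]) (simp add: input_def H_def)
    then obtain n T1 where n: "n \<le> T (length x) * (2 * H + 6)" "tape_of m S' T1"
      and 3: "steps M Or (cf 0 0 ?T' (-1) []) n q (cf e 0 T1 (-1) w')"
      using T unfolding reaches_def e_def by fastforce
    have good': "good m B S'" using exec_good[OF run c(1) good] .
    define pc b where "pc = (if topsym (S' res) = 2 then e + 1 else e + 2)" and "b \<longleftrightarrow> x \<in> L"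
    have "reaches e S' w' (2 * length (S' res) + 6) 0 pc S' w'"
      using instr_test[OF good' c(2) code(2,5)] by (simp add: pc_def)
    then obtain n' T2 where n': "n' \<le> 2 * length (S' res) + 6" "tape_of m S' T2"
      and 4: "steps M Or (cf e 0 T1 (-1) w') n' 0 (cf pc 0 T2 (-1) w')"
      using n(2) unfolding reaches_def by blast
    have "length (S' res) \<le> H" using exec_height[OF run, of res] by (simp add: input_def H_def split: if_splits)
    have pc: "pc < length P" "at_step (P ! pc) pc 0 [0] = (if b then Acc else Rej, [0], MvS, None)"
      using code res by (auto simp: pc_def b_def)
    have 5: "steps M Or (cf pc 0 T2 (-1) w') 1 0 \<lparr> st = sc (if b then Acc else Rej), tp = T2, hp = -1, qt = w' \<rparr>"
      using at_mach_step[where T=T2 and h="-1" and v=w', OF pc(1) _ home_syms tape_home[OF n'(2)] pc(2)]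
        tape_home[OF n'(2)] by (simp add: fun_upd_idem)
    have "2 + n + n' + 1 \<le> (T (length x) + 1) * (2 * H + 6) + 3"
      using n n' \<open>length (S' res) \<le> H\<close> by (simp add: algebra_simps)
    moreover have "steps M Or (init_config M x) (2 + n + n' + 1) q
        \<lparr> st = sc (if b then Acc else Rej), tp = T2, hp = -1, qt = w' \<rparr>"
      using steps_trans[OF steps_trans[OF steps_trans[OF steps_trans[OF 1 2] 3] 4] 5] by (simp add: numeral_2_eq_2)
    moreover have "st \<lparr> st = sc (if b then Acc else Rej), tp = T2, hp = -1, qt = w' \<rparr> = acc M \<longleftrightarrow> x \<in> L"
      "st \<lparr> st = sc (if b then Acc else Rej), tp = T2, hp = -1, qt = w' \<rparr> \<in> {acc M, rej M}"
      by (auto simp: b_def)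
    ultimately show ?thesis using q unfolding H_def by blast
  qed
  then have "decides M Or (\<lambda>n. (T n + 1) * (2 * (n + T n) + 6) + 3) Q L"
    by (rule decidesI[OF wf_mach deterministic_mach])
  then show ?thesis using wf_mach deterministic_mach by blast
qed

section \<open>Iterated exponential growth\<close>

lemma exp_it_mono: "a \<le> b \<Longrightarrow> exp_it i a \<le> exp_it i b"
  by (induction i) auto

lemma exp_it_ge: "a \<le> exp_it i a"
  by (induction i) (auto intro: order_trans less_imp_le[OF less_exp])

lemma exp_it_add: "exp_it j (exp_it i a) = exp_it (i + j) a"
  by (induction j) auto

text \<open>Raising \<open>2 ^ b\<close> to the power \<open>k\<close> multiplies \<open>b\<close>
  by \<open>k\<close>, and \<open>b * k \<le> b ^ k\<close> once \<open>b\<close> is at least 2; so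
  the power moves down one level at a time until it reaches the argument. This is what makes
  polynomial slowdowns free.\<close>

lemma exp_it_power:
  assumes "2 \<le> a" "1 \<le> k"
  shows "exp_it i a ^ k \<le> exp_it i (a ^ k)"
proof (induction i)
  case (Suc i)
  have "2 \<le> exp_it i a" using exp_it_ge[of a i] assms by simp
  have "exp_it i a * k \<le> exp_it i a ^ k"
  proof (cases "k = 1")
    case False
    have "k \<le> 2 ^ (k - 1)" using less_exp[of "k - 1"] assms by linarith
    also have "\<dots> \<le> exp_it i a ^ (k - 1)" using \<open>2 \<le> exp_it i a\<close> by (rule power_mono) simp
    finally have "exp_it i a * k \<le> exp_it i a * exp_it i a ^ (k - 1)" by simp
    then show ?thesis using assms by (simp add: power_eq_if)
  qed simp
  also have "\<dots> \<le> exp_it i (a ^ k)" by (rule Suc.IH)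
  finally show ?case by (simp add: power_mult[symmetric])
qed simp

text \<open>Small arguments are excluded because \<open>exp_it 0 (n ^ k)\<close> does not grow with \<open>k\<close>
  for \<open>n \<le> 1\<close>.\<close>

definition grow :: "nat \<Rightarrow> (nat \<Rightarrow> nat) \<Rightarrow> bool" where
  "grow i f \<longleftrightarrow> (\<exists>k. \<forall>n\<ge>2. f n \<le> exp_it i (n ^ k))"

text \<open>From 2 on a larger exponent gives a larger bound, so the exponent may be demanded to
  exceed any \<open>K\<close>. This brings two bounds to a common exponent.\<close>

lemma growE:
  assumes "grow i f"
  obtains k where "K \<le> k" "\<And>n. 2 \<le> n \<Longrightarrow> f n \<le> exp_it i (n ^ k)"
proof -
  obtain k where k: "\<And>n. 2 \<le> n \<Longrightarrow> f n \<le> exp_it i (n ^ k)"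
    using assms unfolding grow_def by blast
  have "f n \<le> exp_it i (n ^ (k + K))" if "2 \<le> n" for n
    using k[OF that] exp_it_mono[of "n ^ k" "n ^ (k + K)" i] that by (simp add: power_increasing)
  then show thesis using that[of "k + K"] by simp
qed

lemma grow_mono: "grow i f \<Longrightarrow> (\<And>n. 2 \<le> n \<Longrightarrow> g n \<le> f n) \<Longrightarrow> grow i g"
  unfolding grow_def by (meson order_trans)

lemma grow_id: "grow i (\<lambda>n. n)"
  unfolding grow_def using exp_it_ge by (intro exI[of _ 1]) simp

lemma grow_const: "grow i (\<lambda>n. c)"
  unfolding grow_def
proof (intro exI allI impI)
  fix n :: nat assume "2 \<le> n"
  then have "2 ^ c \<le> n ^ c" by (intro power_mono) auto
  then show "c \<le> exp_it i (n ^ c)" using less_exp[of c] exp_it_ge[of "n ^ c" i] by linarith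
qed

lemma grow_mult:
  assumes "grow i f" "grow i g"
  shows "grow i (\<lambda>n. f n * g n)"
proof -
  obtain k where k: "1 \<le> k" "\<And>n. 2 \<le> n \<Longrightarrow> f n \<le> exp_it i (n ^ k)" using growE[OF assms(1)] by blast
  obtain l where l: "k \<le> l" "\<And>n. 2 \<le> n \<Longrightarrow> g n \<le> exp_it i (n ^ l)" using growE[OF assms(2)] by blast
  have "f n * g n \<le> exp_it i (n ^ (l * 2))" if n: "2 \<le> n" for n
  proof -
    have "f n \<le> exp_it i (n ^ l)"
      using k(2)[OF n] exp_it_mono[of "n ^ k" "n ^ l" i] n l(1) by (simp add: power_increasing)
    then have "f n * g n \<le> exp_it i (n ^ l) ^ 2"
      using mult_mono[OF _ l(2)[OF n]] by (simp add: power2_eq_square)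
    also have "\<dots> \<le> exp_it i ((n ^ l) ^ 2)"
    proof (rule exp_it_power)
      have "n ^ 1 \<le> n ^ l" using n k l by (intro power_increasing) auto
      then show "2 \<le> n ^ l" using n by simp
    qed simp
    finally show ?thesis by (simp add: power_mult)
  qed
  then show ?thesis unfolding grow_def by blast
qed

lemma grow_max:
  assumes "grow i f" "grow i g"
  shows "grow i (\<lambda>n. max (f n) (g n))"
proof -
  obtain k where k: "1 \<le> k" "\<And>n. 2 \<le> n \<Longrightarrow> f n \<le> exp_it i (n ^ k)" using growE[OF assms(1)] by blast
  obtain l where l: "k \<le> l" "\<And>n. 2 \<le> n \<Longrightarrow> g n \<le> exp_it i (n ^ l)" using growE[OF assms(2)] by blast
  have "max (f n) (g n) \<le> exp_it i (n ^ l)" if n: "2 \<le> n" for n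
    using k(2)[OF n] exp_it_mono[of "n ^ k" "n ^ l" i] l(1) l(2)[OF n] n by (simp add: power_increasing)
  then show ?thesis unfolding grow_def by blast
qed

lemma grow_add:
  assumes "grow i f" "grow i g"
  shows "grow i (\<lambda>n. f n + g n)"
  by (rule grow_mono[OF grow_mult[OF grow_const[of i 2] grow_max[OF assms]]]) simp

lemma grow_power: "grow i f \<Longrightarrow> grow i (\<lambda>n. f n ^ k)"
  by (induction k) (auto intro: grow_mult grow_const)

text \<open>The source of \<open>i + j\<close>: exp_j is applied to a power of exp_i, and
  \<open>exp_it_power\<close> moves that power into the argument of exp_i. Monotonicity carries the
  bound on \<open>f\<close> through \<open>g\<close>.\<close>

lemma grow_compose:
  assumes f: "grow i f" and g: "grow j g" "mono g"
  shows "grow (i + j) (\<lambda>n. g (f n))"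
proof -
  obtain k where k: "1 \<le> k" "\<And>n. 2 \<le> n \<Longrightarrow> f n \<le> exp_it i (n ^ k)" using growE[OF f] by blast
  obtain l where l: "1 \<le> l" "\<And>n. 2 \<le> n \<Longrightarrow> g n \<le> exp_it j (n ^ l)" using growE[OF g(1)] by blast
  have "g (f n) \<le> exp_it (i + j) (n ^ (k * l))" if n: "2 \<le> n" for n
  proof -
    have "n ^ 1 \<le> n ^ k" using n k by (intro power_increasing) auto
    then have 2: "2 \<le> n ^ k" using n by simp
    have "g (f n) \<le> g (exp_it i (n ^ k))" using monoD[OF g(2) k(2)[OF n]] .
    also have "\<dots> \<le> exp_it j (exp_it i (n ^ k) ^ l)"
      using exp_it_ge[of "n ^ k" i] 2 by (intro l(2)) simp
    also have "\<dots> \<le> exp_it j (exp_it i ((n ^ k) ^ l))"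
      by (intro exp_it_mono exp_it_power 2 l(1))
    finally show ?thesis by (simp add: exp_it_add power_mult)
  qed
  then show ?thesis unfolding grow_def by blast
qed

lemma grow_exp_it: "grow i (\<lambda>n. exp_it i (n ^ k))"
  unfolding grow_def by blast

lemmas grow_intros = grow_id grow_const grow_mult grow_add grow_max grow_power grow_exp_it

lemma grow_bound:
  assumes "grow i f"
  obtains k where "1 \<le> k" "\<And>n. f n \<le> k * exp_it i (n ^ k) + k"
proof -
  obtain k where k: "1 \<le> k" "\<And>n. 2 \<le> n \<Longrightarrow> f n \<le> exp_it i (n ^ k)" using growE[OF assms] by blast
  \<comment> \<open>The arguments 0 and 1, about which \<open>grow\<close> says nothing, are covered
    by putting their values into the additive constant.\<close>
  define l where "l = k + f 0 + f 1"
  have "f n \<le> l * exp_it i (n ^ l) + l" for n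
  proof (cases "2 \<le> n")
    case True
    have "f n \<le> exp_it i (n ^ k)" by (rule k(2)[OF True])
    also have "\<dots> \<le> exp_it i (n ^ l)" using True by (intro exp_it_mono power_increasing) (auto simp: l_def)
    also have "\<dots> \<le> l * exp_it i (n ^ l)" using k(1) by (simp add: l_def)
    finally show ?thesis by simp
  next
    case False
    then have "n = 0 \<or> n = 1" by auto
    then show ?thesis by (auto simp: l_def)
  qed
  then show thesis using that[of l] k(1) by (simp add: l_def)
qed

definition bound :: "nat \<Rightarrow> nat \<Rightarrow> nat \<Rightarrow> nat" where
  "bound i k n = k * exp_it i (n ^ k) + k"

lemma grow_boundfun: "grow i (bound i k)"
  unfolding bound_def by (intro grow_intros)

lemma mono_bound: "mono (bound i k)"
  unfolding bound_def
  by (intro monoI add_mono mult_le_mono exp_it_mono power_mono) auto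

lemma decides_mono:
  assumes "decides M Or T Q L" "\<And>n. T n \<le> T' n" "\<And>n. Q n \<le> Q' n"
  shows "decides M Or T' Q' L"
  using assms unfolding decides_def by (meson order_trans)

text \<open>The passage from programs to classes: the blow-up of \<open>compile_decides\<close> is
  polynomial in \<open>n\<close> and \<open>T n\<close>, so the level \<open>i\<close> is preserved,
  while the number of queries is preserved exactly.\<close>

lemma compile_OClass:
  assumes c: "wf_com m B c" "res < m" "2 \<le> m" "3 \<le> B" and T: "grow i T" and Or: "Or \<in> D"
    and runs: "\<And>x. \<exists>q S' w'. exec Or c (T (length x)) q (input x) [] S' w' \<and>
      (topsym (S' res) = 2 \<longleftrightarrow> x \<in> L) \<and> (case qb of None \<Rightarrow> True | Some r \<Rightarrow> q \<le> r)"
  shows "L \<in> OClass False i qb D"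
proof -
  define T' where "T' = (\<lambda>n. (T n + 1) * (2 * (n + T n) + 6) + 3)"
  define Q where "Q = (\<lambda>n. case qb of None \<Rightarrow> T' n | Some r \<Rightarrow> r)"
  have TT: "T n \<le> T' n" for n by (simp add: T'_def algebra_simps)
  have "\<exists>q S' w'. exec Or c (T (length x)) q (input x) [] S' w' \<and> q \<le> Q (length x) \<and>
      (topsym (S' res) = 2 \<longleftrightarrow> x \<in> L)" for x
  proof -
    obtain q S' w' where *: "exec Or c (T (length x)) q (input x) [] S' w'"
      "topsym (S' res) = 2 \<longleftrightarrow> x \<in> L" "case qb of None \<Rightarrow> True | Some r \<Rightarrow> q \<le> r"
      using runs by blast
    have "q \<le> Q (length x)"
      using *(3) exec_queries_le[OF *(1)] TT[of "length x"] by (auto simp: Q_def split: option.splits)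
    then show ?thesis using * by blast
  qed
  from compile_decides[OF c this] obtain M where M: "wf_machine M" "deterministic M"
    "decides M Or T' Q L" unfolding T'_def by blast
  have "grow i T'" unfolding T'_def by (intro grow_intros T)
  then obtain k where k: "1 \<le> k" "\<And>n. T' n \<le> k * exp_it i (n ^ k) + k"
    using grow_bound by metis
  have "decides M Or (\<lambda>n. k * exp_it i (n ^ k) + k)
        (\<lambda>n. case qb of None \<Rightarrow> k * exp_it i (n ^ k) + k | Some q \<Rightarrow> q) L"
    by (rule decides_mono[OF M(3)]) (use k in \<open>auto simp: Q_def split: option.split\<close>)
  then show ?thesis unfolding OClass_def using M k Or by blast
qed

section \<open>Stack processing\<close>

lemma exec_cong:
  "exec Or c t m S w S' w' \<Longrightarrow> t \<le> t' \<Longrightarrow> m = m' \<Longrightarrow> S' = S'' \<Longrightarrow> w' = w'' \<Longrightarrow> exec Or c t' m' S w S'' w''"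
  using Weaken by blast

text \<open>\<open>F i\<close> and \<open>W i\<close> are the stacks and the query tape after
  \<open>i\<close> rounds; naming them explicitly replaces a loop invariant. The induction is on the
  number of rounds still to come.\<close>

lemma exec_while:
  assumes "\<And>i. i < n \<Longrightarrow> F i s \<noteq> [] \<and> exec Or c t 0 (F i) (W i) (F (Suc i)) (W (Suc i))"
    and "F n s = []"
  shows "exec Or (While s c) (n * (t + 2) + 2) 0 (F 0) (W 0) (F n) (W n)"
proof -
  have "j \<le> n \<Longrightarrow> exec Or (While s c) (j * (t + 2) + 2) 0 (F (n - j)) (W (n - j)) (F n) (W n)" for j
  proof (induction j)
    case 0
    show ?case by (rule exec_cong[OF WhileEnd]) (use assms(2) in auto)
  next
    case (Suc j)
    have "Suc (n - Suc j) = n - j" using Suc.prems by simp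
    then have 1: "F (n - Suc j) s \<noteq> []" "exec Or c t 0 (F (n - Suc j)) (W (n - Suc j)) (F (n - j)) (W (n - j))"
      using assms(1)[of "n - Suc j"] Suc.prems by auto
    show ?case using WhileStep[where s = s, OF 1 Suc.IH] Suc.prems by (simp add: algebra_simps)
  qed
  from this[of n] show ?thesis by simp
qed

definition clear :: "nat \<Rightarrow> com" where "clear s = While s (Pop s)"

lemma exec_clear: "exec Or (clear s) (length (S s) * 3 + 2) 0 S w (S(s := [])) w"
proof -
  let ?F = "\<lambda>i. S(s := drop i (S s))"
  have "exec Or (clear s) (length (S s) * (1 + 2) + 2) 0 (?F 0) w (?F (length (S s))) w"
    unfolding clear_def
  proof (rule exec_while)
    fix i assume "i < length (S s)"
    moreover have "exec Or (Pop s) 1 0 (?F i) w (?F (Suc i)) w"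
      using exec.Pop[of Or s "?F i" w] by (simp add: drop_Suc tl_drop)
    ultimately show "?F i s \<noteq> [] \<and> exec Or (Pop s) 1 0 (?F i) w (?F (Suc i)) w" by simp
  qed simp
  then have "exec Or (clear s) (length (S s) * (1 + 2) + 2) 0 S w (?F (length (S s))) w" by simp
  then show ?thesis by (rule exec_cong) auto
qed

lemma exec_select:
  assumes "topsym (S s) = a" "a \<in> set as" "exec Or (f a) t m S w S' w'"
  shows "exec Or (foldr (\<lambda>a c. IfTop s a (f a) c) as d) (2 * length as + t) m S w S' w'"
  using assms(2)
proof (induction as)
  case (Cons b as)
  show ?case
  proof (cases "b = a")
    case True
    show ?thesis unfolding foldr.simps o_apply True
      by (rule exec_cong[OF IfT[where s = s, OF assms(1) assms(3)]]) auto
  next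
    case False
    then have "topsym (S s) \<noteq> b" "a \<in> set as" using Cons.prems assms(1) by auto
    then show ?thesis unfolding foldr.simps o_apply
      by (intro exec_cong[OF IfF[where s = s, OF _ Cons.IH]]) auto
  qed
qed simp

text \<open>A program has no register for a symbol, so each of the finitely many symbols gets a
  branch of its own.\<close>

definition move_top :: "nat \<Rightarrow> nat \<Rightarrow> nat \<Rightarrow> com" where
  "move_top B s t = foldr (\<lambda>a c. IfTop s a (Pop s ;; Push t a) c) [1..<B] Skip"

lemma exec_move_top:
  assumes "S s = a # l" "0 < a" "a < B" "s \<noteq> t"
  shows "exec Or (move_top B s t) (2 * B + 2) 0 S w (S(s := l, t := a # S t)) w"
proof -
  have "exec Or (Pop s ;; Push t a) (1 + 1) (0 + 0) S w (S(s := l, t := a # S t)) w"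
    using Seq[OF Pop[of Or s S w] Push[of Or t a "S(s := tl (S s))" w]] assms by simp
  then have "exec Or (move_top B s t) (2 * length [1..<B] + (1 + 1)) (0 + 0) S w (S(s := l, t := a # S t)) w"
    unfolding move_top_def using assms
    by (intro exec_select[where s = s and a = a and f = "\<lambda>a. Pop s ;; Push t a"]) auto
  then show ?thesis by (rule exec_cong) auto
qed

lemma wf_move_top: "s < m \<Longrightarrow> t < m \<Longrightarrow> wf_com m B (move_top B s t)"
proof -
  assume *: "s < m" "t < m"
  have "set as \<subseteq> {0<..<B} \<Longrightarrow> wf_com m B (foldr (\<lambda>a c. IfTop s a (Pop s ;; Push t a) c) as Skip)" for as
    by (induction as) (use * in auto)
  then show ?thesis unfolding move_top_def by force
qed

definition move_all :: "nat \<Rightarrow> nat \<Rightarrow> nat \<Rightarrow> com" where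
  "move_all B s t = While s (move_top B s t)"

lemma exec_move_all:
  assumes "set (S s) \<subseteq> {0<..<B}" "s \<noteq> t"
  shows "exec Or (move_all B s t) (length (S s) * (2 * B + 4) + 2) 0 S w (S(s := [], t := rev (S s) @ S t)) w"
proof -
  let ?F = "\<lambda>i. S(s := drop i (S s), t := rev (take i (S s)) @ S t)"
  have "exec Or (move_all B s t) (length (S s) * (2 * B + 2 + 2) + 2) 0 (?F 0) w (?F (length (S s))) w"
    unfolding move_all_def
  proof (rule exec_while)
    fix i assume i: "i < length (S s)"
    then have "S s ! i \<in> {0<..<B}" using assms(1) by (meson nth_mem subsetD)
    moreover have "?F i s = S s ! i # drop (Suc i) (S s)" using i assms(2) by (simp add: Cons_nth_drop_Suc)
    ultimately have "exec Or (move_top B s t) (2 * B + 2) 0 (?F i) w ((?F i)(s := drop (Suc i) (S s), t := S s ! i # ?F i t)) w"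
      using assms(2) by (intro exec_move_top) auto
    moreover have "(?F i)(s := drop (Suc i) (S s), t := S s ! i # ?F i t) = ?F (Suc i)"
      using i assms(2) by (auto simp: fun_eq_iff take_Suc_conv_app_nth)
    ultimately show "?F i s \<noteq> [] \<and> exec Or (move_top B s t) (2 * B + 2) 0 (?F i) w (?F (Suc i)) w"
      using i assms(2) by simp
  qed (use assms in auto)
  moreover have "?F 0 = S" using assms(2) by (auto simp: fun_eq_iff)
  ultimately have "exec Or (move_all B s t) (length (S s) * (2 * B + 2 + 2) + 2) 0 S w (?F (length (S s))) w"
    by simp
  then show ?thesis by (rule exec_cong) (auto simp: algebra_simps)
qed

section \<open>Simulation of a machine by a stack program\<close>

text \<open>The tape symbol \<open>a\<close> is represented by the stack symbol \<open>a + 1\<close>, the state \<open>s\<close> by a stack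
  containing just \<open>s + 1\<close>.\<close>

definition pull :: "nat \<Rightarrow> nat \<Rightarrow> nat \<Rightarrow> com" where
  "pull B l r = IfTop l 0 (Push r 1) (move_top B l r)"

text \<open>Executed after the scanned symbol has been popped. The top of \<open>r\<close> is the
  cell under the head, and \<open>l\<close> holds the cells to its left, nearest on top.\<close>

fun move_com :: "nat \<Rightarrow> nat \<Rightarrow> nat \<Rightarrow> nat \<Rightarrow> move \<Rightarrow> com" where
  "move_com B l r b MvS = Push r (b + 1)"
| "move_com B l r b MvR = Push l (b + 1)"
| "move_com B l r b MvL = (Push r (b + 1) ;; pull B l r)"

fun trans_com :: "nat \<Rightarrow> nat \<Rightarrow> nat \<Rightarrow> nat \<Rightarrow> (bool \<Rightarrow> com) \<Rightarrow> nat \<times> nat \<times> move \<times> bool option \<Rightarrow> com" where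
  "trans_com B l r q em (q', b, d, w) =
     (Pop q ;; Push q (q' + 1) ;; Pop r ;; move_com B l r b d ;;
      (case w of None \<Rightarrow> Skip | Some a \<Rightarrow> em a))"

text \<open>The rest of the table occurs twice, so the program is exponentially large in the table.
  Its size is a constant, though, and a single path is executed, at cost 4 per entry.\<close>

fun lookup :: "nat \<Rightarrow> nat \<Rightarrow> ('t \<Rightarrow> com) \<Rightarrow> ((nat \<times> nat) \<times> 't) list \<Rightarrow> com \<Rightarrow> com" where
  "lookup r q f [] c = c"
| "lookup r q f (((s, a), t) # ds) c =
     IfTop q (s + 1) (IfTop r (a + 1) (f t) (lookup r q f ds c)) (lookup r q f ds c)"

text \<open>The state stack is also the loop condition: a halting branch leaves it empty and puts
  the verdict on \<open>res\<close>, with 2 for acceptance. A missing transition counts as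
  rejection. The first test materialises a blank under the head.\<close>

definition sim_body where
  "sim_body M B l r q res em qc ds =
     (IfTop r 0 (Push r 1) Skip ;;
      IfTop q (acc M + 1) (Pop q ;; Push res 2)
       (IfTop q (rej M + 1) (Pop q ;; Push res 1)
         (IfTop q (qry M + 1) (Pop q ;; qc)
           (lookup r q (trans_com B l r q em) ds (Pop q ;; Push res 1)))))"

definition fits :: "machine \<Rightarrow> nat \<Rightarrow> bool" where
  "fits M B \<longleftrightarrow> 3 < B \<and> start M + 1 < B \<and> yes M + 1 < B \<and> no M + 1 < B \<and>
     (\<forall>(k, (q', b, d, w))\<in>delta M. q' + 1 < B \<and> b + 1 < B)"

lemma fits_exists:
  assumes "finite (delta M)"
  obtains B0 where "\<And>B. B0 \<le> B \<Longrightarrow> fits M B"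
proof -
  let ?f = "\<lambda>(k, (q', b, d, w)). max q' b :: nat"
  obtain n where n: "\<And>x. x \<in> ?f ` delta M \<Longrightarrow> x \<le> n"
    using assms finite_nat_set_iff_bounded_le by (metis finite_imageI)
  have "fits M B" if "n + start M + yes M + no M + 4 \<le> B" for B
  proof -
    have "q' + 1 < B \<and> b + 1 < B" if "(k, (q', b, d, w)) \<in> delta M" for k q' b d w
      using n[OF imageI[OF that]] \<open>_ \<le> B\<close> by simp
    then show ?thesis using that unfolding fits_def by auto
  qed
  then show thesis using that by blast
qed

lemma wf_sim_body:
  assumes "l < m" "r < m" "q < m" "res < m" "fits M B" "set ds = delta M"
    "\<And>a. wf_com m B (em a)" "wf_com m B qc"
  shows "wf_com m B (sim_body M B l r q res em qc ds)"
proof -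
  have B: "3 < B" using assms(5) by (simp add: fits_def)
  have "wf_com m B (move_com B l r b d)" if "b + 1 < B" for b d
    by (cases d) (use assms that B in \<open>auto simp: pull_def wf_move_top\<close>)
  then have t: "wf_com m B (trans_com B l r q em t)" if "(k, t) \<in> delta M" for k t
    using assms that by (cases t) (auto simp: fits_def split: option.split)
  have "set xs \<subseteq> delta M \<Longrightarrow> wf_com m B (lookup r q (trans_com B l r q em) xs (Pop q ;; Push res 1))" for xs
    by (induction xs) (use assms(1-4) B t in auto)
  then show ?thesis using assms B by (auto simp: sim_body_def)
qed

section \<open>A two-way infinite tape as two stacks\<close>

definition symat :: "nat list \<Rightarrow> nat \<Rightarrow> nat" where
  "symat l i = (if i < length l then l ! i - 1 else 0)"

lemma symat_simps [simp]: "symat [] i = 0" "symat (a # l) 0 = a - 1" "symat (a # l) (Suc i) = symat l i"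
  by (auto simp: symat_def)

text \<open>Beyond the ends of the stacks the default value of \<open>symat\<close> supplies blanks,
  so finite stacks describe the whole tape, uniquely up to blanks at the far ends.\<close>

definition tape_rel :: "(int \<Rightarrow> nat) \<Rightarrow> int \<Rightarrow> nat list \<Rightarrow> nat list \<Rightarrow> bool" where
  "tape_rel T h L R \<longleftrightarrow> (\<forall>i. T (h + int i) = symat R i) \<and> (\<forall>i. T (h - 1 - int i) = symat L i)"

lemma tape_rel_head: "tape_rel T h L R \<Longrightarrow> T h = symat R 0"
  unfolding tape_rel_def by (metis add.right_neutral of_nat_0)

lemma symat_pad: "symat [] = symat [1]"
proof
  show "symat [] i = symat [1] i" for i by (cases i) auto
qed

lemma tape_rel_pad: "tape_rel T h L [] \<longleftrightarrow> tape_rel T h L [1]" "tape_rel T h [] R \<longleftrightarrow> tape_rel T h [1] R"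
  unfolding tape_rel_def symat_pad by simp_all

lemma tape_rel_MvS:
  assumes "tape_rel T h L (a # R)"
  shows "tape_rel (T(h := b)) h L ((b + 1) # R)"
  unfolding tape_rel_def
proof (intro conjI allI)
  fix i
  show "(T(h := b)) (h + int i) = symat ((b + 1) # R) i"
    using assms by (cases i) (auto simp: tape_rel_def dest: spec[of _ i])
  show "(T(h := b)) (h - 1 - int i) = symat L i"
    using assms by (simp add: tape_rel_def)
qed

lemma tape_rel_MvR:
  assumes "tape_rel T h L (a # R)"
  shows "tape_rel T (h + 1) (a # L) R"
  unfolding tape_rel_def
proof (intro conjI allI)
  fix i
  have "h + 1 + int i = h + int (Suc i)" by simp
  then show "T (h + 1 + int i) = symat R i"
    using assms unfolding tape_rel_def by (metis symat_simps(3))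
  show "T (h + 1 - 1 - int i) = symat (a # L) i"
  proof (cases i)
    case 0
    then show ?thesis using tape_rel_head[OF assms] by simp
  next
    case (Suc j)
    have "h + 1 - 1 - int i = h - 1 - int j" by (simp add: Suc)
    then show ?thesis using assms unfolding tape_rel_def by (metis Suc symat_simps(3))
  qed
qed

lemma tape_rel_MvL:
  assumes "tape_rel T h (a # L) R"
  shows "tape_rel T (h - 1) L (a # R)"
  unfolding tape_rel_def
proof (intro conjI allI)
  fix i
  show "T (h - 1 + int i) = symat (a # R) i"
  proof (cases i)
    case 0
    have "T (h - 1 - int 0) = symat (a # L) 0" using assms unfolding tape_rel_def by blast
    then show ?thesis using 0 by simp
  next
    case (Suc j)
    have "h - 1 + int i = h + int j" by (simp add: Suc)
    then show ?thesis using assms unfolding tape_rel_def by (metis Suc symat_simps(3))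
  qed
  have "h - 1 - 1 - int i = h - 1 - int (Suc i)" by simp
  then show "T (h - 1 - 1 - int i) = symat L i"
    using assms unfolding tape_rel_def by (metis symat_simps(3))
qed

section \<open>One machine step as one round of a loop\<close>

text \<open>Abstracts from how the query tape is kept and how queries are answered, so that one
  proof covers both a machine with the same oracle and a machine whose oracle is itself simulated.
  \<open>I v S w\<close> says that \<open>v\<close> is the simulated query tape; \<open>A\<close> is
  the oracle of \<open>M\<close>, and \<open>Or\<close> that of the program. \<open>em\<close>
  writes a bit at cost \<open>ke\<close>, and \<open>qc\<close> answers a query of length at most
  \<open>V\<close> at cost \<open>C\<close>. By the last assumption \<open>I\<close> looks only at
  stacks outside the simulation.\<close>

locale simulation =
  fixes M :: machine and B l r q res :: nat and em :: "bool \<Rightarrow> com" and qc :: com and ds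
    and I :: "bool list \<Rightarrow> (nat \<Rightarrow> nat list) \<Rightarrow> bool list \<Rightarrow> bool"
    and A Or :: "bool list set" and V ke C :: nat
  assumes dist: "distinct [l, r, q, res]" and fits: "fits M B" and ds: "set ds = delta M"
    and wf: "wf_machine M" and det: "deterministic M"
    and em: "\<And>v S w a. I v S w \<Longrightarrow> \<exists>S' w'. exec Or (em a) ke 0 S w S' w' \<and> I (v @ [a]) S' w' \<and>
        (\<forall>s\<in>{l, r, q, res}. S' s = S s)"
    and qc: "\<And>v S w. I v S w \<Longrightarrow> length v \<le> V \<Longrightarrow> S q = [] \<Longrightarrow>
        \<exists>m S' w'. exec Or qc C m S w S' w' \<and> I [] S' w' \<and>
          S' q = [(if v \<in> A then yes M else no M) + 1] \<and> (\<forall>s\<in>{l, r, res}. S' s = S s)"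
    and frame: "\<And>v S S' w. I v S w \<Longrightarrow> (\<And>s. s \<notin> {l, r, q, res} \<Longrightarrow> S' s = S s) \<Longrightarrow> I v S' w"
begin

definition rel :: "config \<Rightarrow> (nat \<Rightarrow> nat list) \<Rightarrow> bool list \<Rightarrow> bool" where
  "rel c S w \<longleftrightarrow> S q = [st c + 1] \<and> tape_rel (tp c) (hp c) (S l) (S r) \<and>
     set (S l) \<subseteq> {0<..<B} \<and> set (S r) \<subseteq> {0<..<B} \<and> I (qt c) S w"

lemma exec_pull:
  assumes "set (S l) \<subseteq> {0<..<B}"
  shows "exec Or (pull B l r) (2 * B + 4) 0 S w
    (S(l := tl (S l), r := (case S l of [] \<Rightarrow> 1 | a # _ \<Rightarrow> a) # S r)) w"
proof (cases "S l")
  case Nil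
  have "exec Or (pull B l r) (1 + 2) 0 S w (S(r := 1 # S r)) w"
    unfolding pull_def by (rule IfT[OF _ Push]) (simp add: Nil)
  then show ?thesis by (rule exec_cong) (use dist Nil in \<open>auto simp: fun_eq_iff\<close>)
next
  case (Cons a L)
  have "exec Or (move_top B l r) (2 * B + 2) 0 S w (S(l := L, r := a # S r)) w"
    by (rule exec_move_top) (use assms dist Cons in auto)
  then have "exec Or (pull B l r) (2 * B + 2 + 2) 0 S w (S(l := L, r := a # S r)) w"
    unfolding pull_def by (intro IfF) (use assms Cons in auto)
  then show ?thesis by (rule exec_cong) (use Cons in auto)
qed

lemma exec_move_com:
  assumes "tape_rel T h (S l) (a # S r)" "set (S l) \<subseteq> {0<..<B}" "set (S r) \<subseteq> {0<..<B}" "b + 1 < B"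
  shows "\<exists>L R. exec Or (move_com B l r b d) (2 * B + 5) 0 S w (S(l := L, r := R)) w \<and>
    tape_rel (T(h := b)) (h + mv d) L R \<and> set L \<subseteq> {0<..<B} \<and> set R \<subseteq> {0<..<B}"
proof -
  note T = tape_rel_MvS[OF assms(1), of b]
  have lr: "l \<noteq> r" using dist by simp
  show ?thesis
  proof (cases d)
    case MvS
    have "exec Or (move_com B l r b d) (2 * B + 5) 0 S w (S(l := S l, r := (b + 1) # S r)) w"
      unfolding MvS move_com.simps by (rule exec_cong[OF Push]) auto
    then show ?thesis
      by (rule exI[of _ "S l", OF exI[of _ "(b + 1) # S r"], OF conjI]) (use T MvS assms in auto)
  next
    case MvR
    have "exec Or (move_com B l r b d) (2 * B + 5) 0 S w (S(l := (b + 1) # S l, r := S r)) w"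
      unfolding MvR move_com.simps by (rule exec_cong[OF Push]) (use lr in auto)
    then show ?thesis
      by (rule exI[of _ "(b + 1) # S l", OF exI[of _ "S r"], OF conjI])
        (use tape_rel_MvR[OF T] MvR assms in auto)
  next
    case MvL
    let ?S = "S(r := (b + 1) # S r)" and ?a = "case S l of [] \<Rightarrow> 1 | a # _ \<Rightarrow> a"
    have "exec Or (pull B l r) (2 * B + 4) 0 ?S w (?S(l := tl (?S l), r := (case ?S l of [] \<Rightarrow> 1 | a # _ \<Rightarrow> a) # ?S r)) w"
      by (rule exec_pull) (use assms lr in auto)
    from Seq[OF Push this]
    have "exec Or (move_com B l r b d) (2 * B + 5) 0 S w (S(l := tl (S l), r := ?a # (b + 1) # S r)) w"
      unfolding MvL move_com.simps by (rule exec_cong) (use lr in \<open>auto simp: fun_eq_iff\<close>)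
    moreover have "tape_rel (T(h := b)) (h - 1) (tl (S l)) (?a # (b + 1) # S r)"
    proof (cases "S l")
      case Nil
      then have "tape_rel (T(h := b)) h (1 # []) ((b + 1) # S r)" using T tape_rel_pad(2) by simp
      from tape_rel_MvL[OF this] show ?thesis using Nil by simp
    next
      case (Cons a L)
      then show ?thesis using tape_rel_MvL[of "T(h := b)" h a L] T by simp
    qed
    moreover have "set (tl (S l)) \<subseteq> {0<..<B}" "?a \<in> {0<..<B}"
      using assms fits by (cases "S l"; auto simp: fits_def)+
    ultimately show ?thesis
      by (intro exI[of _ "tl (S l)", OF exI[of _ "?a # (b + 1) # S r"], OF conjI])
        (use MvL assms in auto)
  qed
qed

lemma exec_trans_com:
  assumes S: "S q = [s]" "S r = a # R" and T: "tape_rel T h (S l) (S r)"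
    and B: "set (S l) \<subseteq> {0<..<B}" "set (S r) \<subseteq> {0<..<B}" "b + 1 < B" and I: "I v S w"
  shows "\<exists>S' w'. exec Or (trans_com B l r q em (q', b, d, u)) (2 * B + ke + 8) 0 S w S' w' \<and>
     S' q = [q' + 1] \<and> tape_rel (T(h := b)) (h + mv d) (S' l) (S' r) \<and>
     set (S' l) \<subseteq> {0<..<B} \<and> set (S' r) \<subseteq> {0<..<B} \<and> S' res = S res \<and>
     I (v @ (case u of None \<Rightarrow> [] | Some a \<Rightarrow> [a])) S' w'"
proof -
  let ?S1 = "S(q := tl (S q))"
  let ?S2 = "?S1(q := (q' + 1) # ?S1 q)"
  let ?S3 = "?S2(r := tl (?S2 r))"
  have S3: "?S3 q = [q' + 1]" "?S3 l = S l" "?S3 r = R" "?S3 res = S res"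
    using S dist by auto
  have "\<exists>L R. exec Or (move_com B l r b d) (2 * B + 5) 0 ?S3 w (?S3(l := L, r := R)) w \<and>
    tape_rel (T(h := b)) (h + mv d) L R \<and> set L \<subseteq> {0<..<B} \<and> set R \<subseteq> {0<..<B}"
    by (rule exec_move_com[of _ _ _ a]) (use S3 S T B dist in simp_all)
  then obtain L R' where m: "exec Or (move_com B l r b d) (2 * B + 5) 0 ?S3 w (?S3(l := L, r := R')) w"
    and LR: "tape_rel (T(h := b)) (h + mv d) L R'" "set L \<subseteq> {0<..<B}" "set R' \<subseteq> {0<..<B}"
    by blast
  let ?S4 = "?S3(l := L, r := R')"
  have S4: "?S4 q = [q' + 1]" "?S4 l = L" "?S4 r = R'" "?S4 res = S res" using S3 dist by auto
  have I4: "I v ?S4 w" by (rule frame[OF I]) simp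
  obtain S' w' where e: "exec Or (case u of None \<Rightarrow> Skip | Some a \<Rightarrow> em a) ke 0 ?S4 w S' w'"
    and S': "I (v @ (case u of None \<Rightarrow> [] | Some a \<Rightarrow> [a])) S' w'" "\<forall>s\<in>{l, r, q, res}. S' s = ?S4 s"
  proof (cases u)
    case None
    have "exec Or Skip ke 0 ?S4 w ?S4 w" by (rule exec_cong[OF Skip]) auto
    then show thesis using that[of ?S4 w] I4 None by simp
  next
    case (Some a)
    then show thesis using that em[OF I4, of a] by auto
  qed
  have "exec Or (trans_com B l r q em (q', b, d, u)) (2 * B + ke + 8) 0 S w S' w'"
    unfolding trans_com.simps by (rule exec_cong[OF Seq[OF Pop Seq[OF Push Seq[OF Pop Seq[OF m e]]]]]) simp_all
  then show ?thesis using S' S4 LR by (intro exI conjI) auto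
qed

lemma exec_lookup:
  assumes "S q = [s + 1]" "S r = (a + 1) # R" "((s, a), t) \<in> set xs" "set xs \<subseteq> delta M"
    "exec Or (f t) k m S w S' w'"
  shows "exec Or (lookup r q f xs c) (4 * length xs + k) m S w S' w'"
  using assms(3,4)
proof (induction xs)
  case (Cons x xs)
  obtain s' a' t' where x: "x = ((s', a'), t')" by (cases x) auto
  show ?case
  proof (cases "s' = s \<and> a' = a")
    case True
    then have "((s, a), t') \<in> delta M" "((s, a), t) \<in> delta M" using Cons.prems x by auto
    then have "t' = t" using det unfolding deterministic_def by blast
    have "exec Or (lookup r q f (x # xs) c) (k + 2 + 2) m S w S' w'"
      unfolding x lookup.simps using True \<open>t' = t\<close> assms by (intro IfT) auto
    then show ?thesis by (rule exec_cong) auto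
  next
    case False
    then have IH: "exec Or (lookup r q f xs c) (4 * length xs + k) m S w S' w'"
      using Cons x by auto
    show ?thesis
    proof (cases "s' = s")
      case True
      have "exec Or (lookup r q f (x # xs) c) (4 * length xs + k + 2 + 2) m S w S' w'"
        unfolding x lookup.simps by (rule IfT[OF _ IfF[OF _ IH]]) (use True False assms in auto)
      then show ?thesis by (rule exec_cong) auto
    next
      case False
      have "exec Or (lookup r q f (x # xs) c) (4 * length xs + k + 2) m S w S' w'"
        unfolding x lookup.simps by (rule IfF[OF _ IH]) (use False assms in auto)
      then show ?thesis by (rule exec_cong) auto
    qed
  qed
qed simp

lemma exec_lookup_none:
  assumes "S q = [s + 1]" "S r = (a + 1) # R" "\<And>t. ((s, a), t) \<notin> set xs"
    "exec Or c k m S w S' w'"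
  shows "exec Or (lookup r q f xs c) (4 * length xs + k) m S w S' w'"
  using assms(3)
proof (induction xs)
  case Nil
  then show ?case using assms(4) by simp
next
  case (Cons x xs)
  obtain s' a' t' where x: "x = ((s', a'), t')" by (cases x) auto
  have IH: "exec Or (lookup r q f xs c) (4 * length xs + k) m S w S' w'"
    using Cons by auto
  show ?case
  proof (cases "s' = s")
    case True
    have "a' \<noteq> a" using True Cons.prems x by auto
    then have "exec Or (lookup r q f (x # xs) c) (4 * length xs + k + 2 + 2) m S w S' w'"
      unfolding x lookup.simps by (intro IfT[OF _ IfF[OF _ IH]]) (use True assms in auto)
    then show ?thesis by (rule exec_cong) auto
  next
    case False
    have "exec Or (lookup r q f (x # xs) c) (4 * length xs + k + 2) m S w S' w'"
      unfolding x lookup.simps by (rule IfF[OF _ IH]) (use False assms in auto)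
    then show ?thesis by (rule exec_cong) auto
  qed
qed

abbreviation "body \<equiv> sim_body M B l r q res em qc ds"

definition cost :: nat where "cost = 4 * length ds + 2 * B + ke + C + 20"

lemma normalise:
  assumes "rel c S w"
  obtains S1 R where "exec Or (IfTop r 0 (Push r 1) Skip) 3 0 S w S1 w" "rel c S1 w" "S1 res = S res"
    "S1 r = (tp c (hp c) + 1) # R"
proof (cases "S r")
  case Nil
  have 1: "exec Or (IfTop r 0 (Push r 1) Skip) (1 + 2) 0 S w (S(r := 1 # S r)) w"
    by (rule IfT[OF _ Push]) (simp add: Nil)
  have "I (qt c) (S(r := 1 # S r)) w" by (rule frame) (use assms in \<open>auto simp: rel_def\<close>)
  moreover have T: "tape_rel (tp c) (hp c) (S l) [1]" using assms Nil tape_rel_pad(1) by (simp add: rel_def)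
  ultimately have "rel c (S(r := 1 # S r)) w" using assms Nil dist fits by (auto simp: rel_def fits_def)
  then show thesis using that[of "S(r := 1 # S r)" "[]"] 1 dist Nil tape_rel_head[OF T]
    by (simp add: numeral_3_eq_3)
next
  case (Cons a R)
  have "a \<noteq> 0" using assms Cons by (auto simp: rel_def)
  have "exec Or (IfTop r 0 (Push r 1) Skip) (0 + 2) 0 S w S w"
    by (rule IfF[OF _ Skip]) (simp add: Cons \<open>a \<noteq> 0\<close>)
  then have "exec Or (IfTop r 0 (Push r 1) Skip) 3 0 S w S w" by (rule exec_cong) auto
  moreover have "tape_rel (tp c) (hp c) (S l) (a # R)" using assms Cons by (simp add: rel_def)
  then have "S r = (tp c (hp c) + 1) # R" using tape_rel_head Cons \<open>a \<noteq> 0\<close> by fastforce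
  ultimately show thesis using that assms by blast
qed

lemma body_step:
  assumes "step M A c c'" "rel c S w" "length (qt c) \<le> V"
  shows "\<exists>m S' w'. exec Or body cost m S w S' w' \<and> rel c' S' w' \<and> S' res = S res"
proof -
  obtain S1 R where n: "exec Or (IfTop r 0 (Push r 1) Skip) 3 0 S w S1 w" and rel: "rel c S1 w"
    and S1: "S1 res = S res" "S1 r = (tp c (hp c) + 1) # R" by (rule normalise[OF assms(2)])
  have q: "S1 q = [st c + 1]" using rel by (simp add: rel_def)
  show ?thesis
    using assms(1)
  proof cases
    case query
    let ?S = "S1(q := tl (S1 q))"
    have "I (qt c) ?S w" by (rule frame) (use rel in \<open>auto simp: rel_def\<close>)
    from qc[OF this assms(3)] q obtain m S' w' where e: "exec Or qc C m ?S w S' w'" "I [] S' w'"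
      and S': "S' q = [(if qt c \<in> A then yes M else no M) + 1]" "\<forall>s\<in>{l, r, res}. S' s = ?S s"
      by auto
    have "exec Or body (3 + (1 + C + 2 + 2 + 2)) (0 + (0 + m)) S w S' w'"
      unfolding sim_body_def
      by (rule Seq[OF n IfF[OF _ IfF[OF _ IfT[OF _ Seq[OF Pop e(1)]]]]])
        (use wf query q in \<open>auto simp: wf_machine_def\<close>)
    then have "exec Or body cost m S w S' w'" by (rule exec_cong) (auto simp: cost_def)
    moreover have "rel c' S' w'" using e(2) S' rel dist query by (auto simp: rel_def)
    ultimately show ?thesis using S' S1 dist by auto
  next
    case (trans q' b d u)
    have "b + 1 < B" using trans(3) fits by (force simp: fits_def)
    with rel obtain S' w' where e: "exec Or (trans_com B l r q em (q', b, d, u)) (2 * B + ke + 8) 0 S1 w S' w'"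
      and S': "S' q = [q' + 1]" "tape_rel ((tp c)(hp c := b)) (hp c + mv d) (S' l) (S' r)"
        "set (S' l) \<subseteq> {0<..<B}" "set (S' r) \<subseteq> {0<..<B}" "S' res = S1 res"
        "I (qt c @ (case u of None \<Rightarrow> [] | Some a \<Rightarrow> [a])) S' w'"
      using exec_trans_com[OF q S1(2), of "tp c" "hp c" b "qt c" w q' d u] by (auto simp: rel_def)
    have e': "exec Or (lookup r q (trans_com B l r q em) ds (Pop q ;; Push res 1))
        (4 * length ds + (2 * B + ke + 8)) 0 S1 w S' w'"
      by (rule exec_lookup[where S = S1 and f = "trans_com B l r q em", OF q S1(2) _ _ e]) (use trans ds in auto)
    have "exec Or body (3 + (4 * length ds + (2 * B + ke + 8) + 2 + 2 + 2)) (0 + 0) S w S' w'"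
      unfolding sim_body_def
      by (rule Seq[OF n IfF[OF _ IfF[OF _ IfF[OF _ e']]]]) (use trans q in auto)
    then have "exec Or body cost 0 S w S' w'" by (rule exec_cong) (auto simp: cost_def)
    moreover have "rel c' S' w'" using S' trans by (auto simp: rel_def)
    ultimately show ?thesis using S' S1 by auto
  qed
qed

lemma body_stuck:
  assumes "\<And>c'. \<not> step M A c c'" "rel c S w"
  shows "\<exists>S'. exec Or body cost 0 S w S' w \<and> I (qt c) S' w \<and> S' q = [] \<and>
    S' res = (if st c = acc M then 2 else 1) # S res"
proof -
  obtain S1 R where n: "exec Or (IfTop r 0 (Push r 1) Skip) 3 0 S w S1 w" and rel: "rel c S1 w"
    and S1: "S1 res = S res" "S1 r = (tp c (hp c) + 1) # R" by (rule normalise[OF assms(2)])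
  have q: "S1 q = [st c + 1]" using rel by (simp add: rel_def)
  let ?a = "if st c = acc M then 2 else 1"
  let ?S = "\<lambda>a. (S1(q := tl (S1 q)))(res := a # (S1(q := tl (S1 q))) res)"
  have e: "exec Or (Pop q ;; Push res a) (1 + 1) (0 + 0) S1 w (?S a) w" for a
    by (rule Seq[OF Pop Push])
  have nq: "st c \<noteq> qry M" using assms(1) step.query by blast
  have "exec Or body cost 0 S w (?S ?a) w"
  proof (cases "st c = acc M")
    case True
    have "exec Or body (3 + (1 + 1 + 2)) (0 + (0 + 0)) S w (?S 2) w"
      unfolding sim_body_def by (rule Seq[OF n IfT[OF _ e]]) (use q True in simp)
    then show ?thesis by (rule exec_cong) (use True in \<open>auto simp: cost_def\<close>)
  next
    case na: False
    show ?thesis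
    proof (cases "st c = rej M")
      case True
      have "exec Or body (3 + (1 + 1 + 2 + 2)) (0 + (0 + 0)) S w (?S 1) w"
        unfolding sim_body_def by (rule Seq[OF n IfF[OF _ IfT[OF _ e]]]) (use q True na in auto)
      then show ?thesis by (rule exec_cong) (use na in \<open>auto simp: cost_def\<close>)
    next
      case False
      have "((st c, tp c (hp c)), t) \<notin> set ds" for t
      proof
        assume "((st c, tp c (hp c)), t) \<in> set ds"
        then obtain q' b d u where "((st c, tp c (hp c)), (q', b, d, u)) \<in> delta M"
          using ds by (cases t) auto
        then show False using step.trans[of c M q' b d u A] assms(1) na nq False by blast
      qed
      then have "exec Or (lookup r q (trans_com B l r q em) ds (Pop q ;; Push res 1))
          (4 * length ds + (1 + 1)) (0 + 0) S1 w (?S 1) w"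
        by (intro exec_lookup_none[OF q S1(2) _ e]) auto
      then have "exec Or body (3 + (4 * length ds + (1 + 1) + 2 + 2 + 2)) (0 + (0 + 0)) S w (?S 1) w"
        unfolding sim_body_def by (intro Seq[OF n IfF[OF _ IfF[OF _ IfF]]]) (use q na nq False in auto)
      then show ?thesis by (rule exec_cong) (use na in \<open>auto simp: cost_def\<close>)
    qed
  qed
  moreover have "I (qt c) (?S ?a) w" by (rule frame) (use rel in \<open>auto simp: rel_def\<close>)
  moreover have "(?S ?a) q = []" "(?S ?a) res = ?a # S res" using dist q S1 by auto
  ultimately show ?thesis by blast
qed

text \<open>The query tape grows by at most one bit per step, so its length plus the number of
  remaining steps never increases and stays below \<open>V\<close>. Hence every query is short
  enough for the cost \<open>C\<close>.\<close>

lemma simulate: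
  assumes "steps M A c n m c'" "\<And>c''. \<not> step M A c' c''" "rel c S w" "length (qt c) + n \<le> V"
  shows "\<exists>k S' w' v. exec Or (While q body) (n * (cost + 2) + cost + 4) k S w S' w' \<and> I v S' w' \<and>
    S' q = [] \<and> S' res = (if st c' = acc M then 2 else 1) # S res"
proof -
  have ne: "S q \<noteq> []" if "rel c S w" for c S w using that by (simp add: rel_def)
  have main: "steps M' A' c n m c' \<Longrightarrow> M' = M \<Longrightarrow> A' = A \<Longrightarrow> (\<And>c''. \<not> step M A c' c'') \<Longrightarrow> rel c S w \<Longrightarrow>
    length (qt c) + n \<le> V \<Longrightarrow>
    \<exists>k S' w' v. exec Or (While q body) (n * (cost + 2) + cost + 4) k S w S' w' \<and> I v S' w' \<and>
      S' q = [] \<and> S' res = (if st c' = acc M then 2 else 1) # S res" for M' A' n m c c' S w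
  proof (induction arbitrary: S w rule: steps.induct)
    case (refl M' A' c)
    then obtain S' where S': "exec Or body cost 0 S w S' w" "I (qt c) S' w" "S' q = []"
      "S' res = (if st c = acc M then 2 else 1) # S res"
      using body_stuck by blast
    from WhileStep[OF ne[OF refl.prems(4)] S'(1) WhileEnd[where s = q and S = S', OF S'(3)]]
    have "exec Or (While q body) (0 * (cost + 2) + cost + 4) 0 S w S' w" by (rule exec_cong) auto
    then show ?case using S' by blast
  next
    case (stepI M' A' c d n m c')
    then have st: "step M A c d" by simp
    have "length (qt c) \<le> V" using stepI.prems by simp
    then obtain k1 S1 w1 where 1: "exec Or body cost k1 S w S1 w1" "rel d S1 w1" "S1 res = S res"
      using body_step[OF st stepI.prems(4)] by blast
    have "length (qt d) \<le> length (qt c) + 1" using st by cases (auto split: option.split)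
    then have "length (qt d) + n \<le> V" using stepI.prems by simp
    then obtain k S' w' v where 2: "exec Or (While q body) (n * (cost + 2) + cost + 4) k S1 w1 S' w'" "I v S' w'"
      "S' q = []" "S' res = (if st c' = acc M then 2 else 1) # S1 res"
      using stepI.IH[OF stepI.prems(1,2,3) 1(2)] by blast
    have "exec Or (While q body) (Suc n * (cost + 2) + cost + 4) (k1 + k) S w S' w'"
      by (rule exec_cong[OF WhileStep[OF ne[OF stepI.prems(4)] 1(1) 2(1)]]) auto
    then show ?case using 2 1(3) by metis
  qed
  show ?thesis by (rule main[OF assms(1) HOL.refl HOL.refl assms(2-4)])
qed


lemma rel_init:
  assumes "S q = [start M + 1]" "S l = []" "S r = map (\<lambda>b. bitsym b + 1) x" "I [] S w"
  shows "rel (init_config M x) S w"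
proof -
  have "bitsym b + 1 < B" for b using fits bitsym_cases[of b] by (auto simp: fits_def)
  moreover have "tape_rel (tp (init_config M x)) 0 [] (map (\<lambda>b. bitsym b + 1) x)"
    by (auto simp: tape_rel_def init_config_def symat_def)
  ultimately show ?thesis using assms by (auto simp: rel_def init_config_def)
qed

lemma simulate_decides:
  assumes "decides M A T Q L" "T (length x) \<le> V"
    and "S q = [start M + 1]" "S l = []" "S r = map (\<lambda>b. bitsym b + 1) x" "I [] S w"
  shows "\<exists>k S' w' v. exec Or (While q body) ((T (length x) + 2) * (cost + 2)) k S w S' w' \<and>
    I v S' w' \<and> S' q = [] \<and> S' res = (if x \<in> L then 2 else 1) # S res"
proof -
  obtain n m c where c: "steps M A (init_config M x) n m c" "n \<le> T (length x)"
    "\<And>c'. \<not> step M A c c'" "st c = acc M \<longleftrightarrow> x \<in> L"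
    using decides_stuck_run[OF wf det assms(1)] by blast
  have "\<exists>k S' w' v. exec Or (While q body) (n * (cost + 2) + cost + 4) k S w S' w' \<and> I v S' w' \<and>
    S' q = [] \<and> S' res = (if st c = acc M then 2 else 1) # S res"
    using c(2) assms(2) by (intro simulate[OF c(1,3) rel_init[OF assms(3-6)]]) (simp add: init_config_def)
  then obtain k S' w' v where e: "exec Or (While q body) (n * (cost + 2) + cost + 4) k S w S' w'"
    "I v S' w'" "S' q = []" "S' res = (if st c = acc M then 2 else 1) # S res" by blast
  have "n * (cost + 2) \<le> T (length x) * (cost + 2)" using c(2) by (rule mult_le_mono1)
  then have "exec Or (While q body) ((T (length x) + 2) * (cost + 2)) k S w S' w'"
    by (intro exec_cong[OF e(1)]) (auto simp: algebra_simps)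
  moreover have "S' res = (if x \<in> L then 2 else 1) # S res" using e(4) c(4) by simp
  ultimately show ?thesis using e by blast
qed

end

definition query_com where
  "query_com M q = IfQ (Push q (yes M + 1)) (Push q (no M + 1))"

abbreviation "plain_body M B l r q res ds \<equiv> sim_body M B l r q res Emit (query_com M q) ds"

text \<open>This is \<open>cost + 2\<close> of the simulation with emission cost 1 and query cost 3;
  the 2 is the loop test.\<close>

definition plain_cost :: "nat \<Rightarrow> 'a list \<Rightarrow> nat" where
  "plain_cost B ds = 4 * length ds + 2 * B + 26"

text \<open>The instance in which the simulated query tape is the real one and both sides ask the
  same oracle.\<close>

lemma exec_plain:
  assumes "distinct [l, r, q, res]" "fits M B" "set ds = delta M" "wf_machine M" "deterministic M"
    and "decides M Or T Q L"
    and S: "S q = [start M + 1]" "S l = []" "S r = map (\<lambda>b. bitsym b + 1) x"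
  shows "\<exists>k S' w'. exec Or (While q (plain_body M B l r q res ds))
      ((T (length x) + 2) * plain_cost B ds) k S [] S' w' \<and>
    S' q = [] \<and> S' res = (if x \<in> L then 2 else 1) # S res \<and> (\<forall>s. s \<notin> {l, r, q, res} \<longrightarrow> S' s = S s)"
proof -
  let ?I = "\<lambda>v S' w. w = v \<and> (\<forall>s. s \<notin> {l, r, q, res} \<longrightarrow> S' s = S s)"
  interpret simulation M B l r q res Emit "query_com M q" ds ?I Or Or "T (length x)" 1 3
  proof unfold_locales
    show "\<exists>S'' w'. exec Or (Emit a) 1 0 S' w S'' w' \<and> ?I (v @ [a]) S'' w' \<and> (\<forall>s\<in>{l, r, q, res}. S'' s = S' s)"
      if "?I v S' w" for v S' w a
    proof -
      have "exec Or (Emit a) 1 0 S' w S' (w @ [a])" by (rule exec.Emit)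
      then show ?thesis using that by blast
    qed
    show "\<exists>m S'' w'. exec Or (query_com M q) 3 m S' w S'' w' \<and> ?I [] S'' w' \<and>
        S'' q = [(if v \<in> Or then yes M else no M) + 1] \<and> (\<forall>s\<in>{l, r, res}. S'' s = S' s)"
      if "?I v S' w" "S' q = []" for v S' w
    proof -
      let ?S = "S'(q := ((if v \<in> Or then yes M else no M) + 1) # S' q)"
      have "exec Or (query_com M q) (1 + 2) (Suc 0) S' w ?S []"
      proof (cases "v \<in> Or")
        case True
        have "exec Or (query_com M q) (1 + 2) (Suc 0) S' w (S'(q := (yes M + 1) # S' q)) []"
          unfolding query_com_def by (rule QueryT[OF _ Push]) (use True that in simp)
        then show ?thesis using True by simp
      next
        case False
        have "exec Or (query_com M q) (1 + 2) (Suc 0) S' w (S'(q := (no M + 1) # S' q)) []"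
          unfolding query_com_def by (rule QueryF[OF _ Push]) (use False that in simp)
        then show ?thesis using False by simp
      qed
      then have "exec Or (query_com M q) 3 1 S' w ?S []" by (rule exec_cong) auto
      moreover have "?I [] ?S []" "?S q = [(if v \<in> Or then yes M else no M) + 1]"
        "\<forall>s\<in>{l, r, res}. ?S s = S' s" using that assms(1) by auto
      ultimately show ?thesis by blast
    qed
  qed (use assms in auto)
  have "cost + 2 = plain_cost B ds" unfolding cost_def plain_cost_def by simp
  moreover have "\<exists>k S' w' v. exec Or (While q body) ((T (length x) + 2) * (cost + 2)) k S [] S' w' \<and>
    ?I v S' w' \<and> S' q = [] \<and> S' res = (if x \<in> L then 2 else 1) # S res"
    by (rule simulate_decides[OF assms(6) _ S]) simp_all
  ultimately show ?thesis by metis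
qed

section \<open>Composition of oracle machines\<close>

text \<open>Popping reverses the order, so a word stored with its last bit on top arrives on
  \<open>r\<close> with its first bit on top, as a tape under the head at its start. The bits 1 and
  2 become 2 and 3 in the tape code, and \<open>n\<close> records the length in unary.\<close>

definition load :: "nat \<Rightarrow> nat \<Rightarrow> nat \<Rightarrow> com" where
  "load s r n = While s (IfTop s 1 (Pop s ;; Push r 2) (Pop s ;; Push r 3) ;; Push n 1)"

lemma exec_load:
  assumes "S s = map bitsym y" "distinct [s, r, n]" "S n = []"
  shows "exec Or (load s r n) (length y * 7 + 2) 0 S w
    (S(s := [], r := rev (map (\<lambda>b. bitsym b + 1) y) @ S r, n := replicate (length y) 1)) w"
proof -
  let ?c = "IfTop s 1 (Pop s ;; Push r 2) (Pop s ;; Push r 3)"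
  let ?F = "\<lambda>i. S(s := map bitsym (drop i y), r := rev (map (\<lambda>b. bitsym b + 1) (take i y)) @ S r,
    n := replicate i 1)"
  have "exec Or (load s r n) (length y * (5 + 2) + 2) 0 (?F 0) w (?F (length y)) w"
    unfolding load_def
  proof (rule exec_while)
    fix i assume i: "i < length y"
    then have top: "?F i s = bitsym (y ! i) # map bitsym (drop (Suc i) y)"
      using assms(2) by (simp add: Cons_nth_drop_Suc[symmetric])
    let ?G = "(?F (Suc i))(n := replicate i 1)"
    have e: "exec Or (Pop s ;; Push r (bitsym (y ! i) + 1)) (1 + 1) (0 + 0) (?F i) w ?G w"
    proof (rule exec_cong[OF Seq[OF Pop Push]])
      show "((?F i)(s := tl (?F i s)))(r := (bitsym (y ! i) + 1) # ((?F i)(s := tl (?F i s))) r) = ?G"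
        using i assms(2) top by (auto simp: fun_eq_iff take_Suc_conv_app_nth)
    qed auto
    have "exec Or ?c (1 + 1 + 2) (0 + 0) (?F i) w ?G w"
    proof (cases "y ! i")
      case False
      show ?thesis by (rule IfT) (use e top False in \<open>auto simp: numeral_2_eq_2\<close>)
    next
      case True
      show ?thesis by (rule IfF) (use e top True in \<open>auto simp: numeral_3_eq_3\<close>)
    qed
    then have "exec Or (?c ;; Push n 1) 5 0 (?F i) w (?F (Suc i)) w"
      by (rule exec_cong[OF Seq[OF _ Push]]) auto
    then show "?F i s \<noteq> [] \<and> exec Or (?c ;; Push n 1) 5 0 (?F i) w (?F (Suc i)) w" using top by simp
  qed (use assms in auto)
  moreover have "?F 0 = S" using assms by (auto simp: fun_eq_iff)
  ultimately have "exec Or (load s r n) (length y * (5 + 2) + 2) 0 S w (?F (length y)) w" by simp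
  then show ?thesis by (rule exec_cong) auto
qed

lemma exec_reset_query: "exec Or (IfQ Skip Skip) 2 1 S w S []"
proof -
  have "exec Or (IfQ Skip Skip) (0 + 2) (Suc 0) S w S []"
    by (cases "w \<in> Or") (rule QueryT[OF _ Skip] QueryF[OF _ Skip], assumption)+
  then show ?thesis by (rule exec_cong) auto
qed

text \<open>The outer machine uses the stacks 1--4, its query tape is stack 5, and the machine for its
  oracle uses the stacks 6--9.  That machine may halt with a nonempty query tape, which only a
  further query erases.\<close>

definition oracle_com where
  "oracle_com M1 M2 B ds2 =
     (move_all B 5 7 ;; Push 8 (start M2 + 1) ;; While 8 (plain_body M2 B 6 7 8 9 ds2) ;;
      clear 6 ;; clear 7 ;; IfQ Skip Skip ;;
      IfTop 9 2 (Pop 9 ;; Push 3 (yes M1 + 1)) (Pop 9 ;; Push 3 (no M1 + 1)))"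

text \<open>The outer query tape is kept reversed on stack 5, so that appending a bit is a push.
  Between queries the real query tape and the stacks of the inner machine are empty.\<close>

definition oracle_inv :: "bool list \<Rightarrow> (nat \<Rightarrow> nat list) \<Rightarrow> bool list \<Rightarrow> bool" where
  "oracle_inv v S w \<longleftrightarrow> S 5 = rev (map (\<lambda>b. bitsym b + 1) v) \<and> w = [] \<and> S 6 = [] \<and> S 7 = [] \<and> S 8 = [] \<and> S 9 = []"

text \<open>The factor 7 counts the simulation once and two clearings at 3 units per symbol, since
  the simulation may leave stacks as high as its own cost. The same clearings contribute 6 of the 10
  in the first summand.\<close>

definition oracle_cost :: "nat \<Rightarrow> 'a list \<Rightarrow> (nat \<Rightarrow> nat) \<Rightarrow> nat \<Rightarrow> nat" where
  "oracle_cost B ds T n = n * (2 * B + 10) + (T n + 2) * plain_cost B ds * 7 + 20"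

lemma exec_oracle_com:
  assumes M2: "fits M2 B" "set ds2 = delta M2" "wf_machine M2" "deterministic M2" "decides M2 Or T Q A"
    and S: "oracle_inv v S w" "length v \<le> V" "S 3 = []" and T: "mono T"
  shows "\<exists>m S' w'. exec Or (oracle_com M1 M2 B ds2) (oracle_cost B ds2 T V) m S w S' w' \<and>
    oracle_inv [] S' w' \<and> S' 3 = [(if v \<in> A then yes M1 else no M1) + 1] \<and> (\<forall>s\<in>{1, 2, 4}. S' s = S s)"
proof -
  let ?v = "map (\<lambda>b. bitsym b + 1) v" and ?X = "(T V + 2) * plain_cost B ds2"
  have B: "bitsym b + 1 < B" for b using M2(1) bitsym_cases[of b] by (auto simp: fits_def)
  have w: "w = []" using S by (simp add: oracle_inv_def)
  let ?S1 = "S(5 := [], 7 := ?v)"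
  have "exec Or (move_all B 5 7) (length (S 5) * (2 * B + 4) + 2) 0 S w (S(5 := [], 7 := rev (S 5) @ S 7)) w"
    by (rule exec_move_all) (use S B in \<open>auto simp: oracle_inv_def\<close>)
  then have 1: "exec Or (move_all B 5 7) (V * (2 * B + 4) + 2) 0 S w ?S1 w"
    by (rule exec_cong) (use S mult_le_mono1[OF S(2)] in \<open>auto simp: oracle_inv_def rev_map[symmetric]\<close>)
  let ?S2 = "?S1(8 := (start M2 + 1) # ?S1 8)"
  have 2: "exec Or (Push 8 (start M2 + 1)) 1 0 ?S1 w ?S2 w" by (rule Push)
  have "\<exists>k S' w'. exec Or (While 8 (plain_body M2 B 6 7 8 9 ds2)) ((T (length v) + 2) * plain_cost B ds2) k ?S2 [] S' w' \<and>
    S' 8 = [] \<and> S' 9 = (if v \<in> A then 2 else 1) # ?S2 9 \<and> (\<forall>s. s \<notin> {6, 7, 8, 9} \<longrightarrow> S' s = ?S2 s)"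
    by (rule exec_plain[OF _ M2]) (use S in \<open>auto simp: oracle_inv_def\<close>)
  then obtain k S3 w3 where 3: "exec Or (While 8 (plain_body M2 B 6 7 8 9 ds2)) ((T (length v) + 2) * plain_cost B ds2) k ?S2 w S3 w3"
    and S3: "S3 8 = []" "S3 9 = [if v \<in> A then 2 else 1]" "\<And>s. s \<notin> {6, 7, 8, 9} \<Longrightarrow> S3 s = ?S2 s"
    using S w by (auto simp: oracle_inv_def)
  have "T (length v) \<le> T V" using monoD[OF T S(2)] .
  then have "(T (length v) + 2) * plain_cost B ds2 \<le> ?X" by (intro mult_le_mono1) simp
  then have 3: "exec Or (While 8 (plain_body M2 B 6 7 8 9 ds2)) ?X k ?S2 w S3 w3"
    by (intro exec_cong[OF 3]) auto
  have h: "length (S3 6) \<le> V + ?X" "length (S3 7) \<le> V + ?X"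
    using exec_height[OF 3, of 6] exec_height[OF 3, of 7] S by (auto simp: oracle_inv_def)
  have 4: "exec Or (clear 6) ((V + ?X) * 3 + 2) 0 S3 w3 (S3(6 := [])) w3"
    by (rule exec_cong[OF exec_clear]) (use h in auto)
  have 5: "exec Or (clear 7) ((V + ?X) * 3 + 2) 0 (S3(6 := [])) w3 (S3(6 := [], 7 := [])) w3"
    by (rule exec_cong[OF exec_clear]) (use h in auto)
  let ?S5 = "S3(6 := [], 7 := [])"
  let ?ans = "(if v \<in> A then yes M1 else no M1) + 1"
  let ?S6 = "?S5(9 := [], 3 := [?ans])"
  have e: "exec Or (Pop 9 ;; Push 3 a) (1 + 1) (0 + 0) ?S5 [] (?S5(9 := [], 3 := [a])) []" for a
    by (rule exec_cong[OF Seq[OF Pop Push]]) (use S3 S in \<open>auto simp: fun_eq_iff\<close>)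
  have 6: "exec Or (IfTop 9 2 (Pop 9 ;; Push 3 (yes M1 + 1)) (Pop 9 ;; Push 3 (no M1 + 1))) (1 + 1 + 2) (0 + 0)
      ?S5 [] ?S6 []"
  proof (cases "v \<in> A")
    case True
    show ?thesis by (rule IfT) (use True S3 e[of "yes M1 + 1"] in auto)
  next
    case False
    show ?thesis by (rule IfF) (use False S3 e[of "no M1 + 1"] in auto)
  qed
  note all = Seq[OF 1 Seq[OF 2 Seq[OF 3 Seq[OF 4 Seq[OF 5 Seq[OF exec_reset_query 6]]]]]]
  have "exec Or (oracle_com M1 M2 B ds2) (oracle_cost B ds2 T V) (0 + (0 + (k + (0 + (0 + (1 + (0 + 0))))))) S w ?S6 []"
    unfolding oracle_com_def
    by (rule exec_cong[OF all]) (auto simp: oracle_cost_def algebra_simps)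
  moreover have "oracle_inv [] ?S6 []" using S S3 by (auto simp: oracle_inv_def)
  moreover have "\<forall>s\<in>{1, 2, 4}. ?S6 s = S s" using S3(3) by auto
  moreover have "?S6 3 = [?ans]" by simp
  ultimately show ?thesis by blast
qed

lemma wf_oracle_com:
  assumes "fits M1 B" "fits M2 B" "set ds2 = delta M2"
  shows "wf_com 11 B (oracle_com M1 M2 B ds2)"
  using assms by (auto simp: oracle_com_def move_all_def wf_move_top clear_def query_com_def fits_def
      intro!: wf_sim_body)

lemma DEXP_rel_iff:
  "L \<in> DEXP_rel i D \<longleftrightarrow> (\<exists>Or\<in>D. \<exists>k\<ge>1. \<exists>M. wf_machine M \<and> deterministic M \<and>
     decides M Or (bound i k) (bound i k) L)"
  by (simp add: OClass_def bound_def[abs_def])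

text \<open>Queries of the outer machine have length at most \<open>bound i k1 n\<close>, and so the
  inner machine needs at most \<open>bound j k2 (bound i k1 n)\<close> steps for each.
  \<open>grow_compose\<close> puts this on level \<open>i + j\<close>, where the number of rounds of
  the outer machine is a further factor of level \<open>i\<close>.\<close>

theorem relativized_composition: "DEXP_rel i (DEXP_rel j D) \<subseteq> DEXP_rel (i + j) D"
proof
  fix L assume "L \<in> DEXP_rel i (DEXP_rel j D)"
  then obtain A k1 M1 where A: "A \<in> DEXP_rel j D" and M1: "wf_machine M1" "deterministic M1"
      "decides M1 A (bound i k1) (bound i k1) L"
    unfolding DEXP_rel_iff[of L] by blast
  from A obtain Or k2 M2 where Or: "Or \<in> D" and M2: "wf_machine M2" "deterministic M2"
      "decides M2 Or (bound j k2) (bound j k2) A"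
    unfolding DEXP_rel_iff by blast
  obtain ds1 where ds1: "set ds1 = delta M1" using M1(1) finite_list unfolding wf_machine_def by blast
  obtain ds2 where ds2: "set ds2 = delta M2" using M2(1) finite_list unfolding wf_machine_def by blast
  obtain B1 where B1: "\<And>B. B1 \<le> B \<Longrightarrow> fits M1 B" using fits_exists M1(1) unfolding wf_machine_def by blast
  obtain B2 where B2: "\<And>B. B2 \<le> B \<Longrightarrow> fits M2 B" using fits_exists M2(1) unfolding wf_machine_def by blast
  define B where "B = B1 + B2"
  have fits: "fits M1 B" "fits M2 B" using B1 B2 by (auto simp: B_def)
  define em where "em a = Push 5 (bitsym a + 1)" for a
  define c where "c = (load 0 2 10 ;; Push 3 (start M1 + 1) ;;
    While 3 (sim_body M1 B 1 2 3 4 em (oracle_com M1 M2 B ds2) ds1))"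
  define C where "C = oracle_cost B ds2 (bound j k2)"
  \<comment> \<open>The last factor is \<open>cost + 2\<close> of the outer simulation with emission
    cost 1 and query cost \<open>C (bound i k1 n)\<close>.\<close>
  define T where "T n = (n * 7 + 2) + (1 + (bound i k1 n + 2) * (4 * length ds1 + 2 * B + 1 + C (bound i k1 n) + 20 + 2))" for n
  have bit: "bitsym b + 1 < B" for b using fits bitsym_cases[of b] by (auto simp: fits_def)
  show "L \<in> DEXP_rel (i + j) D"
  proof (rule compile_OClass[of 11 B c 4 _ T])
    have "wf_com 11 B (sim_body M1 B 1 2 3 4 em (oracle_com M1 M2 B ds2) ds1)"
      by (rule wf_sim_body) (use fits ds1 ds2 bit in \<open>auto simp: em_def intro: wf_oracle_com\<close>)
    then show "wf_com 11 B c" using fits by (auto simp: c_def load_def fits_def)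
    show "3 \<le> B" using fits by (simp add: fits_def)
    have gi: "grow (i + j) f" if "grow i f" for f
      using grow_compose[OF that, of j "\<lambda>n. n"] by (simp add: grow_id mono_def)
    have "grow j C" unfolding C_def oracle_cost_def by (intro grow_intros grow_boundfun)
    moreover have "mono C"
      using monoD[OF mono_bound[of j k2]] unfolding C_def oracle_cost_def
      by (intro monoI add_mono mult_le_mono) auto
    ultimately have "grow (i + j) (\<lambda>n. C (bound i k1 n))" by (rule grow_compose[OF grow_boundfun])
    then show "grow (i + j) T"
      unfolding T_def by (intro grow_intros gi[OF grow_boundfun])
    show "Or \<in> D" by (rule Or)
  next
    fix x :: "bool list"
    let ?n = "length x"
    let ?S1 = "(input x)(0 := [], 2 := map (\<lambda>b. bitsym b + 1) x, 10 := replicate ?n 1)"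
    let ?S2 = "?S1(3 := (start M1 + 1) # ?S1 3)"
    have 1: "exec Or (load 0 2 10) (?n * 7 + 2) 0 (input x) [] ?S1 []"
      by (rule exec_cong[OF exec_load[of _ _ "rev x"]]) (auto simp: input_def rev_map)
    interpret simulation M1 B 1 2 3 4 em "oracle_com M1 M2 B ds2" ds1 oracle_inv A Or "bound i k1 ?n" 1 "C (bound i k1 ?n)"
    proof unfold_locales
      show "\<exists>S' w'. exec Or (em a) 1 0 S w S' w' \<and> oracle_inv (v @ [a]) S' w' \<and> (\<forall>s\<in>{1, 2, 3, 4}. S' s = S s)"
        if "oracle_inv v S w" for v S w a
      proof -
        let ?S = "S(5 := (bitsym a + 1) # S 5)"
        have "exec Or (em a) 1 0 S w ?S w" unfolding em_def by (rule Push)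
        moreover have "oracle_inv (v @ [a]) ?S w" "\<forall>s\<in>{1, 2, 3, 4}. ?S s = S s"
          using that by (auto simp: oracle_inv_def)
        ultimately show ?thesis by blast
      qed
      show "\<exists>m S' w'. exec Or (oracle_com M1 M2 B ds2) (C (bound i k1 ?n)) m S w S' w' \<and> oracle_inv [] S' w' \<and>
          S' 3 = [(if v \<in> A then yes M1 else no M1) + 1] \<and> (\<forall>s\<in>{1, 2, 4}. S' s = S s)"
        if "oracle_inv v S w" "length v \<le> bound i k1 ?n" "S 3 = []" for v S w
        unfolding C_def by (rule exec_oracle_com[OF fits(2) ds2 M2 that mono_bound])
    qed (use fits ds1 M1 in \<open>auto simp: oracle_inv_def\<close>)
    have "\<exists>k S' w' v. exec Or (While 3 body) ((bound i k1 ?n + 2) * (cost + 2)) k ?S2 [] S' w' \<and>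
      oracle_inv v S' w' \<and> S' 3 = [] \<and> S' 4 = (if x \<in> L then 2 else 1) # ?S2 4"
      by (rule simulate_decides[OF M1(3)]) (auto simp: input_def oracle_inv_def)
    then obtain k S' w' where 3: "exec Or (While 3 body) ((bound i k1 ?n + 2) * (cost + 2)) k ?S2 [] S' w'"
      and S': "S' 4 = (if x \<in> L then 2 else 1) # ?S2 4" by blast
    have "exec Or c (T ?n) (0 + (0 + k)) (input x) [] S' w'"
      unfolding c_def T_def by (rule exec_cong[OF Seq[OF 1 Seq[OF Push 3[unfolded cost_def]]]]) auto
    then show "\<exists>q S' w'. exec Or c (T ?n) q (input x) [] S' w' \<and> (topsym (S' 4) = 2 \<longleftrightarrow> x \<in> L) \<and>
        (case None of None \<Rightarrow> True | Some r \<Rightarrow> q \<le> r)"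
      using S' by (intro exI[of _ "0 + (0 + k)"] exI[of _ S'] exI[of _ w']) simp
  qed auto
qed

section \<open>Unary arithmetic\<close>

abbreviation unary :: "nat \<Rightarrow> nat list" where
  "unary n \<equiv> replicate n 1"

fun rep :: "nat \<Rightarrow> com \<Rightarrow> com" where
  "rep 0 c = Skip"
| "rep (Suc k) c = (rep k c ;; c)"

lemma wf_rep: "wf_com m B c \<Longrightarrow> wf_com m B (rep k c)"
  by (induction k) auto

definition transfer :: "nat \<Rightarrow> nat \<Rightarrow> com" where
  "transfer s t = While s (Pop s ;; Push t 1)"

lemma exec_transfer:
  assumes "S s = unary n" "s \<noteq> t"
  shows "exec Or (transfer s t) (n * 4 + 2) 0 S w (S(s := [], t := unary n @ S t)) w"
proof -
  let ?F = "\<lambda>i. S(s := unary (n - i), t := unary i @ S t)"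
  have "exec Or (transfer s t) (n * (2 + 2) + 2) 0 (?F 0) w (?F n) w"
    unfolding transfer_def
  proof (rule exec_while)
    fix i assume i: "i < n"
    have "exec Or (Pop s ;; Push t 1) 2 0 (?F i) w (?F (Suc i)) w"
      by (rule exec_cong[OF Seq[OF Pop Push]]) (use i assms in \<open>auto simp: fun_eq_iff\<close>)
    then show "?F i s \<noteq> [] \<and> exec Or (Pop s ;; Push t 1) 2 0 (?F i) w (?F (Suc i)) w"
      using i assms by simp
  qed (use assms in auto)
  moreover have "?F 0 = S" using assms by (auto simp: fun_eq_iff)
  ultimately have "exec Or (transfer s t) (n * (2 + 2) + 2) 0 S w (?F n) w" by simp
  then show ?thesis by (rule exec_cong) auto
qed

definition double :: "nat \<Rightarrow> nat \<Rightarrow> com" where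
  "double e t = (While e (Pop e ;; Push t 1 ;; Push t 1) ;; transfer t e)"

lemma exec_double:
  assumes "S e = unary n" "S t = []" "e \<noteq> t"
  shows "exec Or (double e t) (n * 13 + 4) 0 S w (S(e := unary (2 * n))) w"
proof -
  let ?F = "\<lambda>i. S(e := unary (n - i), t := unary (2 * i))"
  have "exec Or (While e (Pop e ;; Push t 1 ;; Push t 1)) (n * (3 + 2) + 2) 0 (?F 0) w (?F n) w"
  proof (rule exec_while)
    fix i assume i: "i < n"
    have "exec Or (Pop e ;; Push t 1 ;; Push t 1) 3 0 (?F i) w (?F (Suc i)) w"
      by (rule exec_cong[OF Seq[OF Pop Seq[OF Push Push]]]) (use i assms in \<open>auto simp: fun_eq_iff\<close>)
    then show "?F i e \<noteq> [] \<and> exec Or (Pop e ;; Push t 1 ;; Push t 1) 3 0 (?F i) w (?F (Suc i)) w"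
      using i assms by simp
  qed (use assms in auto)
  moreover have "?F 0 = S" using assms by (auto simp: fun_eq_iff)
  ultimately have 1: "exec Or (While e (Pop e ;; Push t 1 ;; Push t 1)) (n * (3 + 2) + 2) 0 S w (?F n) w" by simp
  have 2: "exec Or (transfer t e) (2 * n * 4 + 2) 0 (?F n) w ((?F n)(t := [], e := unary (2 * n) @ ?F n e)) w"
    by (rule exec_transfer) (use assms in auto)
  show ?thesis unfolding double_def
    by (rule exec_cong[OF Seq[OF 1 2]]) (use assms in \<open>auto simp: fun_eq_iff\<close>)
qed

definition exp_com :: "nat \<Rightarrow> nat \<Rightarrow> nat \<Rightarrow> com" where
  "exp_com e u t = (transfer e u ;; Push e 1 ;; While u (Pop u ;; double e t))"

text \<open>The exponent is moved to \<open>u\<close> and counts the doublings of a single 1. Each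
  doubling costs at most a multiple of the final value, so the total is at most quadratic in the
  result.\<close>

lemma exec_exp_com:
  assumes "S e = unary n" "S u = []" "S t = []" "distinct [e, u, t]"
  shows "exec Or (exp_com e u t) (30 * (2 ^ n) ^ 2) 0 S w (S(e := unary (2 ^ n))) w"
proof -
  let ?F = "\<lambda>i. S(e := unary (2 ^ i), u := unary (n - i))"
  have 1: "exec Or (transfer e u) (n * 4 + 2) 0 S w (S(e := [], u := unary n @ S u)) w"
    by (rule exec_transfer) (use assms in auto)
  have 2: "exec Or (Push e 1) 1 0 (S(e := [], u := unary n @ S u)) w (?F 0) w"
    by (rule exec_cong[OF Push]) (use assms in \<open>auto simp: fun_eq_iff\<close>)
  have 3: "exec Or (While u (Pop u ;; double e t)) (n * (2 ^ n * 13 + 5 + 2) + 2) 0 (?F 0) w (?F n) w"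
  proof (rule exec_while)
    fix i assume i: "i < n"
    have "exec Or (double e t) (2 ^ i * 13 + 4) 0 ((?F i)(u := tl (?F i u))) w
        ((?F i)(u := tl (?F i u), e := unary (2 * 2 ^ i))) w"
      by (rule exec_double) (use assms in auto)
    then have "exec Or (Pop u ;; double e t) (1 + (2 ^ i * 13 + 4)) (0 + 0) (?F i) w
        ((?F i)(u := tl (?F i u), e := unary (2 * 2 ^ i))) w"
      by (rule Seq[OF Pop])
    moreover have "2 ^ i \<le> (2::nat) ^ n" using i by simp
    moreover have "(?F i)(u := tl (?F i u), e := unary (2 * 2 ^ i)) = ?F (Suc i)"
      using i assms by (auto simp: fun_eq_iff)
    ultimately have "exec Or (Pop u ;; double e t) (2 ^ n * 13 + 5) 0 (?F i) w (?F (Suc i)) w"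
      by (elim exec_cong) simp_all
    then show "?F i u \<noteq> [] \<and> exec Or (Pop u ;; double e t) (2 ^ n * 13 + 5) 0 (?F i) w (?F (Suc i)) w"
      using i assms by simp
  qed (use assms in auto)
  define V :: nat where "V = 2 ^ n"
  have V: "n \<le> V" "1 \<le> V" by (auto simp: V_def less_imp_le[OF less_exp])
  have "n * 4 + 2 + (1 + (n * (V * 13 + 5 + 2) + 2)) \<le> V * 4 + 2 + (1 + (V * (V * 13 + 5 + 2) + 2))"
    using V(1) by (intro add_mono mult_le_mono) auto
  also have "\<dots> = 13 * (V * V) + 11 * V + 5" by (simp add: algebra_simps)
  also have "\<dots> \<le> 30 * (V * V)"
  proof -
    have "1 \<le> V * V" "V \<le> V * V" using V(2) by auto
    then show ?thesis by linarith
  qed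
  finally have b: "n * 4 + 2 + (1 + (n * (2 ^ n * 13 + 5 + 2) + 2)) \<le> 30 * (2 ^ n)\<^sup>2"
    by (simp add: V_def power2_eq_square)
  show ?thesis unfolding exp_com_def
    by (rule exec_cong[OF Seq[OF 1 Seq[OF 2 3]] b]) (use assms in \<open>auto simp: fun_eq_iff\<close>)
qed

lemma exec_rep_exp:
  assumes "S e = unary n" "S u = []" "S t = []" "distinct [e, u, t]"
  shows "exec Or (rep k (exp_com e u t)) (k * 30 * (exp_it k n) ^ 2) 0 S w (S(e := unary (exp_it k n))) w"
proof (induction k)
  case 0
  show ?case unfolding rep.simps by (rule exec_cong[OF Skip]) (use assms in auto)
next
  case (Suc k)
  let ?S = "S(e := unary (exp_it k n))"
  have 2: "exec Or (exp_com e u t) (30 * (2 ^ exp_it k n) ^ 2) 0 ?S w (?S(e := unary (2 ^ exp_it k n))) w"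
    by (rule exec_exp_com) (use assms in auto)
  have "k * 30 * (exp_it k n) ^ 2 + 30 * (2 ^ exp_it k n) ^ 2
      \<le> k * 30 * (2 ^ exp_it k n) ^ 2 + 30 * (2 ^ exp_it k n) ^ 2"
    by (intro add_mono mult_le_mono power_mono less_imp_le[OF less_exp]) auto
  then have b: "k * 30 * (exp_it k n) ^ 2 + 30 * (2 ^ exp_it k n) ^ 2 \<le> Suc k * 30 * (exp_it (Suc k) n) ^ 2"
    by (simp add: add_mult_distrib)
  show ?case unfolding rep.simps by (rule exec_cong[OF Seq[OF Suc.IH 2] b]) auto
qed

definition halve :: "nat \<Rightarrow> nat \<Rightarrow> com" where
  "halve p t = (While p (Pop p ;; IfTop p 0 Skip (Pop p ;; Push t 1)) ;; transfer t p)"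

lemma exec_halve:
  assumes "S p = unary n" "S t = []" "p \<noteq> t"
  shows "exec Or (halve p t) (n * 11 + 4) 0 S w (S(p := unary (n div 2))) w"
proof -
  let ?c = "Pop p ;; IfTop p 0 Skip (Pop p ;; Push t 1)"
  \<comment> \<open>For odd \<open>n\<close> the last round removes a single 1 from \<open>p\<close>
    and adds nothing to \<open>t\<close>, hence the \<open>min\<close>.\<close>
  let ?F = "\<lambda>i. S(p := unary (n - 2 * i), t := unary (min i (n div 2)))"
  let ?k = "(n + 1) div 2"
  have "exec Or (While p ?c) (?k * (5 + 2) + 2) 0 (?F 0) w (?F ?k) w"
  proof (rule exec_while)
    fix i assume i: "i < ?k"
    let ?G = "S(p := unary (n - 2 * i - 1), t := unary (min i (n div 2)))"
    have 1: "exec Or (Pop p) 1 0 (?F i) w ?G w"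
      by (rule exec_cong[OF Pop]) (use i assms in \<open>auto simp: fun_eq_iff\<close>)
    have 2: "exec Or (IfTop p 0 Skip (Pop p ;; Push t 1)) 4 0 ?G w (?F (Suc i)) w"
    proof (cases "n - 2 * i - 1")
      case 0
      then have "min (Suc i) (n div 2) = min i (n div 2)" "n - 2 * Suc i = 0" using i by auto
      then show ?thesis by (intro exec_cong[OF IfT[OF _ Skip]]) (use 0 assms in auto)
    next
      case (Suc d)
      then have *: "min (Suc i) (n div 2) = Suc (min i (n div 2))" "n - 2 * Suc i = d" by auto
      show ?thesis unfolding *
        by (rule exec_cong[OF IfF[OF _ Seq[OF Pop Push]]]) (use Suc assms in \<open>auto simp: fun_eq_iff\<close>)
    qed
    have "exec Or ?c 5 0 (?F i) w (?F (Suc i)) w" by (rule exec_cong[OF Seq[OF 1 2]]) auto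
    then show "?F i p \<noteq> [] \<and> exec Or ?c 5 0 (?F i) w (?F (Suc i)) w" using i assms by simp
  qed (use assms in auto)
  moreover have "?F 0 = S" using assms by (auto simp: fun_eq_iff)
  moreover have F: "?F ?k = S(p := [], t := unary (n div 2))"
    using assms by (auto simp: fun_eq_iff)
  ultimately have 1: "exec Or (While p ?c) (?k * (5 + 2) + 2) 0 S w (S(p := [], t := unary (n div 2))) w" by simp
  have 2: "exec Or (transfer t p) (n div 2 * 4 + 2) 0 (S(p := [], t := unary (n div 2))) w
      (S(p := unary (n div 2))) w"
    by (rule exec_cong[OF exec_transfer[where n = "n div 2"]]) (use assms in \<open>auto simp: fun_eq_iff\<close>)
  have "?k * 7 + n div 2 * 4 \<le> n * 7 + n * 4" by (intro add_mono mult_le_mono) auto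
  then have b: "?k * (5 + 2) + 2 + (n div 2 * 4 + 2) \<le> n * 11 + 4" by simp
  show ?thesis unfolding halve_def
    by (rule exec_cong[OF Seq[OF 1 2] b]) auto
qed

text \<open>The value 1 is recognised by its stack being empty after one pop; otherwise the popped 1
  is put back before halving. Both 0 and 1 produce 0, as \<open>floor_log\<close> does.\<close>

definition log_com :: "nat \<Rightarrow> nat \<Rightarrow> nat \<Rightarrow> com" where
  "log_com p v t = (While p (Pop p ;; IfTop p 0 Skip (Push p 1 ;; halve p t ;; Push v 1)) ;; transfer v p)"

lemma exec_log_loop:
  assumes "S p = unary n" "S v = unary j" "S t = []" "distinct [p, v, t]"
  shows "exec Or (While p (Pop p ;; IfTop p 0 Skip (Push p 1 ;; halve p t ;; Push v 1)))
    (n * (n * 11 + 11) + 2) 0 S w (S(p := [], v := unary (j + floor_log n))) w"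
  using assms
proof (induction n arbitrary: S j rule: less_induct)
  case (less n)
  let ?c = "Pop p ;; IfTop p 0 Skip (Push p 1 ;; halve p t ;; Push v 1)"
  show ?case
  proof (cases "n = 0")
    case True
    show ?thesis by (rule exec_cong[OF WhileEnd]) (use True less.prems in \<open>auto simp: fun_eq_iff\<close>)
  next
    case n: False
    have ne: "S p \<noteq> []" using n less.prems by simp
    have 1: "exec Or (Pop p) 1 0 S w (S(p := unary (n - 1))) w"
      by (rule exec_cong[OF Pop]) (use less.prems in auto)
    show ?thesis
    proof (cases "n = 1")
      case True
      have 2: "exec Or (IfTop p 0 Skip (Push p 1 ;; halve p t ;; Push v 1)) (0 + 2) 0
          (S(p := unary (n - 1))) w (S(p := unary (n - 1))) w"
        by (rule IfT[OF _ Skip]) (use True in simp)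
      have 3: "exec Or (While p ?c) 2 0 (S(p := unary (n - 1))) w (S(p := unary (n - 1))) w"
        by (rule WhileEnd) (use True in simp)
      show ?thesis by (rule exec_cong[OF WhileStep[OF ne Seq[OF 1 2] 3]])
          (use True less.prems in \<open>auto simp: fun_eq_iff\<close>)
    next
      case False
      then have n2: "2 \<le> n" using n by simp
      let ?S = "S(p := unary (n div 2), v := unary (Suc j))"
      have 2: "exec Or (Push p 1) 1 0 (S(p := unary (n - 1))) w S w"
        by (rule exec_cong[OF Push]) (use n less.prems in \<open>auto simp: fun_eq_iff replicate_Suc[symmetric] simp del: replicate_Suc\<close>)
      have 3: "exec Or (halve p t) (n * 11 + 4) 0 S w (S(p := unary (n div 2))) w"
        by (rule exec_halve) (use less.prems in auto)
      have 4: "exec Or (Push v 1) 1 0 (S(p := unary (n div 2))) w ?S w"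
        by (rule exec_cong[OF Push]) (use less.prems in auto)
      have 5: "exec Or (IfTop p 0 Skip (Push p 1 ;; halve p t ;; Push v 1)) (1 + (n * 11 + 4 + 1) + 2) (0 + (0 + 0))
          (S(p := unary (n - 1))) w ?S w"
        by (rule IfF[OF _ Seq[OF 2 Seq[OF 3 4]]]) (use n2 in \<open>cases "n - 1"; auto\<close>)
      have 6: "exec Or (While p ?c) (n div 2 * (n div 2 * 11 + 11) + 2) 0 ?S w
          (?S(p := [], v := unary (Suc j + floor_log (n div 2)))) w"
        by (rule less.IH) (use n2 less.prems in auto)
      \<comment> \<open>The recursive call fits into \<open>n - 1\<close> of the \<open>n\<close>
        summands \<open>n * 11 + 11\<close>; the remaining one, with the closing 2, pays for this
        round.\<close>
      have "n div 2 * (n div 2 * 11 + 11) \<le> (n - 1) * (n * 11 + 11)"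
        using n2 by (intro mult_le_mono) auto
      moreover have "n * (n * 11 + 11) = (n - 1) * (n * 11 + 11) + (n * 11 + 11)"
        using n by (cases n) auto
      ultimately have b: "1 + (1 + (n * 11 + 4 + 1) + 2) + (n div 2 * (n div 2 * 11 + 11) + 2) + 2 \<le> n * (n * 11 + 11) + 2"
        by simp
      have "floor_log n = Suc (floor_log (n div 2))" by (rule floor_log_rec[OF n2])
      then show ?thesis
        by (intro exec_cong[OF WhileStep[OF ne Seq[OF 1 5] 6] b]) (use less.prems in \<open>auto simp: fun_eq_iff\<close>)
    qed
  qed
qed

lemma floor_log_le: "floor_log n \<le> n"
proof (cases "n = 0")
  case False
  have "floor_log n < 2 ^ floor_log n" by (rule less_exp)
  also have "\<dots> \<le> n" using False by (simp add: floor_log_exp2_le)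
  finally show ?thesis by simp
qed simp

lemma exec_log_com:
  assumes "S p = unary n" "S v = []" "S t = []" "distinct [p, v, t]"
  shows "exec Or (log_com p v t) (30 * (n + 1) ^ 2) 0 S w (S(p := unary (floor_log n))) w"
proof -
  have 1: "exec Or (While p (Pop p ;; IfTop p 0 Skip (Push p 1 ;; halve p t ;; Push v 1)))
    (n * (n * 11 + 11) + 2) 0 S w (S(p := [], v := unary (0 + floor_log n))) w"
    by (rule exec_log_loop) (use assms in auto)
  have 2: "exec Or (transfer v p) (floor_log n * 4 + 2) 0 (S(p := [], v := unary (0 + floor_log n))) w
      (S(p := unary (floor_log n))) w"
    by (rule exec_cong[OF exec_transfer[where n = "floor_log n"]]) (use assms in \<open>auto simp: fun_eq_iff\<close>)
  show ?thesis unfolding log_com_def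
    by (rule exec_cong[OF Seq[OF 1 2]]) (use floor_log_le[of n] in \<open>auto simp: power2_eq_square algebra_simps\<close>)
qed

lemma funpow_floor_log_le: "(floor_log ^^ k) n \<le> n"
  by (induction k) (auto intro: order_trans[OF floor_log_le])

lemma exec_rep_log:
  assumes "S p = unary n" "S v = []" "S t = []" "distinct [p, v, t]"
  shows "exec Or (rep k (log_com p v t)) (k * 30 * (n + 1) ^ 2) 0 S w (S(p := unary ((floor_log ^^ k) n))) w"
proof (induction k)
  case 0
  show ?case unfolding rep.simps by (rule exec_cong[OF Skip]) (use assms in auto)
next
  case (Suc k)
  let ?m = "(floor_log ^^ k) n"
  let ?S = "S(p := unary ?m)"
  have 2: "exec Or (log_com p v t) (30 * (?m + 1) ^ 2) 0 ?S w (?S(p := unary (floor_log ?m))) w"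
    by (rule exec_log_com) (use assms in auto)
  have "(?m + 1) ^ 2 \<le> (n + 1) ^ 2" using funpow_floor_log_le by (intro power_mono) auto
  then have b: "k * 30 * (n + 1) ^ 2 + 30 * (?m + 1) ^ 2 \<le> Suc k * 30 * (n + 1) ^ 2"
    by (simp add: add_mult_distrib)
  show ?case unfolding rep.simps by (rule exec_cong[OF Seq[OF Suc.IH 2] b]) auto
qed

definition mul_com :: "nat \<Rightarrow> nat \<Rightarrow> nat \<Rightarrow> nat \<Rightarrow> com" where
  "mul_com e n u t = (transfer e u ;;
     While u (Pop u ;; While n (Pop n ;; Push e 1 ;; Push t 1) ;; transfer t n))"

lemma exec_mul_com:
  assumes "S e = unary a" "S n = unary b" "S u = []" "S t = []" "distinct [e, n, u, t]"
  shows "exec Or (mul_com e n u t) (a * (9 * b + 11) + 4) 0 S w (S(e := unary (a * b))) w"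
proof -
  let ?F = "\<lambda>i. S(e := unary (i * b), u := unary (a - i))"
  let ?in = "While n (Pop n ;; Push e 1 ;; Push t 1)"
  have 1: "exec Or (transfer e u) (a * 4 + 2) 0 S w (?F 0) w"
    by (rule exec_cong[OF exec_transfer[where n = a]]) (use assms in \<open>auto simp: fun_eq_iff\<close>)
  have 2: "exec Or (While u (Pop u ;; ?in ;; transfer t n)) (a * (9 * b + 5 + 2) + 2) 0 (?F 0) w (?F a) w"
  proof (rule exec_while)
    fix i assume i: "i < a"
    let ?G = "\<lambda>l. S(e := unary (i * b + l), u := unary (a - Suc i), n := unary (b - l), t := unary l)"
    have 3: "exec Or (Pop u) 1 0 (?F i) w (?G 0) w"
      by (rule exec_cong[OF Pop]) (use i assms in \<open>auto simp: fun_eq_iff\<close>)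
    have 4: "exec Or ?in (b * (3 + 2) + 2) 0 (?G 0) w (?G b) w"
    proof (rule exec_while)
      fix l assume l: "l < b"
      have "exec Or (Pop n ;; Push e 1 ;; Push t 1) 3 0 (?G l) w (?G (Suc l)) w"
        by (rule exec_cong[OF Seq[OF Pop Seq[OF Push Push]]]) (use l assms in \<open>auto simp: fun_eq_iff\<close>)
      then show "?G l n \<noteq> [] \<and> exec Or (Pop n ;; Push e 1 ;; Push t 1) 3 0 (?G l) w (?G (Suc l)) w"
        using l assms by simp
    qed (use assms in auto)
    have 5: "exec Or (transfer t n) (b * 4 + 2) 0 (?G b) w (?F (Suc i)) w"
      by (rule exec_cong[OF exec_transfer[where n = b]]) (use assms in \<open>auto simp: fun_eq_iff add.commute\<close>)
    have "exec Or (Pop u ;; ?in ;; transfer t n) (9 * b + 5) 0 (?F i) w (?F (Suc i)) w"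
      by (rule exec_cong[OF Seq[OF 3 Seq[OF 4 5]]]) auto
    then show "?F i u \<noteq> [] \<and> exec Or (Pop u ;; ?in ;; transfer t n) (9 * b + 5) 0 (?F i) w (?F (Suc i)) w"
      using i assms by simp
  qed (use assms in auto)
  show ?thesis unfolding mul_com_def
    by (rule exec_cong[OF Seq[OF 1 2]]) (use assms in \<open>auto simp: fun_eq_iff algebra_simps\<close>)
qed

definition pow_com :: "nat \<Rightarrow> nat \<Rightarrow> nat \<Rightarrow> nat \<Rightarrow> nat \<Rightarrow> com" where
  "pow_com K e n u t = (Push e 1 ;; rep K (mul_com e n u t))"

text \<open>With \<open>1 \<le> b\<close> the powers of \<open>b\<close> are positive and do not
  decrease, so the lower terms of one multiplication are absorbed into the leading one: 24 is 9 + 11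
  + 4.\<close>

lemma exec_pow_com:
  assumes "S e = []" "S n = unary b" "S u = []" "S t = []" "distinct [e, n, u, t]" "1 \<le> b"
  shows "exec Or (pow_com K e n u t) (1 + K * 24 * b ^ K) 0 S w (S(e := unary (b ^ K))) w"
proof -
  let ?S = "S(e := unary 1)"
  have 1: "exec Or (Push e 1) 1 0 S w ?S w" by (rule exec_cong[OF Push]) (use assms in auto)
  have 2: "exec Or (rep k (mul_com e n u t)) (k * 24 * b ^ k) 0 ?S w (?S(e := unary (b ^ k))) w" for k
  proof (induction k)
    case 0
    show ?case unfolding rep.simps by (rule exec_cong[OF Skip]) auto
  next
    case (Suc k)
    let ?S' = "?S(e := unary (b ^ k))"
    have 2: "exec Or (mul_com e n u t) (b ^ k * (9 * b + 11) + 4) 0 ?S' w (?S'(e := unary (b ^ k * b))) w"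
      by (rule exec_mul_com) (use assms in auto)
    have b: "1 \<le> b ^ k" "b ^ k \<le> b ^ k * b" using assms by auto
    have "k * 24 * b ^ k \<le> k * 24 * (b ^ k * b)" using b(2) by (intro mult_le_mono) auto
    moreover have "b ^ k * (9 * b + 11) + 4 = 9 * (b ^ k * b) + 11 * b ^ k + 4"
      by (simp add: algebra_simps)
    then have "b ^ k * (9 * b + 11) + 4 \<le> 24 * (b ^ k * b)" using b by linarith
    ultimately have "k * 24 * b ^ k + (b ^ k * (9 * b + 11) + 4) \<le> k * 24 * (b ^ k * b) + 24 * (b ^ k * b)"
      by (rule add_mono)
    also have "\<dots> = Suc k * 24 * b ^ Suc k" by (simp add: algebra_simps)
    finally show ?case unfolding rep.simps
      by (intro exec_cong[OF Seq[OF Suc.IH 2]]) (auto simp: algebra_simps)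
  qed
  show ?thesis unfolding pow_com_def
    by (rule exec_cong[OF Seq[OF 1 2]]) (use assms in \<open>auto simp: fun_eq_iff\<close>)
qed

section \<open>Iterated logarithms against iterated exponentials\<close>

text \<open>\<open>2 ^ floor_log a \<le> a\<close> fails only at \<open>a = 0\<close>, where
  \<open>floor_log\<close> has the value 0. A positive \<open>v\<close> excludes this at every
  level, because all iterates are then positive.\<close>

lemma exp_it_le_if_floor_log:
  "1 \<le> v \<Longrightarrow> v \<le> (floor_log ^^ k) n \<Longrightarrow> exp_it k v \<le> n"
proof (induction k arbitrary: v)
  case (Suc k)
  let ?a = "(floor_log ^^ k) n"
  have "floor_log ?a \<noteq> 0" using Suc.prems by simp
  then have "0 < ?a" by (metis floor_log_zero neq0_conv)
  have "(2::nat) ^ v \<le> 2 ^ floor_log ?a" using Suc.prems by (intro power_increasing) auto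
  also have "\<dots> \<le> ?a" using floor_log_exp2_le \<open>0 < ?a\<close> by blast
  finally have "exp_it k (2 ^ v) \<le> n" by (intro Suc.IH) auto
  then show ?case using exp_it_add[of k 1 v] by simp
qed simp

lemma floor_log_exp_it: "(floor_log ^^ k) (exp_it k v) = v"
proof (induction k)
  case (Suc k)
  have "(floor_log ^^ Suc k) (exp_it (Suc k) v) = (floor_log ^^ k) (floor_log (exp_it (Suc k) v))"
    by (simp only: funpow_Suc_right o_apply)
  then show ?case using Suc by simp
qed simp

section \<open>Padding\<close>

lemma exec_start:
  "exec Or c t m S w S' w' \<Longrightarrow> S = T \<Longrightarrow> w = v \<Longrightarrow> exec Or c t m T v S' w'"
  by simp

text \<open>The separating 1 makes \<open>x\<close> recoverable even if it ends in zeros. The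
  \<open>+ 1\<close> keeps the power positive for the empty word too, as the comparison by
  logarithms requires.\<close>

definition pad :: "nat \<Rightarrow> nat \<Rightarrow> bool list \<Rightarrow> bool list" where
  "pad k K x = x @ True # replicate (exp_it k ((length x + 1) ^ K)) False"

definition pad_com :: "nat \<Rightarrow> nat \<Rightarrow> com" where
  "pad_com k K =
     (load 0 1 2 ;; While 1 (IfTop 1 2 (Pop 1 ;; Emit False) (Pop 1 ;; Emit True)) ;; Push 2 1 ;; Emit True ;;
      pow_com K 3 2 4 5 ;; rep k (exp_com 3 4 5) ;; While 3 (Pop 3 ;; Emit False) ;;
      IfQ (Push 6 2) (Push 6 1))"

definition pad_cost :: "nat \<Rightarrow> nat \<Rightarrow> nat \<Rightarrow> nat" where
  "pad_cost k K n = n * 13 + K * 24 * (n + 1) ^ K + k * 30 * (exp_it k ((n + 1) ^ K)) ^ 2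
     + exp_it k ((n + 1) ^ K) * 4 + 20"

text \<open>The answer to the only query is the result. The cost is polynomial in the length of the
  word that is asked, hence of level \<open>k\<close>.\<close>

lemma exec_pad_com:
  "\<exists>S w. exec Or (pad_com k K) (pad_cost k K (length x)) 1 (input x) [] S w \<and>
     S 6 = [if pad k K x \<in> Or then 2 else 1]"
proof -
  let ?n = "length x" and ?u = "(length x + 1) ^ K" and ?code = "map (\<lambda>b. bitsym b + 1)"
  let ?V = "exp_it k ?u"
  let ?S = "\<lambda>y n e. (input x)(0 := [], 1 := y, 2 := unary n, 3 := unary e)"
  have 1: "exec Or (load 0 1 2) (?n * 7 + 2) 0 (input x) [] (?S (?code x) ?n 0) []"
    by (rule exec_cong[OF exec_load[of _ _ "rev x"]]) (auto simp: input_def rev_map fun_eq_iff)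
  let ?c = "IfTop 1 2 (Pop 1 ;; Emit False) (Pop 1 ;; Emit True)"
  let ?F = "\<lambda>i. ?S (?code (drop i x)) ?n 0"
  have 2: "exec Or (While 1 ?c) (?n * (4 + 2) + 2) 0 (?F 0) (take 0 x) (?F ?n) (take ?n x)"
  proof (rule exec_while)
    fix i assume i: "i < ?n"
    have top: "?F i 1 = (bitsym (x ! i) + 1) # ?code (drop (Suc i) x)"
      using i by (simp add: Cons_nth_drop_Suc[symmetric])
    have e: "exec Or (Pop 1 ;; Emit (x ! i)) (1 + 1) (0 + 0) (?F i) (take i x) (?F (Suc i)) (take (Suc i) x)"
      by (rule exec_cong[OF Seq[OF Pop Emit]]) (use i top in \<open>auto simp: fun_eq_iff take_Suc_conv_app_nth\<close>)
    have "exec Or ?c (1 + 1 + 2) (0 + 0) (?F i) (take i x) (?F (Suc i)) (take (Suc i) x)"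
    proof (cases "x ! i")
      case False
      show ?thesis by (rule IfT) (use e top False in auto)
    next
      case True
      show ?thesis by (rule IfF) (use e top True in auto)
    qed
    then have "exec Or ?c 4 0 (?F i) (take i x) (?F (Suc i)) (take (Suc i) x)"
      by (rule exec_cong) auto
    then show "?F i 1 \<noteq> [] \<and> exec Or ?c 4 0 (?F i) (take i x) (?F (Suc i)) (take (Suc i) x)"
      using top by simp
  qed simp
  have 2: "exec Or (While 1 ?c) (?n * (4 + 2) + 2) 0 (?S (?code x) ?n 0) [] (?S [] ?n 0) x"
    by (rule exec_start[OF exec_cong[OF 2]]) (auto simp: fun_eq_iff)
  have 3: "exec Or (Push 2 1) 1 0 (?S [] ?n 0) x (?S [] (?n + 1) 0) x"
    by (rule exec_cong[OF Push]) (auto simp: fun_eq_iff)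
  have 4: "exec Or (Emit True) 1 0 (?S [] (?n + 1) 0) x (?S [] (?n + 1) 0) (x @ [True])"
    by (rule Emit)
  have 5: "exec Or (pow_com K 3 2 4 5) (1 + K * 24 * ?u) 0 (?S [] (?n + 1) 0) (x @ [True])
      (?S [] (?n + 1) ?u) (x @ [True])"
    by (rule exec_cong[OF exec_pow_com[where b = "?n + 1"]]) (auto simp: input_def fun_eq_iff)
  have 6: "exec Or (rep k (exp_com 3 4 5)) (k * 30 * ?V ^ 2) 0 (?S [] (?n + 1) ?u) (x @ [True])
      (?S [] (?n + 1) ?V) (x @ [True])"
    by (rule exec_cong[OF exec_rep_exp[where n = ?u]]) (auto simp: input_def fun_eq_iff)
  let ?G = "\<lambda>i. ?S [] (?n + 1) (?V - i)" and ?W = "\<lambda>i. x @ True # replicate i False"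
  have 7: "exec Or (While 3 (Pop 3 ;; Emit False)) (?V * (2 + 2) + 2) 0 (?G 0) (?W 0) (?G ?V) (?W ?V)"
  proof (rule exec_while)
    fix i assume i: "i < ?V"
    have "exec Or (Pop 3 ;; Emit False) 2 0 (?G i) (?W i) (?G (Suc i)) (?W (Suc i))"
      by (rule exec_cong[OF Seq[OF Pop Emit]])
        (use i in \<open>auto simp: fun_eq_iff replicate_append_same\<close>)
    then show "?G i 3 \<noteq> [] \<and> exec Or (Pop 3 ;; Emit False) 2 0 (?G i) (?W i) (?G (Suc i)) (?W (Suc i))"
      using i by simp
  qed simp
  have 7: "exec Or (While 3 (Pop 3 ;; Emit False)) (?V * (2 + 2) + 2) 0 (?S [] (?n + 1) ?V) (x @ [True])
      (?S [] (?n + 1) 0) (pad k K x)"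
    by (rule exec_start[OF exec_cong[OF 7]]) (auto simp: pad_def)
  let ?a = "if pad k K x \<in> Or then 2 else 1"
  let ?T = "?S [] (?n + 1) 0"
  have 8: "exec Or (IfQ (Push 6 2) (Push 6 1)) (1 + 2) (Suc 0) ?T (pad k K x) (?T(6 := ?a # ?T 6)) []"
  proof (cases "pad k K x \<in> Or")
    case True
    have "exec Or (IfQ (Push 6 2) (Push 6 1)) (1 + 2) (Suc 0) ?T (pad k K x) (?T(6 := 2 # ?T 6)) []"
      by (rule QueryT[OF True Push])
    then show ?thesis using True by simp
  next
    case False
    have "exec Or (IfQ (Push 6 2) (Push 6 1)) (1 + 2) (Suc 0) ?T (pad k K x) (?T(6 := 1 # ?T 6)) []"
      by (rule QueryF[OF False Push])
    then show ?thesis using False by simp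
  qed
  have "exec Or (pad_com k K) (pad_cost k K ?n) 1 (input x) [] (?T(6 := ?a # ?T 6)) []"
    unfolding pad_com_def
    by (rule exec_cong[OF Seq[OF 1 Seq[OF 2 Seq[OF 3 Seq[OF 4 Seq[OF 5 Seq[OF 6 Seq[OF 7 8]]]]]]]])
      (simp_all add: pad_cost_def)
  then show ?thesis by (intro exI conjI, assumption) (simp add: input_def)
qed

lemma wf_pad_com: "wf_com 7 4 (pad_com k K)"
  by (simp add: pad_com_def load_def pow_com_def mul_com_def exp_com_def double_def transfer_def wf_rep)

lemma grow_pad_cost: "grow k (pad_cost k K)"
proof -
  \<comment> \<open>From 2 on \<open>n + 1\<close> is at most \<open>n ^ 2\<close>, so doubling the
    exponent absorbs the shift of the argument.\<close>
  have "(n + 1) ^ K \<le> n ^ (2 * K)" if "2 \<le> n" for n :: nat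
  proof -
    have "n + 1 \<le> n * 2" "n * 2 \<le> n * n" using that by auto
    then have "n + 1 \<le> n ^ 2" unfolding power2_eq_square by linarith
    then have "(n + 1) ^ K \<le> (n ^ 2) ^ K" by (rule power_mono) simp
    then show ?thesis by (simp add: power_mult)
  qed
  then have "grow k (\<lambda>n. exp_it k ((n + 1) ^ K))"
    by (intro grow_mono[OF grow_exp_it[of k "2 * K"]] exp_it_mono)
  then show ?thesis unfolding pad_cost_def[abs_def] by (intro grow_intros)
qed

section \<open>Recognising padded words\<close>

definition zeros :: "bool list \<Rightarrow> nat" where
  "zeros y = length (takeWhile Not (rev y))"

text \<open>A word without a 1 gets the empty core, since \<open>tl []\<close> is \<open>[]\<close>.
  Whether such a word passes the test for padding is immaterial: only words of the form
  \<open>pad k K x\<close> are ever asked.\<close>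

definition core :: "bool list \<Rightarrow> bool list" where
  "core y = rev (tl (dropWhile Not (rev y)))"

text \<open>Comparing on the side of the logarithms keeps the test polynomial in the length of
  \<open>y\<close>, even if exp_k of the left side is much longer than \<open>y\<close>. An
  inequality is enough, because additional zeros only allow the simulation more time.\<close>

definition padded :: "nat \<Rightarrow> nat \<Rightarrow> bool list \<Rightarrow> bool" where
  "padded k K y \<longleftrightarrow> (length (core y) + 1) ^ K \<le> (floor_log ^^ k) (zeros y)"

lemma zeros_pad: "zeros (pad k K x) = exp_it k ((length x + 1) ^ K)"
  and core_pad: "core (pad k K x) = x"
  by (auto simp: zeros_def core_def pad_def takeWhile_append dropWhile_append)

lemma padded_pad: "padded k K (pad k K x)"
  by (simp add: padded_def zeros_pad core_pad floor_log_exp_it)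

lemma zeros_le: "zeros y \<le> length y"
  unfolding zeros_def by (metis length_rev length_takeWhile_le)

lemma core_le: "length (core y) \<le> length y"
proof -
  have "length (dropWhile Not (rev y)) \<le> length y" by (metis length_dropWhile_le length_rev)
  then show ?thesis by (simp add: core_def)
qed

text \<open>This is the time allowance: as exp_(k+i) is exp_i of exp_k, a simulation of level
  \<open>k + i\<close> on the core becomes one of level \<open>i\<close> on
  \<open>y\<close>.\<close>

lemma padded_exp_it:
  assumes "padded k K y"
  shows "exp_it k ((length (core y)) ^ K) \<le> length y"
proof -
  have "exp_it k ((length (core y) + 1) ^ K) \<le> zeros y"
    using assms by (intro exp_it_le_if_floor_log) (auto simp: padded_def)
  moreover have "exp_it k (length (core y) ^ K) \<le> exp_it k ((length (core y) + 1) ^ K)"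
    by (intro exp_it_mono power_mono) auto
  ultimately show ?thesis using zeros_le[of y] by linarith
qed

text \<open>A loop ends only on an empty stack, so stack 10 acts as a flag. The trailing zeros lie
  on top of stack 0, because the input is stored reversed; the final pop removes the separating
  1.\<close>

definition strip_com :: com where
  "strip_com = (Push 10 1 ;; While 10 (IfTop 0 1 (Pop 0 ;; Push 1 1) (Pop 10)) ;; Pop 0)"

lemma exec_strip_loop:
  assumes "S 0 = map bitsym z" "S 1 = unary j" "S 10 = [1]"
  shows "exec Or (While 10 (IfTop 0 1 (Pop 0 ;; Push 1 1) (Pop 10))) (length z * 6 + 7) 0 S w
    (S(0 := map bitsym (dropWhile Not z), 1 := unary (j + length (takeWhile Not z)), 10 := [])) w"
  using assms
proof (induction z arbitrary: S j)
  case Nil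
  have 1: "exec Or (IfTop 0 1 (Pop 0 ;; Push 1 1) (Pop 10)) (1 + 2) 0 S w (S(10 := [])) w"
    by (rule IfF) (use Nil Pop[of Or 10 S w] in auto)
  show ?case
    by (rule exec_cong[OF WhileStep[OF _ 1 WhileEnd]]) (use Nil in \<open>auto simp: fun_eq_iff\<close>)
next
  case (Cons b z)
  show ?case
  proof (cases b)
    case True
    have 1: "exec Or (IfTop 0 1 (Pop 0 ;; Push 1 1) (Pop 10)) (1 + 2) 0 S w (S(10 := [])) w"
      by (rule IfF) (use Cons.prems True Pop[of Or 10 S w] in auto)
    show ?thesis
      by (rule exec_cong[OF WhileStep[OF _ 1 WhileEnd]]) (use Cons.prems True in \<open>auto simp: fun_eq_iff\<close>)
  next
    case False
    let ?S = "S(0 := map bitsym z, 1 := unary (Suc j))"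
    have 1: "exec Or (Pop 0 ;; Push 1 1) (1 + 1) (0 + 0) S w ?S w"
      by (rule exec_cong[OF Seq[OF Pop Push]]) (use Cons.prems in \<open>auto simp: fun_eq_iff\<close>)
    have 2: "exec Or (IfTop 0 1 (Pop 0 ;; Push 1 1) (Pop 10)) (1 + 1 + 2) (0 + 0) S w ?S w"
      by (rule IfT[OF _ 1]) (use Cons.prems False in simp)
    have 3: "exec Or (While 10 (IfTop 0 1 (Pop 0 ;; Push 1 1) (Pop 10))) (length z * 6 + 7) 0 ?S w
        (?S(0 := map bitsym (dropWhile Not z), 1 := unary (Suc j + length (takeWhile Not z)), 10 := [])) w"
      by (rule Cons.IH) (use Cons.prems in auto)
    show ?thesis
      by (rule exec_cong[OF WhileStep[OF _ 2 3]]) (use Cons.prems False in \<open>auto simp: fun_eq_iff\<close>)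
  qed
qed

text \<open>Stack 1 holds the number of zeros and then its iterated logarithm, stack 2 the length of
  the core plus one, stack 3 the \<open>K\<close>-th power of that, and stack 7 the core as a tape.
  Stacks 1 and 3 are then popped in parallel, and stack 11 collects a mark for each unit by which
  stack 3 exceeds stack 1; the simulation runs only if there is no mark.\<close>

definition unpad_com :: "nat \<Rightarrow> nat \<Rightarrow> machine \<Rightarrow> nat \<Rightarrow> ((nat \<times> nat) \<times> nat \<times> nat \<times> move \<times> bool option) list \<Rightarrow> com" where
  "unpad_com k K M B ds =
     (strip_com ;; load 0 7 2 ;; Push 2 1 ;; rep k (log_com 1 4 5) ;; pow_com K 3 2 4 5 ;;
      While 3 (Pop 3 ;; IfTop 1 0 (Push 11 1) (Pop 1)) ;;
      IfTop 11 0 (Push 8 (start M + 1) ;; While 8 (plain_body M B 6 7 8 9 ds)) (Push 9 1))"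

definition unpad_cost :: "nat \<Rightarrow> nat \<Rightarrow> nat \<Rightarrow> nat \<Rightarrow> 'a list \<Rightarrow> nat \<Rightarrow> nat" where
  "unpad_cost i k K B ds n = n * 13 + k * 30 * (n + 1) ^ 2 + K * 24 * (n + 1) ^ K + (n + 1) ^ K * 6
     + (K * exp_it i n + K + 2) * plain_cost B ds + 30"

lemma exec_unpad_com:
  assumes M: "fits M B" "set ds = delta M" "wf_machine M" "deterministic M"
    and dec: "decides M Or (bound (k + i) K) Q L"
  shows "\<exists>m S w. exec Or (unpad_com k K M B ds) (unpad_cost i k K B ds (length y)) m (input y) [] S w \<and>
     (topsym (S 9) = 2 \<longleftrightarrow> padded k K y \<and> core y \<in> L)"
proof -
  let ?n = "length y" and ?z = "dropWhile Not (rev y)" and ?x = "core y"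
  let ?N = "length ?x + 1"
  let ?S = "\<lambda>a b c d f r. (input y)(0 := a, 1 := unary b, 2 := unary c, 3 := unary d, 11 := unary f, 7 := r)"
  let ?code = "map (\<lambda>b. bitsym b + 1)"
  have 1: "exec Or strip_com (1 + (?n * 6 + 7 + 1)) (0 + (0 + 0)) (input y) [] (?S (map bitsym (tl ?z)) (zeros y) 0 0 0 []) []"
  proof -
    let ?T = "(input y)(10 := [1])"
    have 1: "exec Or (Push 10 1) 1 0 (input y) [] ?T []"
      by (rule exec_cong[OF Push]) (auto simp: input_def)
    have 2: "exec Or (While 10 (IfTop 0 1 (Pop 0 ;; Push 1 1) (Pop 10))) (length (rev y) * 6 + 7) 0 ?T []
        (?T(0 := map bitsym ?z, 1 := unary (0 + length (takeWhile Not (rev y))), 10 := [])) []"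
      by (rule exec_strip_loop) (auto simp: input_def rev_map)
    show ?thesis unfolding strip_com_def
      by (rule exec_cong[OF Seq[OF 1 Seq[OF 2 Pop]]]) (auto simp: fun_eq_iff input_def zeros_def map_tl)
  qed
  have lx: "length (tl ?z) = length ?x" "rev (tl ?z) = ?x" by (auto simp: core_def)
  have 2: "exec Or (load 0 7 2) (?n * 7 + 2) 0 (?S (map bitsym (tl ?z)) (zeros y) 0 0 0 []) []
      (?S [] (zeros y) (length ?x) 0 0 (?code ?x)) []"
    by (rule exec_cong[OF exec_load[of _ _ "tl ?z"]])
      (use core_le[of y] lx in \<open>auto simp: fun_eq_iff rev_map\<close>)
  have 3: "exec Or (Push 2 1) 1 0 (?S [] (zeros y) (length ?x) 0 0 (?code ?x)) []
      (?S [] (zeros y) ?N 0 0 (?code ?x)) []"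
    by (rule exec_cong[OF Push]) (auto simp: fun_eq_iff)
  let ?l = "(floor_log ^^ k) (zeros y)"
  have "k * 30 * (zeros y + 1) ^ 2 \<le> k * 30 * (?n + 1) ^ 2"
    using zeros_le[of y] by (intro mult_le_mono power_mono) auto
  then have 4: "exec Or (rep k (log_com 1 4 5)) (k * 30 * (?n + 1) ^ 2) 0 (?S [] (zeros y) ?N 0 0 (?code ?x)) []
      (?S [] ?l ?N 0 0 (?code ?x)) []"
    by (intro exec_cong[OF exec_rep_log[where n = "zeros y"]]) (auto simp: fun_eq_iff input_def)
  let ?e = "?N ^ K"
  have e: "?e \<le> (?n + 1) ^ K" using core_le[of y] by (intro power_mono) auto
  then have "1 + K * 24 * ?e \<le> 1 + K * 24 * (?n + 1) ^ K" by simp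
  then have 5: "exec Or (pow_com K 3 2 4 5) (1 + K * 24 * (?n + 1) ^ K) 0 (?S [] ?l ?N 0 0 (?code ?x)) []
      (?S [] ?l ?N ?e 0 (?code ?x)) []"
    by (intro exec_cong[OF exec_pow_com[where b = ?N]]) (auto simp: fun_eq_iff input_def)
  \<comment> \<open>Truncated subtraction describes the comparison before and after stack 1 runs
    out; marks appear on stack 11 only afterwards.\<close>
  let ?F = "\<lambda>j. ?S [] (?l - j) ?N (?e - j) (j - ?l) (?code ?x)"
  let ?c = "Pop 3 ;; IfTop 1 0 (Push 11 1) (Pop 1)"
  have 6: "exec Or (While 3 ?c) (?e * (4 + 2) + 2) 0 (?F 0) [] (?F ?e) []"
  proof (rule exec_while)
    fix j assume j: "j < ?e"
    let ?G = "?S [] (?l - j) ?N (?e - Suc j) (j - ?l) (?code ?x)"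
    have 1: "exec Or (Pop 3) 1 0 (?F j) [] ?G []"
      by (rule exec_cong[OF Pop]) (use j in \<open>auto simp: fun_eq_iff\<close>)
    have 2: "exec Or (IfTop 1 0 (Push 11 1) (Pop 1)) (1 + 2) 0 ?G [] (?F (Suc j)) []"
    proof (cases "?l \<le> j")
      case True
      then have "Suc j - ?l = Suc (j - ?l)" "?l - j = 0" "?l - Suc j = 0" by auto
      then have "exec Or (Push 11 1) 1 0 ?G [] (?F (Suc j)) []"
        by (intro exec_cong[OF Push]) (auto simp: fun_eq_iff)
      then show ?thesis by (rule IfT[rotated]) (use True in simp)
    next
      case False
      then have "Suc j - ?l = 0" "?l - j = Suc (?l - Suc j)" "j - ?l = 0" by auto
      then have "exec Or (Pop 1) 1 0 ?G [] (?F (Suc j)) []"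
        by (intro exec_cong[OF Pop]) (auto simp: fun_eq_iff)
      then show ?thesis by (rule IfF[rotated]) (use False in \<open>simp add: Suc_diff_Suc[symmetric]\<close>)
    qed
    have "exec Or ?c 4 0 (?F j) [] (?F (Suc j)) []" by (rule exec_cong[OF Seq[OF 1 2]]) auto
    then show "?F j 3 \<noteq> [] \<and> exec Or ?c 4 0 (?F j) [] (?F (Suc j)) []" using j by simp
  qed simp
  let ?G = "?S [] (?l - ?e) ?N 0 (?e - ?l) (?code ?x)"
  have 6: "exec Or (While 3 ?c) ((?n + 1) ^ K * 6 + 2) 0 (?S [] ?l ?N ?e 0 (?code ?x)) [] ?G []"
    by (rule exec_start[OF exec_cong[OF 6]]) (use e in auto)
  let ?X = "(K * exp_it i ?n + K + 2) * plain_cost B ds"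
  have "\<exists>m S w. exec Or (IfTop 11 0 (Push 8 (start M + 1) ;; While 8 (plain_body M B 6 7 8 9 ds)) (Push 9 1))
      (?X + 3) m ?G [] S w \<and> (topsym (S 9) = 2 \<longleftrightarrow> padded k K y \<and> core y \<in> L)"
  proof (cases "padded k K y")
    case True
    then have el: "?e - ?l = 0" by (simp add: padded_def)
    let ?H = "?G(8 := (start M + 1) # ?G 8)"
    have "\<exists>m S w. exec Or (While 8 (plain_body M B 6 7 8 9 ds))
      ((bound (k + i) K (length ?x) + 2) * plain_cost B ds) m ?H [] S w \<and>
      S 8 = [] \<and> S 9 = (if ?x \<in> L then 2 else 1) # ?H 9 \<and> (\<forall>s. s \<notin> {6, 7, 8, 9} \<longrightarrow> S s = ?H s)"
      by (rule exec_plain[OF _ M dec]) (auto simp: input_def)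
    then obtain m S w where 7: "exec Or (While 8 (plain_body M B 6 7 8 9 ds))
      ((bound (k + i) K (length ?x) + 2) * plain_cost B ds) m ?H [] S w"
      and S: "S 9 = (if ?x \<in> L then 2 else 1) # ?H 9" by blast
    have "exp_it (k + i) (length ?x ^ K) = exp_it i (exp_it k (length ?x ^ K))" by (simp add: exp_it_add)
    also have "\<dots> \<le> exp_it i ?n" by (rule exp_it_mono[OF padded_exp_it[OF True]])
    finally have "bound (k + i) K (length ?x) \<le> K * exp_it i ?n + K" by (simp add: bound_def)
    then have b: "(bound (k + i) K (length ?x) + 2) * plain_cost B ds \<le> ?X" by (intro mult_le_mono1) simp
    have "exec Or (IfTop 11 0 (Push 8 (start M + 1) ;; While 8 (plain_body M B 6 7 8 9 ds)) (Push 9 1))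
      (1 + (bound (k + i) K (length ?x) + 2) * plain_cost B ds + 2) (0 + m) ?G [] S w"
      by (rule IfT[OF _ Seq[OF Push 7]]) (use el in simp)
    then have "exec Or (IfTop 11 0 (Push 8 (start M + 1) ;; While 8 (plain_body M B 6 7 8 9 ds)) (Push 9 1))
      (?X + 3) m ?G [] S w" by (rule exec_cong) (use b in auto)
    moreover have "topsym (S 9) = 2 \<longleftrightarrow> padded k K y \<and> core y \<in> L" using S True by simp
    ultimately show ?thesis by blast
  next
    case False
    then have el: "?e - ?l \<noteq> 0" by (simp add: padded_def)
    have "exec Or (IfTop 11 0 (Push 8 (start M + 1) ;; While 8 (plain_body M B 6 7 8 9 ds)) (Push 9 1))
      (1 + 2) 0 ?G [] (?G(9 := 1 # ?G 9)) []"
      by (rule IfF[OF _ Push]) (use el in \<open>cases "?e - ?l"; simp\<close>)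
    then have "exec Or (IfTop 11 0 (Push 8 (start M + 1) ;; While 8 (plain_body M B 6 7 8 9 ds)) (Push 9 1))
      (?X + 3) 0 ?G [] (?G(9 := 1 # ?G 9)) []" by (rule exec_cong) auto
    moreover have "topsym ((?G(9 := 1 # ?G 9)) 9) = 2 \<longleftrightarrow> padded k K y \<and> core y \<in> L" using False by simp
    ultimately show ?thesis by blast
  qed
  then obtain m S w where 7: "exec Or (IfTop 11 0 (Push 8 (start M + 1) ;; While 8 (plain_body M B 6 7 8 9 ds)) (Push 9 1))
      (?X + 3) m ?G [] S w" and S: "topsym (S 9) = 2 \<longleftrightarrow> padded k K y \<and> core y \<in> L" by blast
  have "exec Or (unpad_com k K M B ds) (unpad_cost i k K B ds ?n) m (input y) [] S w"
    unfolding unpad_com_def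
    by (rule exec_cong[OF Seq[OF 1 Seq[OF 2 Seq[OF 3 Seq[OF 4 Seq[OF 5 Seq[OF 6 7]]]]]]])
      (simp_all add: unpad_cost_def)
  then show ?thesis using S by blast
qed

lemma wf_unpad_com:
  assumes "fits M B" "set ds = delta M"
  shows "wf_com 12 B (unpad_com k K M B ds)"
proof -
  have "3 < B" "start M + 1 < B" using assms by (auto simp: fits_def)
  moreover have "wf_com 12 B (plain_body M B 6 7 8 9 ds)"
    by (rule wf_sim_body) (use assms in \<open>auto simp: query_com_def fits_def\<close>)
  ultimately show ?thesis
    by (simp add: unpad_com_def strip_com_def load_def pow_com_def mul_com_def log_com_def halve_def
        transfer_def wf_rep)
qed

text \<open>The oracle \<open>Or\<close> moves one level inwards: the program for \<open>A\<close>
  asks \<open>Or\<close>, whereas the program for \<open>L\<close> asks only \<open>A\<close>. Since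
  \<open>core\<close> undoes \<open>pad\<close> and padded inputs pass the test, membership of
  \<open>x\<close> in \<open>L\<close> is membership of its padding in \<open>A\<close>.\<close>

theorem relativized_padding:
  "DEXP_rel (k + i) D \<subseteq> DEXP_rel_q k 1 (DEXP_rel i D)"
proof
  fix L assume "L \<in> DEXP_rel (k + i) D"
  then obtain Or K M where Or: "Or \<in> D" and M: "wf_machine M" "deterministic M"
      "decides M Or (bound (k + i) K) (bound (k + i) K) L"
    unfolding DEXP_rel_iff by blast
  obtain ds where ds: "set ds = delta M" using M(1) finite_list unfolding wf_machine_def by blast
  obtain B where fits: "fits M B" using fits_exists M(1) unfolding wf_machine_def by blast
  define A where "A = {y. padded k K y \<and> core y \<in> L}"
  have "A \<in> DEXP_rel i D"
  proof (rule compile_OClass[OF wf_unpad_com[OF fits ds, of k K]])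
    show "grow i (unpad_cost i k K B ds)"
      unfolding unpad_cost_def[abs_def]
      by (intro grow_intros) (use grow_exp_it[of i 1] in simp)
    show "Or \<in> D" by (rule Or)
    show "\<exists>q S' w'. exec Or (unpad_com k K M B ds) (unpad_cost i k K B ds (length x)) q (input x) [] S' w' \<and>
        (topsym (S' 9) = 2 \<longleftrightarrow> x \<in> A) \<and> (case None of None \<Rightarrow> True | Some r \<Rightarrow> q \<le> r)" for x
      using exec_unpad_com[OF fits ds M, of x] by (simp add: A_def)
    show "3 \<le> B" using fits by (simp add: fits_def)
  qed auto
  show "L \<in> DEXP_rel_q k 1 (DEXP_rel i D)"
  proof (rule compile_OClass[OF wf_pad_com[of k K] _ _ _ grow_pad_cost \<open>A \<in> DEXP_rel i D\<close>])
    fix x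
    have "pad k K x \<in> A \<longleftrightarrow> x \<in> L" by (simp add: A_def padded_pad core_pad)
    moreover obtain S w where "exec A (pad_com k K) (pad_cost k K (length x)) 1 (input x) [] S w"
      "S 6 = [if pad k K x \<in> A then 2 else 1]" using exec_pad_com by blast
    ultimately show "\<exists>q S' w'. exec A (pad_com k K) (pad_cost k K (length x)) q (input x) [] S' w' \<and>
        (topsym (S' 6) = 2 \<longleftrightarrow> x \<in> L) \<and> (case Some 1 of None \<Rightarrow> True | Some r \<Rightarrow> q \<le> r)"
      by (intro exI[of _ 1] exI[of _ S] exI[of _ w]) simp
  qed auto
qed

theorem mainTheorem3:
  fixes i j k c :: nat
  assumes "k \<le> i + j"
  shows "DEXP_rel i (DEXP_rel j (SigmaP c)) \<subseteq> DEXP_rel (i + j) (SigmaP c)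
       \<and> DEXP_rel (i + j) (SigmaP c) \<subseteq> DEXP_rel_q k 1 (DEXP_rel (i + j - k) (SigmaP c))"
proof
  show "DEXP_rel i (DEXP_rel j (SigmaP c)) \<subseteq> DEXP_rel (i + j) (SigmaP c)"
    by (rule relativized_composition)
  show "DEXP_rel (i + j) (SigmaP c) \<subseteq> DEXP_rel_q k 1 (DEXP_rel (i + j - k) (SigmaP c))"
    using relativized_padding[of k "i + j - k" "SigmaP c"] assms by simp
qed

end
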